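(* Let $(Z_i)_{i\in\mathbb N}$ be independent centred real random variables with $\mathbb E(Z_i^2)=1$ and $\sup_i\mathbb E|Z_i|^q<\infty$ for every $q\ge1$. For $p\in(0,\frac12)$ let $S_{n,p}=n^{-(1-p)}\sum_{i,j=1}^n1_{\{i\neq j\}}|i-j|^{-p}Z_iZ_j$, let $\psi_p(s,t)=|s-t|^{-p}$ on $[0,1]^2$, and let $I_2(\psi_p)=\int_0^1\int_0^1\psi_p(s,t)\,dW_sdW_t$ denote the double Wiener–Itô integral with respect to a standard Brownian motion $W$. Then for every $\theta\in(\frac14,1)$ there exist $n_*$ and $C$ such that for $n\ge n_*$, $$d_{Kol}(S_{n,p},I_2(\psi_p))\le Cn^{-\theta(1-2p)/15}.$$ If moreover there exist $\varepsilon,r,R>0$ and $x_i\in\mathbb R$ with $\sup_i|x_i|\le R$ and $\mathbb P(Z_i\in A)\ge\varepsilon\,\mathrm{Leb}(A)$ for all measurable $A\subset(x_i-r,x_i+r)$, then for every $\theta\in(\frac14,1)$ there exist $n_*$ and $C$ such that for $n\ge n_*$, $$d_{TV}(S_{n,p},I_2(\psi_p))\le Cn^{-(\frac{\theta}{26}\wedge\frac{\theta(1-2p)}{15})}.$$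
   Context: $d_{Kol}(F,G)=\sup_x|\mathbb P(F\le x)-\mathbb P(G\le x)|$; $d_{TV}(F,G)=\sup\{|\mathbb Ef(F)-\mathbb Ef(G)|:f\text{ measurable},\|f\|_\infty\le1\}$. Since $p<\frac12$, $\psi_p\in L^2([0,1]^2)$. *)

theory Defs
  imports "HOL-Probability.Probability"
begin

definition d_kol :: "'a measure \<Rightarrow> ('a \<Rightarrow> real) \<Rightarrow> 'b measure \<Rightarrow> ('b \<Rightarrow> real) \<Rightarrow> real" where
  "d_kol M X N Y = (SUP x::real. \<bar>measure M {\<omega> \<in> space M. X \<omega> \<le> x} - measure N {\<omega> \<in> space N. Y \<omega> \<le> x}\<bar>)"

definition d_tv :: "'a measure \<Rightarrow> ('a \<Rightarrow> real) \<Rightarrow> 'b measure \<Rightarrow> ('b \<Rightarrow> real) \<Rightarrow> real" where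
  "d_tv M X N Y = (SUP f \<in> {f :: real \<Rightarrow> real. f \<in> borel_measurable borel \<and> (\<forall>x. \<bar>f x\<bar> \<le> 1)}.
      \<bar>(\<integral>\<omega>. f (X \<omega>) \<partial>M) - (\<integral>\<omega>. f (Y \<omega>) \<partial>N)\<bar>)"

definition std_BM :: "'b measure \<Rightarrow> (real \<Rightarrow> 'b \<Rightarrow> real) \<Rightarrow> bool" where
  "std_BM N W \<longleftrightarrow> prob_space N \<and>
     (\<forall>t. W t \<in> borel_measurable N) \<and>
     (\<forall>\<omega>\<in>space N. W 0 \<omega> = 0 \<and> continuous_on {0..} (\<lambda>t. W t \<omega>)) \<and>
     (\<forall>s t. 0 \<le> s \<and> s < t \<longrightarrow>
        distributed N lborel (\<lambda>\<omega>. W t \<omega> - W s \<omega>) (\<lambda>x. ennreal (normal_density 0 (sqrt (t - s)) x))) \<and>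
     (\<forall>ts. sorted_wrt (<) ts \<and> set ts \<subseteq> {0..} \<longrightarrow>
        prob_space.indep_vars N (\<lambda>_. borel) (\<lambda>k \<omega>. W (ts ! Suc k) \<omega> - W (ts ! k) \<omega>) {..<length ts - 1})"

definition elem_admissible :: "real list \<Rightarrow> (nat \<Rightarrow> nat \<Rightarrow> real) \<Rightarrow> bool" where
  "elem_admissible ts a \<longleftrightarrow> sorted_wrt (<) ts \<and> set ts \<subseteq> {0..1} \<and> (\<forall>j. a j j = 0)"

definition elem_kernel :: "real list \<Rightarrow> (nat \<Rightarrow> nat \<Rightarrow> real) \<Rightarrow> real \<times> real \<Rightarrow> real" where
  "elem_kernel ts a = (\<lambda>(s, t). \<Sum>j<length ts - 1. \<Sum>k<length ts - 1.
      a j k * indicator {ts ! j..<ts ! Suc j} s * indicator {ts ! k..<ts ! Suc k} t)"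

definition elem_I2 :: "(real \<Rightarrow> 'b \<Rightarrow> real) \<Rightarrow> real list \<Rightarrow> (nat \<Rightarrow> nat \<Rightarrow> real) \<Rightarrow> 'b \<Rightarrow> real" where
  "elem_I2 W ts a \<omega> = (\<Sum>j<length ts - 1. \<Sum>k<length ts - 1.
      a j k * (W (ts ! Suc j) \<omega> - W (ts ! j) \<omega>) * (W (ts ! Suc k) \<omega> - W (ts ! k) \<omega>))"

definition is_double_WI :: "'b measure \<Rightarrow> (real \<Rightarrow> 'b \<Rightarrow> real) \<Rightarrow> (real \<times> real \<Rightarrow> real) \<Rightarrow> ('b \<Rightarrow> real) \<Rightarrow> bool" where
  "is_double_WI N W \<psi> X \<longleftrightarrow> X \<in> borel_measurable N \<and>
     (\<exists>tsq aq. (\<forall>n. elem_admissible (tsq n) (aq n)) \<and>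
        (\<lambda>n. \<integral>\<^sup>+ u. ennreal ((\<psi> u - elem_kernel (tsq n) (aq n) u)\<^sup>2) * indicator ({0..1} \<times> {0..1}) u \<partial>lborel)
           \<longlonglongrightarrow> 0 \<and>
        (\<lambda>n. \<integral>\<^sup>+ \<omega>. ennreal ((X \<omega> - elem_I2 W (tsq n) (aq n) \<omega>)\<^sup>2) \<partial>N) \<longlonglongrightarrow> 0)"

definition psi :: "real \<Rightarrow> real \<times> real \<Rightarrow> real" where
  "psi p = (\<lambda>(s, t). \<bar>s - t\<bar> powr (- p))"

definition S_np :: "(nat \<Rightarrow> 'a \<Rightarrow> real) \<Rightarrow> real \<Rightarrow> nat \<Rightarrow> 'a \<Rightarrow> real" where
  "S_np Z p n \<omega> = real n powr (- (1 - p)) *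
     (\<Sum>i\<in>{1..n}. \<Sum>j\<in>{1..n}. if i \<noteq> j then \<bar>real i - real j\<bar> powr (- p) * Z i \<omega> * Z j \<omega> else 0)"

end

theory Submission
  imports Defs
begin

text \<open>For a test function with three bounded derivatives, Lindeberg replacement exchanges the \<open>Z i\<close>
  for Gaussian variables at cost \<open>n powr (- 1 / 2)\<close>. Taking these to be normalised increments of \<open>W\<close>
  makes the sum a double integral of a step kernel, and the isometry bounds its \<open>L\<^sup>2\<close>-distance to
  \<open>X\<close> by \<open>n powr (- (1 - 2 * p) / 4)\<close> up to a constant.

  Passing to indicators and bounded measurable functions needs \<open>\<bar>E (\<phi>' S)\<bar> \<le> C * (sup \<bar>\<phi>\<bar> / \<surd>\<eta> + sup \<bar>\<phi>'\<bar> * (\<surd>\<eta> + 1 / n))\<close>.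
  By the lower bound on their laws the variables have, with positive probability, a smooth density. Let
  \<open>Y\<close> be the derivative of the quadratic form \<open>S\<close> along the vector \<open>n powr (- 1 / 2)\<close> on these
  coordinates. The derivative of \<open>Y\<close> in the same direction does not depend on their values and is
  bounded below with probability \<open>1 - O(1 / n)\<close>, since all coefficients exceed \<open>1 / n\<close>; so integration
  by parts shows first that \<open>Y\<close> is rarely of order \<open>\<surd>\<eta>\<close>, then the bound itself. Gaussian variables
  satisfy the lower bound, so the limit \<open>X\<close> inherits the estimate. Smoothing at scale
  \<open>n powr (- 2 * (1 - 2 * p) / 15)\<close> then gives the rate \<open>n powr (- (1 - 2 * p) / 15)\<close> for both distances.\<close>


section \<open>Lindeberg replacement for quadratic forms\<close>

text \<open>Two obstacles shape the regularity estimate. A single \<open>Z i\<close> may have atoms,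
  so its law cannot be differentiated as a whole; a random label on each coordinate marks the share
  of the mass that can. And the gradient of a quadratic form vanishes somewhere, so dividing by it
  needs a bound on how often it is small. A second derivative in the same fixed direction supplies
  this bound: it is a sum over pairs of labels, and as the kernel is at least 1 on the square all
  pairs contribute with the same sign. No small-ball inequality for polynomials is invoked. Let
  \<delta> be the smoothing scale. Three derivatives cost \<delta>^(-3) against n^(-1/2), one
  derivative costs \<delta>^(-1) against n^(-(1-2p)/4), and undoing the smoothing costs
  \<delta>^(1/2). With \<delta> = n^(-2(1-2p)/15) all three are at most of order n^(-(1-2p)/15),
  because 7(1-2p)/15 \<le> 1/2 and 3/15 \<le> 1/4. The claimed exponents are no larger. For the
  Kolmogorov distance monotonicity puts the whole cost of undoing the smoothing on \<open>X\<close>;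
  for total variation both laws have to be regular.\<close>

lemma PiM_component_integrable_iff:
  fixes f :: "'b \<Rightarrow> real"
  assumes "\<And>i. i \<in> I \<Longrightarrow> prob_space (M i)" "i \<in> I" "f \<in> borel_measurable (M i)"
  shows "integrable (PiM I M) (\<lambda>x. f (x i)) \<longleftrightarrow> integrable (M i) f"
proof -
  have "integrable (distr (PiM I M) (M i) (\<lambda>x. x i)) f \<longleftrightarrow> integrable (PiM I M) (\<lambda>x. f (x i))"
    using assms(2,3) by (intro integrable_distr_eq) auto
  then show ?thesis using distr_PiM_component[of I M i] assms(1,2) by simp
qed

text \<open>Fubini for a product in which one factor involves only the new coordinate. The premise
  \<open>upd\<close> encodes that \<open>g\<close> depends on the coordinates in \<open>J\<close>
  only; \<open>restrict\<close> appears because points of \<open>PiM J M\<close> are extensional.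
  The last two conclusions are the case \<open>f = 1\<close>.\<close>

lemma PiM_insert_mult:
  fixes f :: "'b \<Rightarrow> real" and g :: "('i \<Rightarrow> 'b) \<Rightarrow> real"
  assumes M: "\<And>j. prob_space (M j)" and J: "finite J" "i \<notin> J"
    and f: "integrable (M i) f" and g: "integrable (PiM J M) g"
    and upd: "\<And>x y. g (x(i := y)) = g (restrict x J)"
  shows "integrable (PiM (insert i J) M) (\<lambda>x. f (x i) * g x)"
    and "(\<integral>x. f (x i) * g x \<partial>PiM (insert i J) M) = (\<integral>y. f y \<partial>M i) * (\<integral>x. g x \<partial>PiM J M)"
    and "integrable (PiM (insert i J) M) g"
    and "(\<integral>x. g x \<partial>PiM (insert i J) M) = (\<integral>x. g x \<partial>PiM J M)"
proof -
  interpret MM: product_prob_space M "insert i J"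
    by (intro product_prob_spaceI M)
  interpret PJ: prob_space "PiM J M" by (intro prob_space_PiM M)
  interpret PP: pair_sigma_finite "M i" "PiM J M" ..
  have gr: "g x = g (restrict x J)" for x
    using upd[of x "x i"] by simp
  have gm: "g \<in> borel_measurable (PiM (insert i J) M)"
  proof -
    have "(\<lambda>x. g (restrict x J)) \<in> borel_measurable (PiM (insert i J) M)"
      using g by (auto intro!: measurable_compose[OF measurable_restrict_subset])
    then show ?thesis by (subst measurable_cong[OF gr])
  qed
  have main: "integrable (PiM (insert i J) M) (\<lambda>x. f (x i) * g x)
    \<and> (\<integral>x. f (x i) * g x \<partial>PiM (insert i J) M) = (\<integral>y. f y \<partial>M i) * (\<integral>x. g x \<partial>PiM J M)"
    if f: "integrable (M i) f" for f :: "'b \<Rightarrow> real"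
  proof -
    have [measurable]: "f \<in> borel_measurable (M i)" "g \<in> borel_measurable (PiM J M)"
      using f g by auto
    have m: "(\<lambda>x. f (x i) * g x) \<in> borel_measurable (PiM (insert i J) M)"
      using gm by measurable
    have eq: "distr (M i \<Otimes>\<^sub>M PiM J M) (PiM (insert i J) M) (\<lambda>(x, X). X(i := x)) = PiM (insert i J) M"
      by (intro distr_pair_PiM_eq_PiM) (use M in auto)
    have ip: "integrable (M i \<Otimes>\<^sub>M PiM J M) (\<lambda>(y, x). f y * g x)"
      by (rule PP.Fubini_integrable) (use f g in \<open>auto simp: abs_mult\<close>)
    have ig: "integrable (distr (M i \<Otimes>\<^sub>M PiM J M) (PiM (insert i J) M) (\<lambda>(x, X). X(i := x))) (\<lambda>x. f (x i) * g x)"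
      by (subst integrable_distr_eq) (use ip m in \<open>auto simp: upd gr[symmetric] case_prod_beta'\<close>)
    then have 1: "integrable (PiM (insert i J) M) (\<lambda>x. f (x i) * g x)" by (simp add: eq)
    have "(\<integral>x. f (x i) * g x \<partial>PiM (insert i J) M) = (\<integral>x. (\<integral>y. f ((x(i := y)) i) * g (x(i := y)) \<partial>M i) \<partial>PiM J M)"
      by (rule MM.product_integral_insert[OF J 1])
    also have "\<dots> = (\<integral>y. f y \<partial>M i) * (\<integral>x. g x \<partial>PiM J M)"
      by (simp add: upd gr[symmetric])
    finally show ?thesis using 1 by simp
  qed
  show "integrable (PiM (insert i J) M) (\<lambda>x. f (x i) * g x)"
    and "(\<integral>x. f (x i) * g x \<partial>PiM (insert i J) M) = (\<integral>y. f y \<partial>M i) * (\<integral>x. g x \<partial>PiM J M)"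
    using main[OF f] by auto
  show "integrable (PiM (insert i J) M) g" "(\<integral>x. g x \<partial>PiM (insert i J) M) = (\<integral>x. g x \<partial>PiM J M)"
    using main[of "\<lambda>_. 1"] by (auto simp: prob_space.prob_space[OF M])
qed

lemma sum_upd_eq:
  fixes f :: "'i \<Rightarrow> 'b \<Rightarrow> real"
  assumes "i \<notin> J"
  shows "(\<Sum>j\<in>J. f j ((x(i := y)) j)) = (\<Sum>j\<in>J. f j (restrict x J j))"
  using assms by (intro sum.cong) auto

text \<open>Every cross term contains a factor of mean zero. Integrability and values are proved in
  one induction, since expanding the square at \<open>insert i J\<close> needs all of them for
  \<open>J\<close>.\<close>

lemma PiM_sum_square:
  fixes f :: "'i \<Rightarrow> 'b \<Rightarrow> real"
  assumes M: "\<And>j. prob_space (M j)" and "finite J"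
    and f: "\<And>j. integrable (M j) (f j)" "\<And>j. (\<integral>y. f j y \<partial>M j) = 0"
    and f2: "\<And>j. integrable (M j) (\<lambda>y. (f j y)\<^sup>2)"
  shows "integrable (PiM J M) (\<lambda>x. \<Sum>j\<in>J. f j (x j)) \<and> (\<integral>x. (\<Sum>j\<in>J. f j (x j)) \<partial>PiM J M) = 0
    \<and> integrable (PiM J M) (\<lambda>x. (\<Sum>j\<in>J. f j (x j))\<^sup>2)
    \<and> (\<integral>x. (\<Sum>j\<in>J. f j (x j))\<^sup>2 \<partial>PiM J M) = (\<Sum>j\<in>J. (\<integral>y. (f j y)\<^sup>2 \<partial>M j))"
  using \<open>finite J\<close>
proof (induction J rule: finite_induct)
  case empty
  then show ?case
    using prob_space_PiM[of "{}" M] by (auto simp: prob_space.prob_space)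
next
  case (insert i J)
  let ?S = "\<lambda>x. \<Sum>j\<in>J. f j (x j)"
  note S = sum_upd_eq[of i J f, OF insert.hyps(2)]
  have IH: "integrable (PiM J M) ?S" "(\<integral>x. ?S x \<partial>PiM J M) = 0"
    "integrable (PiM J M) (\<lambda>x. (?S x)\<^sup>2)"
    "(\<integral>x. (?S x)\<^sup>2 \<partial>PiM J M) = (\<Sum>j\<in>J. (\<integral>y. (f j y)\<^sup>2 \<partial>M j))"
    using insert.IH by auto
  have S2: "(?S (x(i := y)))\<^sup>2 = (?S (restrict x J))\<^sup>2" for x y using S[of x y] by simp
  note A = PiM_insert_mult[OF M insert.hyps f(1)[of i] IH(1) S]
  note B = PiM_insert_mult[OF M insert.hyps f2[of i] IH(3) S2]
  interpret PJ: prob_space "PiM J M" by (intro prob_space_PiM M)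
  have oneP: "integrable (PiM J M) (\<lambda>_. 1::real)" by simp
  note C = PiM_insert_mult(1,2)[OF M insert.hyps f(1)[of i] oneP refl]
  note D = PiM_insert_mult(1,2)[OF M insert.hyps f2[of i] oneP refl]
  have e1: "(\<lambda>x. \<Sum>j\<in>insert i J. f j (x j)) = (\<lambda>x. f i (x i) * 1 + ?S x)"
    using insert.hyps by auto
  have e2: "(\<lambda>x. (\<Sum>j\<in>insert i J. f j (x j))\<^sup>2) = (\<lambda>x. (f i (x i))\<^sup>2 * 1 + 2 * (f i (x i) * ?S x) + (?S x)\<^sup>2)"
    using insert.hyps by (auto simp: power2_eq_square algebra_simps)
  show ?case unfolding e1 e2
    using A B C D IH f(2) insert.hyps by (simp add: PJ.prob_space)
qed

section \<open>Moments of linear forms up to order four\<close>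

lemma (in prob_space) integrable_power_le_4:
  fixes f :: "'a \<Rightarrow> real"
  assumes "f \<in> borel_measurable M" "integrable M (\<lambda>x. f x ^ 4)" "k \<le> 4"
  shows "integrable M (\<lambda>x. \<bar>f x\<bar> ^ k)" "integrable M (\<lambda>x. f x ^ k)"
proof -
  have "\<bar>y\<bar> ^ k \<le> 1 + y ^ 4" for y :: real
  proof (cases "\<bar>y\<bar> \<le> 1")
    case True
    then show ?thesis using power_le_one[of "\<bar>y\<bar>" k] zero_le_power_eq_numeral[of y] 
      by (smt (verit) abs_ge_zero zero_le_even_power' even_numeral)
  next
    case False
    then have "\<bar>y\<bar> ^ k \<le> \<bar>y\<bar> ^ 4" using assms(3) by (intro power_increasing) auto
    then show ?thesis by (simp add: power_even_abs)
  qed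
  then have b: "\<bar>f x\<bar> ^ k \<le> 1 + f x ^ 4" for x by blast
  have i: "integrable M (\<lambda>x. 1 + f x ^ 4)" using assms by auto
  have z: "0 \<le> f x ^ 4" for x by simp
  show "integrable M (\<lambda>x. \<bar>f x\<bar> ^ k)" "integrable M (\<lambda>x. f x ^ k)"
    by (rule Bochner_Integration.integrable_bound[OF i]; use assms b z in \<open>auto simp: power_abs\<close>)+
qed

text \<open>One class for the laws of the \<open>Z i\<close> and for the Gaussian law: the first two
  moments agree, as the exchange of variables demands, and \<open>K\<close> controls all remainders
  uniformly.\<close>

definition std_law :: "real \<Rightarrow> real measure \<Rightarrow> bool" where
  "std_law K \<mu> \<longleftrightarrow> prob_space \<mu> \<and> sets \<mu> = sets borel \<and> integrable \<mu> (\<lambda>x. x ^ 4)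
     \<and> (\<integral>x. x \<partial>\<mu>) = 0 \<and> (\<integral>x. x\<^sup>2 \<partial>\<mu>) = 1 \<and> (\<integral>x. x ^ 4 \<partial>\<mu>) \<le> K"

lemma std_law_integrable:
  assumes "std_law K \<mu>" "k \<le> 4"
  shows "integrable \<mu> (\<lambda>x. x ^ k)" "integrable \<mu> (\<lambda>x. \<bar>x\<bar> ^ k)"
proof -
  interpret prob_space \<mu> using assms unfolding std_law_def by auto
  have "(\<lambda>x. x) \<in> borel_measurable \<mu>" using assms unfolding std_law_def
    by (intro measurable_ident_sets) auto
  then show "integrable \<mu> (\<lambda>x. x ^ k)" "integrable \<mu> (\<lambda>x. \<bar>x\<bar> ^ k)"
    using integrable_power_le_4[of "\<lambda>x. x" k] assms unfolding std_law_def by auto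
qed

text \<open>\<open>3 \<le> K\<close> closes the induction: with s the sum of squares so far, the
  mixed term \<open>6 * (a i)\<^sup>2 * s\<close> is at most
  \<open>2 * K * (a i)\<^sup>2 * s\<close>, which completes the square
  \<open>K * ((a i)\<^sup>2 + s)\<^sup>2\<close>.\<close>

lemma PiM_linear_form_moments:
  fixes a :: "'i \<Rightarrow> real"
  assumes M: "\<And>j. std_law K (M j)" and K: "3 \<le> K" and "finite J"
  shows "integrable (PiM J M) (\<lambda>x. (\<Sum>j\<in>J. a j * x j) ^ 4)
    \<and> (\<integral>x. (\<Sum>j\<in>J. a j * x j) \<partial>PiM J M) = 0
    \<and> (\<integral>x. (\<Sum>j\<in>J. a j * x j)\<^sup>2 \<partial>PiM J M) = (\<Sum>j\<in>J. (a j)\<^sup>2)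
    \<and> (\<integral>x. (\<Sum>j\<in>J. a j * x j) ^ 4 \<partial>PiM J M) \<le> K * (\<Sum>j\<in>J. (a j)\<^sup>2)\<^sup>2"
proof -
  have P: "\<And>j. prob_space (M j)" and sb: "\<And>j. sets (M j) = sets borel"
    using M unfolding std_law_def by auto
  have L2: "integrable (PiM J M) (\<lambda>x. \<Sum>j\<in>J. a j * x j) \<and> (\<integral>x. (\<Sum>j\<in>J. a j * x j) \<partial>PiM J M) = 0
    \<and> integrable (PiM J M) (\<lambda>x. (\<Sum>j\<in>J. a j * x j)\<^sup>2)
    \<and> (\<integral>x. (\<Sum>j\<in>J. a j * x j)\<^sup>2 \<partial>PiM J M) = (\<Sum>j\<in>J. (\<integral>y. (a j * y)\<^sup>2 \<partial>M j))" if "finite J" for J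
    using M std_law_integrable[OF M, of 1] std_law_integrable[OF M, of 2] unfolding std_law_def
    by (intro PiM_sum_square P that) (auto simp: power_mult_distrib)
  have E2: "(\<Sum>j\<in>J. (\<integral>y. (a j * y)\<^sup>2 \<partial>M j)) = (\<Sum>j\<in>J. (a j)\<^sup>2)" for J
    using M unfolding std_law_def by (intro sum.cong) (auto simp: power_mult_distrib)
  have "integrable (PiM J M) (\<lambda>x. (\<Sum>j\<in>J. a j * x j) ^ 4) \<and>
    (\<integral>x. (\<Sum>j\<in>J. a j * x j) ^ 4 \<partial>PiM J M) \<le> K * (\<Sum>j\<in>J. (a j)\<^sup>2)\<^sup>2"
    using \<open>finite J\<close>
  proof (induction J rule: finite_induct)
    case empty
    then show ?case using prob_space_PiM[of "{}" M] by (auto simp: prob_space.prob_space)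
  next
    case (insert i J)
    interpret PJ: prob_space "PiM J M" by (intro prob_space_PiM P)
    let ?S = "\<lambda>x. \<Sum>j\<in>J. a j * x j"
    let ?s = "\<Sum>j\<in>J. (a j)\<^sup>2"
    have m: "?S \<in> borel_measurable (PiM J M)"
      using L2[OF insert.hyps(1)] by auto
    have i4: "integrable (PiM J M) (\<lambda>x. ?S x ^ 4)" using insert.IH by auto
    have iS: "integrable (PiM J M) (\<lambda>x. ?S x ^ k)" if "k \<le> 4" for k
      using PJ.integrable_power_le_4[OF m i4 that] by auto
    have u: "(?S (x(i := y))) ^ k = (?S (restrict x J)) ^ k" for x y k
      using sum_upd_eq[of i J "\<lambda>j z. a j * z"] insert.hyps(2) by simp
    have ix: "integrable (M i) (\<lambda>x. x ^ k)" if "k \<le> 4" for k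
      using std_law_integrable[OF M that] by auto
    note R = PiM_insert_mult[OF P insert.hyps ix iS u]
    \<comment> \<open>All exponents are written out, 0 and 1 included, so that \<open>int\<close>
      and \<open>val\<close> apply to each monomial. The two terms with odd exponents vanish, since
      one factor of each has a first moment as its mean.\<close>
    have e: "(\<lambda>x. (\<Sum>j\<in>insert i J. a j * x j) ^ 4) = (\<lambda>x. a i ^ 4 * (x i ^ 4 * ?S x ^ 0)
        + 4 * a i ^ 3 * (x i ^ 3 * ?S x ^ 1) + 6 * (a i)\<^sup>2 * ((x i)\<^sup>2 * (?S x)\<^sup>2)
        + 4 * a i * (x i ^ 1 * ?S x ^ 3) + x i ^ 0 * ?S x ^ 4)"
      using insert.hyps by (auto simp: power2_eq_square power3_eq_cube power4_eq_xxxx algebra_simps)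
    have int: "integrable (PiM (insert i J) M) (\<lambda>x. x i ^ k * ?S x ^ l)" if "k \<le> 4" "l \<le> 4" for k l
      by (rule R(1)[OF that])
    have val: "(\<integral>x. x i ^ k * ?S x ^ l \<partial>PiM (insert i J) M) = (\<integral>y. y ^ k \<partial>M i) * (\<integral>x. ?S x ^ l \<partial>PiM J M)"
      if "k \<le> 4" "l \<le> 4" for k l
      by (rule R(2)[OF that])
    have mi: "(\<integral>y. y ^ 0 \<partial>M i) = 1" "(\<integral>y. y ^ 1 \<partial>M i) = 0" "(\<integral>y. y\<^sup>2 \<partial>M i) = 1" "(\<integral>y. y ^ 4 \<partial>M i) \<le> K"
      using M[of i] P[of i] by (auto simp: std_law_def prob_space.prob_space)
    have mS: "(\<integral>x. ?S x ^ 0 \<partial>PiM J M) = 1" "(\<integral>x. ?S x ^ 1 \<partial>PiM J M) = 0" 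
      "(\<integral>x. (?S x)\<^sup>2 \<partial>PiM J M) = ?s" "(\<integral>x. ?S x ^ 4 \<partial>PiM J M) \<le> K * ?s\<^sup>2"
      using L2[OF insert.hyps(1)] E2[of J] insert.IH by (auto simp: PJ.prob_space)
    have I: "integrable (PiM (insert i J) M) (\<lambda>x. (\<Sum>j\<in>insert i J. a j * x j) ^ 4)"
      unfolding e by (intro Bochner_Integration.integrable_add integrable_mult_right int) auto
    have "(\<integral>x. (\<Sum>j\<in>insert i J. a j * x j) ^ 4 \<partial>PiM (insert i J) M) = 
      a i ^ 4 * (\<integral>y. y ^ 4 \<partial>M i) + 6 * (a i)\<^sup>2 * ?s + (\<integral>x. ?S x ^ 4 \<partial>PiM J M)"
      unfolding e 
      by (simp add: int val mi mS del: power_0 One_nat_def power_one_right power_Suc0_right)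
    also have "\<dots> \<le> a i ^ 4 * K + 2 * K * (a i)\<^sup>2 * ?s + K * ?s\<^sup>2"
    proof (intro add_mono mS mult_left_mono mi)
      have "0 \<le> ?s" by (simp add: sum_nonneg)
      then show "6 * (a i)\<^sup>2 * ?s \<le> 2 * K * (a i)\<^sup>2 * ?s" using K by (intro mult_right_mono) auto
    qed auto
    also have "\<dots> = K * (\<Sum>j\<in>insert i J. (a j)\<^sup>2)\<^sup>2"
      using insert.hyps by (simp add: power2_eq_square power4_eq_xxxx algebra_simps)
    finally show ?case using I by simp
  qed
  then show ?thesis using L2[OF \<open>finite J\<close>] E2 by simp
qed

text \<open>Weighted AM-GM bounds the third absolute moment by the second and the fourth;
  \<open>\<tau>\<close> dominates the standard deviation and is therefore the right weight.\<close>

lemma PiM_linear_form_abs_cube: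
  fixes a :: "'i \<Rightarrow> real"
  assumes M: "\<And>j. std_law K (M j)" and K: "3 \<le> K" and J: "finite J"
    and \<tau>: "0 < \<tau>" "(\<Sum>j\<in>J. (a j)\<^sup>2) \<le> \<tau>\<^sup>2"
  shows "integrable (PiM J M) (\<lambda>x. \<bar>\<Sum>j\<in>J. a j * x j\<bar> ^ 3)"
    and "(\<integral>x. \<bar>\<Sum>j\<in>J. a j * x j\<bar> ^ 3 \<partial>PiM J M) \<le> (1 + K) / 2 * \<tau> ^ 3"
proof -
  interpret prob_space "PiM J M" using M by (intro prob_space_PiM) (auto simp: std_law_def)
  let ?S = "\<lambda>x. \<Sum>j\<in>J. a j * x j"
  note R = PiM_linear_form_moments[where a=a, OF M K J]
  have "\<And>j. sets (M j) = sets borel" using M unfolding std_law_def by auto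
  note [measurable_cong] = this
  have m: "?S \<in> borel_measurable (PiM J M)" by measurable
  have i: "integrable (PiM J M) (\<lambda>x. \<bar>?S x\<bar> ^ 3)" "integrable (PiM J M) (\<lambda>x. (?S x)\<^sup>2)"
    using integrable_power_le_4[OF m, of 3] integrable_power_le_4[OF m, of 2] R by auto
  show "integrable (PiM J M) (\<lambda>x. \<bar>?S x\<bar> ^ 3)" by fact
  have pw: "\<bar>y\<bar> ^ 3 \<le> \<tau> / 2 * y\<^sup>2 + 1 / (2 * \<tau>) * y ^ 4" for y :: real
  proof -
    have "0 \<le> y\<^sup>2 * (\<bar>y\<bar> - \<tau>)\<^sup>2 / (2 * \<tau>)" using \<tau> by auto
    also have "\<dots> = \<tau> / 2 * y\<^sup>2 + 1 / (2 * \<tau>) * y ^ 4 - \<bar>y\<bar> ^ 3"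
    proof -
      have "y\<^sup>2 = \<bar>y\<bar> ^ 2" "y ^ 4 = \<bar>y\<bar> ^ 4" by (simp_all add: power_even_abs)
      then show ?thesis using \<tau> 
        by (simp add: field_simps power2_eq_square power3_eq_cube power4_eq_xxxx)
    qed
    finally show ?thesis by simp
  qed
  have "(\<integral>x. \<bar>?S x\<bar> ^ 3 \<partial>PiM J M) \<le> (\<integral>x. \<tau> / 2 * (?S x)\<^sup>2 + 1 / (2 * \<tau>) * ?S x ^ 4 \<partial>PiM J M)"
    using i R pw by (intro integral_mono) auto
  also have "\<dots> = \<tau> / 2 * (\<Sum>j\<in>J. (a j)\<^sup>2) + 1 / (2 * \<tau>) * (\<integral>x. ?S x ^ 4 \<partial>PiM J M)"
    using i R by (subst Bochner_Integration.integral_add) auto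
  also have "\<dots> \<le> \<tau> / 2 * \<tau>\<^sup>2 + 1 / (2 * \<tau>) * (K * (\<tau>\<^sup>2)\<^sup>2)"
  proof (intro add_mono mult_left_mono \<tau>)
    have "(\<integral>x. ?S x ^ 4 \<partial>PiM J M) \<le> K * (\<Sum>j\<in>J. (a j)\<^sup>2)\<^sup>2" using R by auto
    also have "\<dots> \<le> K * (\<tau>\<^sup>2)\<^sup>2" using \<tau> K by (intro mult_left_mono power_mono) (auto simp: sum_nonneg)
    finally show "(\<integral>x. ?S x ^ 4 \<partial>PiM J M) \<le> K * (\<tau>\<^sup>2)\<^sup>2" .
  qed (use \<tau> in auto)
  also have "\<dots> = (1 + K) / 2 * \<tau> ^ 3" using \<tau>
    by (simp add: field_simps power2_eq_square power3_eq_cube)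
  finally show "(\<integral>x. \<bar>?S x\<bar> ^ 3 \<partial>PiM J M) \<le> (1 + K) / 2 * \<tau> ^ 3" .
qed

section \<open>Exchange of the variables one at a time\<close>

lemma third_order_Taylor:
  fixes h h1 h2 h3 :: "real \<Rightarrow> real"
  assumes "\<And>x. (h has_real_derivative h1 x) (at x)" "\<And>x. (h1 has_real_derivative h2 x) (at x)"
    "\<And>x. (h2 has_real_derivative h3 x) (at x)" and B: "\<And>x. \<bar>h3 x\<bar> \<le> B"
  shows "\<bar>h (a + t) - h a - h1 a * t - h2 a * t\<^sup>2 / 2\<bar> \<le> B * \<bar>t\<bar> ^ 3 / 6"
proof -
  define D where "D = (\<lambda>k::nat. if k = 0 then h else if k = 1 then h1 else if k = 2 then h2 else h3)"
  have "\<exists>s. \<bar>s\<bar> \<le> \<bar>t\<bar> \<and> h (a + t) = (\<Sum>m<(3::nat). D m (a + 0) / fact m * t ^ m) + D 3 (a + s) / fact 3 * t ^ 3"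
  proof (rule Maclaurin_bi_le[where f="\<lambda>x. h (a + x)" and diff="\<lambda>k x. D k (a + x)" and n=3])
    show "(\<lambda>x. D 0 (a + x)) = (\<lambda>x. h (a + x))" by (simp add: D_def)
    have "(D m has_real_derivative D (Suc m) x) (at x)" if "m < 3" for m x
    proof -
      consider "m = 0" | "m = 1" | "m = 2" using \<open>m < 3\<close> by linarith
      then show ?thesis by cases (auto simp: D_def assms)
    qed
    then show "\<forall>m s. m < 3 \<and> \<bar>s\<bar> \<le> \<bar>t\<bar> \<longrightarrow> ((\<lambda>x. D m (a + x)) has_real_derivative D (Suc m) (a + s)) (at s)"
      by (auto simp: DERIV_shift[symmetric] add.commute)
  qed
  then obtain s where s: "h (a + t) = (\<Sum>m<(3::nat). D m a / fact m * t ^ m) + D 3 (a + s) / fact 3 * t ^ 3"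
    by auto
  have "h (a + t) - h a - h1 a * t - h2 a * t\<^sup>2 / 2 = h3 (a + s) / 6 * t ^ 3"
    unfolding s by (simp add: D_def numeral_3_eq_3 fact_numeral power2_eq_square)
  then have "\<bar>h (a + t) - h a - h1 a * t - h2 a * t\<^sup>2 / 2\<bar> = \<bar>h3 (a + s)\<bar> / 6 * \<bar>t\<bar> ^ 3"
    by (simp only: abs_mult power_abs abs_divide abs_numeral)
  also have "\<dots> \<le> B / 6 * \<bar>t\<bar> ^ 3" using B[of "a + s"] by (intro mult_right_mono) auto
  finally show ?thesis by simp
qed

definition qform :: "('i \<Rightarrow> 'i \<Rightarrow> real) \<Rightarrow> 'i set \<Rightarrow> ('i \<Rightarrow> real) \<Rightarrow> real" where
  "qform q I x = (\<Sum>i\<in>I. \<Sum>j\<in>I. q i j * x i * x j)"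

text \<open>A zero diagonal makes the form affine in each single coordinate. Its slope is a linear
  form in the others, so a Taylor expansion in \<open>u\<close> leaves a remainder of the order of
  the slope cubed.\<close>

lemma qform_insert_upd:
  assumes "finite J" "i \<notin> J" "q i i = 0" "\<And>j. q j i = q i j"
  shows "qform q (insert i J) (x(i := u)) = qform q J x + u * (\<Sum>j\<in>J. (2 * q i j) * x j)"
proof -
  let ?x = "x(i := u)"
  have e: "?x j = x j" if "j \<in> J" for j using that assms(2) by auto
  have "qform q (insert i J) ?x = (\<Sum>j\<in>J. q i j * u * x j) + (\<Sum>j\<in>J. q j i * x j * u + (\<Sum>k\<in>J. q j k * x j * x k))"
    using assms(1-3) e unfolding qform_def by (simp cong: sum.cong)
  also have "\<dots> = (\<Sum>j\<in>J. q i j * u * x j) + (\<Sum>j\<in>J. q i j * x j * u) + qform q J x"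
    unfolding assms(4) qform_def by (simp add: sum.distrib)
  also have "\<dots> = qform q J x + u * (\<Sum>j\<in>J. (2 * q i j) * x j)"
    unfolding sum_distrib_left by (simp add: sum.distrib[symmetric] algebra_simps)
  finally show ?thesis .
qed

lemma qform_measurable [measurable]:
  assumes [measurable_cong]: "\<And>j. sets (M j) = sets borel" and "finite I"
  shows "qform q I \<in> borel_measurable (PiM I M)"
  unfolding qform_def by measurable

text \<open>Only mean and variance of \<open>\<mu>\<close> enter the Taylor polynomial, so any two
  laws of the class give the same main term. The remainder uses that the third absolute moment is at
  most \<open>1 + K\<close>.\<close>

lemma Lindeberg_one_variable:
  fixes h h1 h2 h3 :: "real \<Rightarrow> real"
  assumes d: "\<And>x. (h has_real_derivative h1 x) (at x)" "\<And>x. (h1 has_real_derivative h2 x) (at x)"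
    "\<And>x. (h2 has_real_derivative h3 x) (at x)" and B: "\<And>x. \<bar>h3 x\<bar> \<le> B" and b: "\<And>x. \<bar>h x\<bar> \<le> 1"
    and \<mu>: "std_law K \<mu>"
  shows "\<bar>(\<integral>u. h (a + u * l) \<partial>\<mu>) - (h a + h2 a * l\<^sup>2 / 2)\<bar> \<le> B * (1 + K) * \<bar>l\<bar> ^ 3 / 6"
proof -
  interpret prob_space \<mu> using \<mu> by (auto simp: std_law_def)
  have B0: "0 \<le> B" using B[of 0] by linarith
  have [measurable_cong]: "sets \<mu> = sets borel" using \<mu> by (auto simp: std_law_def)
  have "continuous_on UNIV h" using d(1) by (meson DERIV_continuous_on has_field_derivative_at_within)
  then have [measurable]: "h \<in> borel_measurable borel" by (rule borel_measurable_continuous_onI)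
  have ih: "integrable \<mu> (\<lambda>u. h (a + u * l))"
    by (rule integrable_const_bound[of _ 1]) (use b in auto)
  note ik = std_law_integrable[OF \<mu>]
  have i1: "integrable \<mu> (\<lambda>u. u)" using ik(1)[of 1] by simp
  have i2: "integrable \<mu> (\<lambda>u. u\<^sup>2)" using ik(1)[of 2] by simp
  have i3: "integrable \<mu> (\<lambda>u. \<bar>u\<bar> ^ 3)" using ik(2)[of 3] by simp
  have i4: "integrable \<mu> (\<lambda>u. u ^ 4)" using ik(1)[of 4] by simp
  have m: "(\<integral>u. u \<partial>\<mu>) = 0" "(\<integral>u. u\<^sup>2 \<partial>\<mu>) = 1" "(\<integral>u. u ^ 4 \<partial>\<mu>) \<le> K"
    using \<mu> by (auto simp: std_law_def)
  let ?p = "\<lambda>u. h a + h1 a * l * u + h2 a * l\<^sup>2 / 2 * u\<^sup>2"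
  have ip: "integrable \<mu> ?p" using i1 i2 by auto
  have vp: "(\<integral>u. ?p u \<partial>\<mu>) = h a + h2 a * l\<^sup>2 / 2" using i1 i2 m by (simp add: prob_space)
  have "\<bar>(\<integral>u. h (a + u * l) \<partial>\<mu>) - (h a + h2 a * l\<^sup>2 / 2)\<bar> = \<bar>\<integral>u. h (a + u * l) - ?p u \<partial>\<mu>\<bar>"
    unfolding vp[symmetric] using ih ip by simp
  also have "\<dots> \<le> (\<integral>u. \<bar>h (a + u * l) - ?p u\<bar> \<partial>\<mu>)" by (rule integral_abs_bound)
  also have "\<dots> \<le> (\<integral>u. B * \<bar>l\<bar> ^ 3 / 6 * \<bar>u\<bar> ^ 3 \<partial>\<mu>)"
  proof (intro integral_mono)
    fix u
    show "\<bar>h (a + u * l) - ?p u\<bar> \<le> B * \<bar>l\<bar> ^ 3 / 6 * \<bar>u\<bar> ^ 3"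
      using third_order_Taylor[OF d B, of a "u * l"]
      by (simp add: abs_mult power_mult_distrib algebra_simps)
  qed (use ih ip i3 in auto)
  also have "\<dots> = B * \<bar>l\<bar> ^ 3 / 6 * (\<integral>u. \<bar>u\<bar> ^ 3 \<partial>\<mu>)" by simp
  also have "\<dots> \<le> B * \<bar>l\<bar> ^ 3 / 6 * (1 + K)"
  proof (intro mult_left_mono)
    have pw: "\<bar>u\<bar> ^ 3 \<le> 1 + u ^ 4" for u :: real
    proof -
      have "\<bar>u\<bar> ^ 3 \<le> 1 \<or> \<bar>u\<bar> ^ 3 \<le> \<bar>u\<bar> ^ 4"
        using power_le_one[of "\<bar>u\<bar>" 3] power_increasing[of 3 4 "\<bar>u\<bar>"] by linarith
      moreover have "\<bar>u\<bar> ^ 4 = u ^ 4" "0 \<le> u ^ 4" by (simp_all add: power_even_abs)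
      ultimately show ?thesis by linarith
    qed
    have "(\<integral>u. \<bar>u\<bar> ^ 3 \<partial>\<mu>) \<le> (\<integral>u. 1 + u ^ 4 \<partial>\<mu>)"
      using i3 i4 pw by (intro integral_mono) auto
    also have "\<dots> \<le> 1 + K" using i4 m by (simp add: prob_space)
    finally show "(\<integral>u. \<bar>u\<bar> ^ 3 \<partial>\<mu>) \<le> 1 + K" .
  qed (use B0 in auto)
  finally show ?thesis by (simp add: algebra_simps)
qed

text \<open>Given the other coordinates, the old and the new law both lie within the one-variable
  error of the same main term. The constant is twice (1 + K)/6 from that error, times (1 + K)/2 from
  the third absolute moment of the slope.\<close>

lemma Lindeberg_replacement:
  fixes h h1 h2 h3 :: "real \<Rightarrow> real"
  assumes d: "\<And>x. (h has_real_derivative h1 x) (at x)" "\<And>x. (h1 has_real_derivative h2 x) (at x)"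
    "\<And>x. (h2 has_real_derivative h3 x) (at x)" and B: "\<And>x. \<bar>h3 x\<bar> \<le> B" and b: "\<And>x. \<bar>h x\<bar> \<le> 1"
    and M: "\<And>j. std_law K (M j)" "std_law K \<mu>" and K: "3 \<le> K"
    and J: "finite J" "i \<notin> J" and q: "q i i = 0" "\<And>j. q j i = q i j"
    and \<tau>: "0 < \<tau>" "(\<Sum>j\<in>J. (2 * q i j)\<^sup>2) \<le> \<tau>\<^sup>2"
  shows "\<bar>(\<integral>x. h (qform q (insert i J) x) \<partial>PiM (insert i J) (M(i := \<mu>)))
     - (\<integral>x. h (qform q (insert i J) x) \<partial>PiM (insert i J) M)\<bar> \<le> B * (1 + K)\<^sup>2 / 6 * \<tau> ^ 3"
proof -
  let ?L = "\<lambda>x. \<Sum>j\<in>J. (2 * q i j) * x j"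
  let ?A = "qform q J"
  have P: "prob_space (M j)" for j using M by (auto simp: std_law_def)
  interpret PJ: prob_space "PiM J M" by (intro prob_space_PiM P)
  have S[measurable_cong]: "sets (M j) = sets borel" for j using M by (auto simp: std_law_def)
  have "continuous_on UNIV h" using d(1) by (meson DERIV_continuous_on has_field_derivative_at_within)
  then have h[measurable]: "h \<in> borel_measurable borel" by (rule borel_measurable_continuous_onI)
  have B0: "0 \<le> B" using B[of 0] by linarith
  \<comment> \<open>Stated for an arbitrary law in slot \<open>i\<close>, so that it serves the new
    law and, through \<open>M(i := M i) = M\<close>, also the old one.\<close>
  have fub: "(\<integral>x. h (qform q (insert i J) x) \<partial>PiM (insert i J) (M(i := \<nu>)))
     = (\<integral>x. (\<integral>u. h (?A x + u * ?L x) \<partial>\<nu>) \<partial>PiM J M)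
     \<and> (\<lambda>x. \<integral>u. h (?A x + u * ?L x) \<partial>\<nu>) \<in> borel_measurable (PiM J M)" if \<nu>: "std_law K \<nu>" for \<nu>
  proof -
    have N: "std_law K ((M(i := \<nu>)) j)" for j using M \<nu> by auto
    have PN: "prob_space ((M(i := \<nu>)) j)" and SN: "sets ((M(i := \<nu>)) j) = sets borel" for j
      using N[of j] unfolding std_law_def by auto
    interpret MM: product_prob_space "M(i := \<nu>)" "insert i J" by (intro product_prob_spaceI PN)
    have [measurable]: "qform q (insert i J) \<in> borel_measurable (PiM (insert i J) (M(i := \<nu>)))"
      by (rule qform_measurable[OF SN]) (use J in auto)
    have "integrable (PiM (insert i J) (M(i := \<nu>))) (\<lambda>x. h (qform q (insert i J) x))"
      by (rule MM.P.integrable_const_bound[of _ 1]) (use b in auto)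
    note MM.product_integral_insert[OF J this]
    moreover have "PiM J (M(i := \<nu>)) = PiM J M" using J by (intro PiM_cong) auto
    moreover have "(\<lambda>x. \<integral>u. h (?A x + u * ?L x) \<partial>\<nu>) \<in> borel_measurable (PiM J M)"
    proof -
      interpret \<nu>: prob_space \<nu> using \<nu> by (auto simp: std_law_def)
      have [measurable_cong]: "sets \<nu> = sets borel" using \<nu> by (auto simp: std_law_def)
      have [measurable]: "?A \<in> borel_measurable (PiM J M)" by (rule qform_measurable[OF S J(1)])
      show ?thesis by measurable
    qed
    ultimately show ?thesis using qform_insert_upd[of J i q, OF J q] by simp
  qed
  have MM: "M(i := M i) = M" by simp
  let ?f = "\<lambda>\<nu> x. \<integral>u. h (?A x + u * ?L x) \<partial>\<nu>"
  have bd: "\<bar>?f \<nu> x\<bar> \<le> 1" if "std_law K \<nu>" for \<nu> x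
  proof -
    interpret \<nu>: prob_space \<nu> using that by (auto simp: std_law_def)
    have "\<bar>?f \<nu> x\<bar> \<le> (\<integral>u. \<bar>h (?A x + u * ?L x)\<bar> \<partial>\<nu>)" by (rule integral_abs_bound)
    also have "\<dots> \<le> (\<integral>u. 1 \<partial>\<nu>)" by (rule integral_mono') (use b in auto)
    finally show ?thesis by (simp add: \<nu>.prob_space)
  qed
  have int: "integrable (PiM J M) (?f \<nu>)" if "std_law K \<nu>" for \<nu>
    by (rule PJ.integrable_const_bound[of _ 1]) (use fub[OF that] bd[OF that] in auto)
  note c3 = PiM_linear_form_abs_cube[where a="\<lambda>j. 2 * q i j" and M=M, OF M(1) K J(1) \<tau>]
  have "\<bar>(\<integral>x. ?f \<mu> x \<partial>PiM J M) - (\<integral>x. ?f (M i) x \<partial>PiM J M)\<bar> = \<bar>\<integral>x. ?f \<mu> x - ?f (M i) x \<partial>PiM J M\<bar>"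
    using int M by simp
  also have "\<dots> \<le> (\<integral>x. \<bar>?f \<mu> x - ?f (M i) x\<bar> \<partial>PiM J M)" by (rule integral_abs_bound)
  also have "\<dots> \<le> (\<integral>x. B * (1 + K) / 3 * \<bar>?L x\<bar> ^ 3 \<partial>PiM J M)"
  proof (intro integral_mono)
    fix x
    show "\<bar>?f \<mu> x - ?f (M i) x\<bar> \<le> B * (1 + K) / 3 * \<bar>?L x\<bar> ^ 3"
    proof -
      have tri: "\<bar>a - c\<bar> \<le> e \<Longrightarrow> \<bar>b - c\<bar> \<le> e \<Longrightarrow> \<bar>a - b\<bar> \<le> 2 * e" for a b c e :: real
        by linarith
      have "\<bar>?f \<mu> x - ?f (M i) x\<bar> \<le> 2 * (B * (1 + K) * \<bar>?L x\<bar> ^ 3 / 6)"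
        by (rule tri[OF Lindeberg_one_variable[OF d B b M(2)] Lindeberg_one_variable[OF d B b M(1)]])
      then show ?thesis by simp
    qed
  qed (use int M c3(1) in auto)
  also have "\<dots> = B * (1 + K) / 3 * (\<integral>x. \<bar>?L x\<bar> ^ 3 \<partial>PiM J M)" by simp
  also have "\<dots> \<le> B * (1 + K) / 3 * ((1 + K) / 2 * \<tau> ^ 3)"
    using c3(2) B0 K by (intro mult_left_mono) auto
  also have "\<dots> = B * (1 + K)\<^sup>2 / 6 * \<tau> ^ 3" by (simp add: power2_eq_square)
  finally show ?thesis using fub[OF M(2)] fub[OF M(1)[of i]] unfolding MM by simp
qed

text \<open>Telescopes over the hybrid products \<open>H A\<close>, in which the coordinates in
  \<open>A\<close> already carry \<open>M\<close>. When \<open>\<tau>\<close> is of order n^(-1/2),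
  the n exchanges together cost n^(-1/2).\<close>

lemma Lindeberg_quadratic_form:
  fixes h h1 h2 h3 :: "real \<Rightarrow> real"
  assumes d: "\<And>x. (h has_real_derivative h1 x) (at x)" "\<And>x. (h1 has_real_derivative h2 x) (at x)"
    "\<And>x. (h2 has_real_derivative h3 x) (at x)" and B: "\<And>x. \<bar>h3 x\<bar> \<le> B" and b: "\<And>x. \<bar>h x\<bar> \<le> 1"
    and M: "\<And>j. std_law K (M j)" "\<And>j. std_law K (M' j)" and K: "3 \<le> K"
    and I: "finite I" and q: "\<And>i. q i i = 0" "\<And>i j. q j i = q i j"
    and \<tau>: "0 < \<tau>" "\<And>i. i \<in> I \<Longrightarrow> (\<Sum>j\<in>I. (2 * q i j)\<^sup>2) \<le> \<tau>\<^sup>2"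
  shows "\<bar>(\<integral>x. h (qform q I x) \<partial>PiM I M) - (\<integral>x. h (qform q I x) \<partial>PiM I M')\<bar>
    \<le> real (card I) * (B * (1 + K)\<^sup>2 / 6 * \<tau> ^ 3)"
proof -
  define H where "H A = (\<lambda>i. if i \<in> A then M i else M' i)" for A
  let ?E = "\<lambda>A. \<integral>x. h (qform q I x) \<partial>PiM I (H A)"
  have HS: "std_law K (H A j)" for A j using M by (auto simp: H_def)
  have "\<bar>?E A - ?E {}\<bar> \<le> real (card A) * (B * (1 + K)\<^sup>2 / 6 * \<tau> ^ 3)" if "finite A" "A \<subseteq> I" for A
    using that
  proof (induction A rule: finite_induct)
    case (insert i A)
    let ?J = "I - {i}"
    have II: "insert i ?J = I" using insert.prems by auto
    have HH: "H (insert i A) = (H A)(i := M i)" by (auto simp: H_def)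
    have "(\<Sum>j\<in>?J. (2 * q i j)\<^sup>2) \<le> (\<Sum>j\<in>I. (2 * q i j)\<^sup>2)" using I by (intro sum_mono2) auto
    also have "\<dots> \<le> \<tau>\<^sup>2" using \<tau> insert.prems by auto
    finally have le: "(\<Sum>j\<in>?J. (2 * q i j)\<^sup>2) \<le> \<tau>\<^sup>2" .
    have "\<bar>?E (insert i A) - ?E A\<bar> \<le> B * (1 + K)\<^sup>2 / 6 * \<tau> ^ 3"
      using Lindeberg_replacement[where J="I - {i}" and i=i and q=q and M="H A" and \<mu>="M i",
          OF d B b HS M(1) K _ _ q \<tau>(1) le] I
      unfolding II HH by auto
    moreover have "\<bar>?E A - ?E {}\<bar> \<le> real (card A) * (B * (1 + K)\<^sup>2 / 6 * \<tau> ^ 3)"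
      using insert by auto
    ultimately have "\<bar>?E (insert i A) - ?E {}\<bar> \<le> (real (card A) + 1) * (B * (1 + K)\<^sup>2 / 6 * \<tau> ^ 3)"
      unfolding distrib_right by linarith
    then show ?case using insert.hyps by (simp add: add.commute)
  qed simp
  from this[OF I order_refl] show ?thesis
    by (simp add: H_def cong: PiM_cong)
qed

section \<open>Smoothing by moving averages\<close>

lemma continuous_antiderivative:
  fixes f :: "real \<Rightarrow> real"
  assumes "continuous_on UNIV f"
  obtains F where "\<And>x. (F has_real_derivative f x) (at x)"
proof -
  have "\<exists>F. \<forall>x :: real. -\<infinity> < ereal x \<longrightarrow> ereal x < \<infinity> \<longrightarrow> (F has_vector_derivative f x) (at x)"
    by (rule einterval_antiderivative) (use assms in \<open>auto simp: continuous_on_eq_continuous_at\<close>)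
  then show ?thesis using that by (auto simp: has_real_derivative_iff_has_vector_derivative)
qed

lemma DERIV_imp_continuous_on_UNIV:
  fixes f :: "real \<Rightarrow> real"
  assumes "\<And>x. (f has_real_derivative f' x) (at x)"
  shows "continuous_on UNIV f"
  using assms by (meson DERIV_continuous_on has_field_derivative_at_within)

text \<open>Here \<open>a x\<close> is the mean of \<open>f\<close> over \<open>[x, x + d]\<close>, a difference quotient of an antiderivative;
  \<open>\<phi>\<close> shows that the smoothing error is the derivative of a small function.\<close>

lemma moving_average:
  fixes f :: "real \<Rightarrow> real"
  assumes f: "continuous_on UNIV f" and d: "0 < d"
  obtains a \<phi> where "\<And>x. (a has_real_derivative (f (x + d) - f x) / d) (at x)"
    and "\<And>x. \<exists>y\<in>{x..x + d}. a x = f y"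
    and "\<And>x. (\<phi> has_real_derivative f x - a x) (at x)"
    and "\<And>b x. (\<And>x. \<bar>f x\<bar> \<le> b) \<Longrightarrow> \<bar>\<phi> x\<bar> \<le> b * d"
proof -
  obtain F where F: "\<And>x. (F has_real_derivative f x) (at x)"
    using continuous_antiderivative[OF f] by blast
  obtain F2 where F2: "\<And>x. (F2 has_real_derivative F x) (at x)"
    using continuous_antiderivative[OF DERIV_imp_continuous_on_UNIV[OF F]] by blast
  define a where "a x = (F (x + d) - F x) / d" for x
  define \<phi> where "\<phi> x = F x - (F2 (x + d) - F2 x) / d" for x
  have sh: "((\<lambda>x. G (x + d)) has_real_derivative g (x + d)) (at x)"
    if "\<And>x. (G has_real_derivative g x) (at x)" for G g :: "real \<Rightarrow> real" and x
    using that[of "x + d"] by (simp add: DERIV_shift)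
  have mvt: "\<exists>y\<in>{x..x + d}. (G (x + d) - G x) / d = g y"
    if "\<And>x. (G has_real_derivative g x) (at x)" for G g :: "real \<Rightarrow> real" and x
  proof -
    have "\<exists>z>x. z < x + d \<and> G (x + d) - G x = (x + d - x) * g z"
      using d that by (intro MVT2) auto
    then show ?thesis using d by (auto intro!: bexI)
  qed
  show ?thesis
  proof
    show "(a has_real_derivative (f (x + d) - f x) / d) (at x)" for x
      unfolding a_def by (intro DERIV_cdivide DERIV_diff F sh)
    show "\<exists>y\<in>{x..x + d}. a x = f y" for x
      unfolding a_def using mvt[OF F] by auto
    show "(\<phi> has_real_derivative f x - a x) (at x)" for x
      unfolding \<phi>_def a_def by (intro DERIV_cdivide DERIV_diff F F2 sh)
    show "\<bar>\<phi> x\<bar> \<le> b * d" if b: "\<And>x. \<bar>f x\<bar> \<le> b" for b x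
    proof -
      obtain y where y: "y \<in> {x..x + d}" "(F2 (x + d) - F2 x) / d = F y" using mvt[OF F2] by blast
      have "\<bar>F x - F y\<bar> \<le> b * \<bar>x - y\<bar>"
        using field_differentiable_bound[of UNIV F f b x y] F b by (auto intro: has_field_derivative_at_within)
      also have "\<dots> \<le> b * d" using y b[of 0] by (intro mult_left_mono) auto
      finally show ?thesis using y by (simp add: \<phi>_def)
    qed
  qed
qed

text \<open>Averaging commutes with differentiation, so every derivative of the triple average is a
  difference quotient of something one order lower; \<open>h3\<close> is a triple difference
  quotient of \<open>f\<close>, whence \<open>8 / d ^ 3\<close>. All averages look to the right, so
  the reach is one-sided. The errors of the three stages add up in \<open>\<phi>\<close>.\<close>

lemma third_order_smoothing:
  fixes f :: "real \<Rightarrow> real"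
  assumes f: "continuous_on UNIV f" and b: "\<And>x. \<bar>f x\<bar> \<le> 1" and d: "0 < d"
  obtains h h1 h2 h3 \<phi> where
    "\<And>x. (h has_real_derivative h1 x) (at x)" "\<And>x. (h1 has_real_derivative h2 x) (at x)"
    "\<And>x. (h2 has_real_derivative h3 x) (at x)"
    "\<And>x. \<exists>y\<in>{x..x + 3 * d}. h x = f y" "\<And>x. \<bar>h1 x\<bar> \<le> 2 / d" "\<And>x. \<bar>h3 x\<bar> \<le> 8 / d ^ 3"
    "\<And>x. (\<phi> has_real_derivative f x - h x) (at x)" "\<And>x. \<bar>\<phi> x\<bar> \<le> 3 * d"
proof -
  have bd: "\<bar>u x\<bar> \<le> 1" if "\<And>x. \<exists>y\<in>{x..x + d}. u x = v y" "\<And>x. \<bar>v x\<bar> \<le> 1" for u v :: "real \<Rightarrow> real" and x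
    using that by metis
  obtain a1 p1 where a1: "\<And>x. (a1 has_real_derivative (f (x + d) - f x) / d) (at x)"
    "\<And>x. \<exists>y\<in>{x..x + d}. a1 x = f y" "\<And>x. (p1 has_real_derivative f x - a1 x) (at x)"
    "\<And>b x. (\<And>x. \<bar>f x\<bar> \<le> b) \<Longrightarrow> \<bar>p1 x\<bar> \<le> b * d"
    using moving_average[OF f d] by blast
  note b1 = bd[OF a1(2) b]
  obtain a2 p2 where a2: "\<And>x. (a2 has_real_derivative (a1 (x + d) - a1 x) / d) (at x)"
    "\<And>x. \<exists>y\<in>{x..x + d}. a2 x = a1 y" "\<And>x. (p2 has_real_derivative a1 x - a2 x) (at x)"
    "\<And>b x. (\<And>x. \<bar>a1 x\<bar> \<le> b) \<Longrightarrow> \<bar>p2 x\<bar> \<le> b * d"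
    using moving_average[OF DERIV_imp_continuous_on_UNIV[OF a1(1)] d] by blast
  note b2 = bd[OF a2(2) b1]
  obtain a3 p3 where a3: "\<And>x. (a3 has_real_derivative (a2 (x + d) - a2 x) / d) (at x)"
    "\<And>x. \<exists>y\<in>{x..x + d}. a3 x = a2 y" "\<And>x. (p3 has_real_derivative a2 x - a3 x) (at x)"
    "\<And>b x. (\<And>x. \<bar>a2 x\<bar> \<le> b) \<Longrightarrow> \<bar>p3 x\<bar> \<le> b * d"
    using moving_average[OF DERIV_imp_continuous_on_UNIV[OF a2(1)] d] by blast
  have sh: "((\<lambda>x. G (x + d)) has_real_derivative g (x + d)) (at x)"
    if "\<And>x. (G has_real_derivative g x) (at x)" for G g :: "real \<Rightarrow> real" and x
    using that[of "x + d"] by (simp add: DERIV_shift)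
  \<comment> \<open>\<open>g1\<close>, \<open>g2\<close>, \<open>h1\<close> are the derivatives of
    \<open>a1\<close>, \<open>a2\<close>, \<open>a3\<close>. Since \<open>k2\<close> is the
    derivative of \<open>g2\<close>, the quotients \<open>h2\<close> and \<open>h3\<close> are the
    next two derivatives of \<open>h1\<close>.\<close>
  define g1 g2 where "g1 x = (f (x + d) - f x) / d" and "g2 x = (a1 (x + d) - a1 x) / d" for x
  define h1 where "h1 x = (a2 (x + d) - a2 x) / d" for x
  define h2 where "h2 x = (g2 (x + d) - g2 x) / d" for x
  define k2 where "k2 x = (g1 (x + d) - g1 x) / d" for x
  define h3 where "h3 x = (k2 (x + d) - k2 x) / d" for x
  note a1' = a1(1)[folded g1_def] and a2' = a2(1)[folded g2_def] and a3' = a3(1)[folded h1_def]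
  have g2': "(g2 has_real_derivative k2 x) (at x)" for x
    unfolding g2_def k2_def by (intro DERIV_cdivide DERIV_diff sh a1')
  show ?thesis
  proof (rule that[of a3 h1 h2 h3 "\<lambda>x. p1 x + p2 x + p3 x"])
    show "(a3 has_real_derivative h1 x) (at x)" for x by (rule a3')
    show "(h1 has_real_derivative h2 x) (at x)" for x
      unfolding h1_def h2_def by (intro DERIV_cdivide DERIV_diff sh a2')
    show "(h2 has_real_derivative h3 x) (at x)" for x
      unfolding h2_def h3_def by (intro DERIV_cdivide DERIV_diff sh g2')
    show "\<exists>y\<in>{x..x + 3 * d}. a3 x = f y" for x
    proof -
      obtain y1 where "y1 \<in> {x..x + d}" "a3 x = a2 y1" using a3(2) by blast
      moreover obtain y2 where "y2 \<in> {y1..y1 + d}" "a2 y1 = a1 y2" using a2(2) by blast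
      moreover obtain y3 where "y3 \<in> {y2..y2 + d}" "a1 y2 = f y3" using a1(2) by blast
      ultimately show ?thesis by (intro bexI[of _ y3]) auto
    qed
    have dq: "\<bar>(u - v) / d\<bar> \<le> 2 * c / d" if "\<bar>u\<bar> \<le> c" "\<bar>v\<bar> \<le> c" for u v c :: real
      using that d by (auto simp: divide_simps)
    show "\<bar>h1 x\<bar> \<le> 2 / d" for x
      unfolding h1_def using dq[OF b2 b2] by simp
    have "\<bar>g1 x\<bar> \<le> 2 / d" for x unfolding g1_def using dq[OF b b] by simp
    then have "\<bar>k2 x\<bar> \<le> 2 * (2 / d) / d" for x unfolding k2_def using dq by blast
    then have "\<bar>h3 x\<bar> \<le> 2 * (2 * (2 / d) / d) / d" for x unfolding h3_def using dq by blast
    then show "\<bar>h3 x\<bar> \<le> 8 / d ^ 3" for x by (simp add: power3_eq_cube)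
    show "((\<lambda>x. p1 x + p2 x + p3 x) has_real_derivative f x - a3 x) (at x)" for x
      using DERIV_add[OF DERIV_add[OF a1(3) a2(3)] a3(3), of x] by simp
    show "\<bar>p1 x + p2 x + p3 x\<bar> \<le> 3 * d" for x
      using a1(4)[OF b, of x] a2(4)[OF b1, of x] a3(4)[OF b2, of x] by linarith
  qed
qed

text \<open>Induction over integrable functions: for indicators, a Urysohn function between an inner
  compact and an outer open set; for limits, dominated convergence. Boundedness of \<open>g\<close>
  is carried along to keep all differences integrable.\<close>

lemma continuous_approx_L1:
  fixes f :: "real \<Rightarrow> real"
  assumes fin: "finite_measure \<nu>" and sb: "sets \<nu> = sets borel" and f: "integrable \<nu> f" and e: "0 < e"
  shows "\<exists>g. continuous_on UNIV g \<and> bounded (range g) \<and> (\<integral>x. \<bar>f x - g x\<bar> \<partial>\<nu>) < e"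
  using f e
proof (induction arbitrary: e rule: integrable_induct)
  case (base A c)
  interpret finite_measure \<nu> by fact
  have [measurable_cong]: "sets \<nu> = sets borel" by fact
  have sp: "space \<nu> = UNIV" using sb by (metis sets_eq_imp_space_eq space_borel)
  have A: "A \<in> sets borel" using base sb by auto
  \<comment> \<open>Adding 1 to the denominator covers \<open>c = 0\<close>.\<close>
  obtain e1 where e': "e1 > 0" "\<bar>c\<bar> * e1 < e"
    using base by (intro that[of "e / (\<bar>c\<bar> + 1)"]) (auto simp: field_simps)
  have fine: "emeasure \<nu> (space \<nu>) \<noteq> \<infinity>" by (simp add: emeasure_eq_measure)
  obtain K where K: "K \<subseteq> A" "compact K" "measure \<nu> A < measure \<nu> K + e1 / 2"
  proof -
    have "emeasure \<nu> A = (SUP K \<in> {K. K \<subseteq> A \<and> compact K}. emeasure \<nu> K)"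
      using inner_regular[OF sb fine] A by auto
    \<comment> \<open>\<open>ennreal\<close> sends negative numbers to 0, hence the second
      alternative, in which the empty set serves as \<open>K\<close>.\<close>
    moreover have "ennreal (measure \<nu> A - e1 / 2) < emeasure \<nu> A \<or> measure \<nu> A - e1 / 2 < 0"
      unfolding emeasure_eq_measure using e' by (auto simp: ennreal_less_iff)
    ultimately consider K where "K \<subseteq> A" "compact K" "ennreal (measure \<nu> A - e1 / 2) < emeasure \<nu> K"
      | "measure \<nu> A - e1 / 2 < 0"
      by (auto simp: less_SUP_iff)
    then show ?thesis
    proof cases
      case 1
      then show ?thesis using that[of K] by (auto simp: emeasure_eq_measure ennreal_less_iff not_le)
         (smt (verit) ennreal_less_iff ennreal_neg measure_nonneg)
    next
      case 2
      then show ?thesis using that[of "{}"] by auto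
    qed
  qed
  obtain U where U: "A \<subseteq> U" "open U" "measure \<nu> U < measure \<nu> A + e1 / 2"
  proof -
    have "emeasure \<nu> A = (INF U \<in> {U. A \<subseteq> U \<and> open U}. emeasure \<nu> U)"
      using outer_regular[OF sb fine] A by auto
    moreover have "emeasure \<nu> A < ennreal (measure \<nu> A + e1 / 2)"
      unfolding emeasure_eq_measure using e' by (subst ennreal_less_iff) auto
    ultimately obtain U where "A \<subseteq> U" "open U" "emeasure \<nu> U < ennreal (measure \<nu> A + e1 / 2)"
      by (auto simp: INF_less_iff)
    then show ?thesis using that[of U] by (auto simp: emeasure_eq_measure ennreal_less_iff)
  qed
  obtain g where g: "continuous_on UNIV g" "\<And>x. g x \<in> closed_segment (1::real) 0"
    "\<And>x. x \<in> K \<Longrightarrow> g x = 1" "\<And>x. x \<in> - U \<Longrightarrow> g x = 0"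
  proof (rule Urysohn[of K "- U" "1::real" 0])
    show "closed K" "closed (- U)" "K \<inter> - U = {}" using K U by (auto simp: compact_imp_closed)
  qed blast
  have g01: "0 \<le> g x \<and> g x \<le> 1" for x using g(2)[of x] by (auto simp: closed_segment_eq_real_ivl)
  have [measurable]: "g \<in> borel_measurable borel" using g(1) by (rule borel_measurable_continuous_onI)
  have [measurable]: "K \<in> sets borel" "U \<in> sets borel" "A \<in> sets borel"
    using K U A by (auto simp: compact_imp_closed)
  have pt: "\<bar>indicator A x - g x\<bar> \<le> indicator U x - (indicator K x :: real)" for x
    using g01[of x] g(3,4)[of x] K(1) U(1) by (auto simp: indicator_def)
  have pt': "\<bar>indicator A x *\<^sub>R c - c * g x\<bar> \<le> \<bar>c\<bar> * (indicator U x - (indicator K x :: real))" for x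
  proof -
    have "\<bar>indicator A x *\<^sub>R c - c * g x\<bar> = \<bar>c\<bar> * \<bar>indicator A x - g x\<bar>"
      by (simp add: abs_mult[symmetric] algebra_simps)
    then show ?thesis using pt[of x] by (simp add: mult_left_mono)
  qed
  have iI: "integrable \<nu> (\<lambda>x. \<bar>c\<bar> * (indicator U x - (indicator K x :: real)))"
    by (intro integrable_mult_right Bochner_Integration.integrable_diff integrable_real_indicator)
       (auto simp: emeasure_eq_measure sb)
  have "(\<integral>x. \<bar>indicator A x *\<^sub>R c - c * g x\<bar> \<partial>\<nu>) \<le> (\<integral>x. \<bar>c\<bar> * (indicator U x - (indicator K x :: real)) \<partial>\<nu>)"
    by (rule integral_mono'[OF iI pt']) (use order_trans[OF abs_ge_zero pt'] in auto)
  also have "\<dots> = \<bar>c\<bar> * (measure \<nu> U - measure \<nu> K)"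
    by (subst integral_mult_right_zero, subst Bochner_Integration.integral_diff)
       (auto simp: emeasure_eq_measure sb sp)
  also have "\<dots> \<le> \<bar>c\<bar> * e1" using K U by (intro mult_left_mono) linarith+
  also have "\<dots> < e" by (rule e')
  finally have "(\<integral>x. \<bar>indicator A x *\<^sub>R c - c * g x\<bar> \<partial>\<nu>) < e" .
  moreover have "bounded (range (\<lambda>x. c * g x))"
    using g01 by (intro boundedI[of _ "\<bar>c\<bar>"]) (auto simp: abs_mult mult_left_le)
  ultimately show ?case using g(1)
    by (intro exI[of _ "\<lambda>x. c * g x"]) (auto intro!: continuous_intros)
next
  case (add f f')
  interpret finite_measure \<nu> by fact
  have [measurable_cong]: "sets \<nu> = sets borel" by fact
  obtain g where g: "continuous_on UNIV g" "bounded (range g)" "(\<integral>x. \<bar>f x - g x\<bar> \<partial>\<nu>) < e / 2"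
    using add.IH(1)[of "e / 2"] add.prems by auto
  obtain g' where g': "continuous_on UNIV g'" "bounded (range g')" "(\<integral>x. \<bar>f' x - g' x\<bar> \<partial>\<nu>) < e / 2"
    using add.IH(2)[of "e / 2"] add.prems by auto
  have int: "integrable \<nu> u" if "continuous_on UNIV u" "bounded (range u)" for u :: "real \<Rightarrow> real"
  proof -
    note u = that
    obtain b where "\<And>x. \<bar>u x\<bar> \<le> b" using u(2) by (auto simp: bounded_iff)
    then show ?thesis using borel_measurable_continuous_onI[OF u(1)]
      by (intro integrable_const_bound[of _ b]) auto
  qed
  note i = int[OF g(1,2)] int[OF g'(1,2)]
  have "(\<integral>x. \<bar>f x + f' x - (g x + g' x)\<bar> \<partial>\<nu>) \<le> (\<integral>x. \<bar>f x - g x\<bar> + \<bar>f' x - g' x\<bar> \<partial>\<nu>)"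
    using i add by (intro integral_mono) auto
  also have "\<dots> < e" using i add g g' by (subst Bochner_Integration.integral_add) auto
  finally show ?case using g g'
    by (intro exI[of _ "\<lambda>x. g x + g' x"]) (auto intro!: continuous_intros bounded_plus_comp)
next
  case (lim f s)
  interpret finite_measure \<nu> by fact
  have [measurable_cong]: "sets \<nu> = sets borel" by fact
  have "(\<lambda>i. \<integral>x. \<bar>f x - s i x\<bar> \<partial>\<nu>) \<longlonglongrightarrow> (\<integral>x. 0 \<partial>\<nu>)"
  proof (rule integral_dominated_convergence[where w="\<lambda>x. 3 * \<bar>f x\<bar>"])
    show "AE x in \<nu>. (\<lambda>i. \<bar>f x - s i x\<bar>) \<longlonglongrightarrow> 0"
    proof (rule AE_I2)
      fix x assume "x \<in> space \<nu>"
      then have "(\<lambda>i. s i x) \<longlonglongrightarrow> f x" using lim by auto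
      then have "(\<lambda>i. \<bar>f x - s i x\<bar>) \<longlonglongrightarrow> \<bar>f x - f x\<bar>" by (intro tendsto_intros)
      then show "(\<lambda>i. \<bar>f x - s i x\<bar>) \<longlonglongrightarrow> 0" by simp
    qed
    show "AE x in \<nu>. norm \<bar>f x - s i x\<bar> \<le> 3 * \<bar>f x\<bar>" for i
    proof (rule AE_I2)
      fix x assume "x \<in> space \<nu>"
      then have "\<bar>s i x\<bar> \<le> 2 * \<bar>f x\<bar>" using lim by auto
      then show "norm \<bar>f x - s i x\<bar> \<le> 3 * \<bar>f x\<bar>" by auto
    qed
  qed (use lim in auto)
  then have "\<forall>\<^sub>F i in sequentially. (\<integral>x. \<bar>f x - s i x\<bar> \<partial>\<nu>) < e / 2"
    using lim.prems by (intro order_tendstoD) auto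
  then obtain i where i: "(\<integral>x. \<bar>f x - s i x\<bar> \<partial>\<nu>) < e / 2"
    by (auto simp: eventually_sequentially)
  obtain g where g: "continuous_on UNIV g" "bounded (range g)" "(\<integral>x. \<bar>s i x - g x\<bar> \<partial>\<nu>) < e / 2"
    using lim.IH[of "e / 2" i] lim.prems by auto
  obtain b where b: "\<And>x. \<bar>g x\<bar> \<le> b" using g(2) by (auto simp: bounded_iff)
  have ig: "integrable \<nu> g" using borel_measurable_continuous_onI[OF g(1)] b
    by (intro integrable_const_bound[of _ b]) auto
  have "(\<integral>x. \<bar>f x - g x\<bar> \<partial>\<nu>) \<le> (\<integral>x. \<bar>f x - s i x\<bar> + \<bar>s i x - g x\<bar> \<partial>\<nu>)"
    using lim ig by (intro integral_mono) auto
  also have "\<dots> < e" using i g ig lim by (subst Bochner_Integration.integral_add) auto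
  finally show ?case using g by blast
qed

section \<open>Regularity of quadratic forms by integration by parts\<close>

lemma integrable_bounded_mult:
  fixes b g :: "'a \<Rightarrow> real"
  assumes "integrable M g" "b \<in> borel_measurable M" "\<And>x. \<bar>b x\<bar> \<le> C"
  shows "integrable M (\<lambda>x. b x * g x)"
proof (rule Bochner_Integration.integrable_bound)
  show "integrable M (\<lambda>x. C * \<bar>g x\<bar>)" using assms by auto
  have "0 \<le> C" using assms(3) abs_ge_zero order_trans by blast
  then show "AE x in M. norm (b x * g x) \<le> norm (C * \<bar>g x\<bar>)"
    using assms(3) by (auto simp: abs_mult intro!: mult_right_mono)
qed (use assms in auto)

text \<open>A law on \<open>\<real> \<times> bool\<close> encodes a mixture: given the label \<open>True\<close> (of mass \<open>m\<close>) the real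
  coordinate has a smooth density with logarithmic derivative \<open>l\<close>, and \<open>V\<close> bounds the Fisher
  information. Only this smooth part is differentiated.\<close>

definition scored_law :: "real \<Rightarrow> real \<Rightarrow> (real \<times> bool) measure \<Rightarrow> (real \<Rightarrow> real) \<Rightarrow> bool" where
  "scored_law m V P l \<longleftrightarrow> prob_space P \<and> sets P = sets (borel \<Otimes>\<^sub>M count_space UNIV)
     \<and> integrable P fst \<and> l \<in> borel_measurable borel
     \<and> (\<integral>y. of_bool (snd y) \<partial>P) = m
     \<and> integrable P (\<lambda>y. of_bool (snd y) * (l (fst y))\<^sup>2)
     \<and> (\<integral>y. of_bool (snd y) * (l (fst y))\<^sup>2 \<partial>P) \<le> V
     \<and> (\<forall>g g'. (\<forall>u. (g has_real_derivative g' u) (at u)) \<longrightarrow> continuous_on UNIV g' \<longrightarrow>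
          (\<integral>y. of_bool (snd y) * g' (fst y) \<partial>P) = - (\<integral>y. of_bool (snd y) * l (fst y) * g (fst y) \<partial>P))"

text \<open>Fubini isolates coordinate \<open>i\<close>, where the defining identity of
  \<open>scored_law\<close> applies. The factor \<open>of_bool\<close> lets the label be set to
  \<open>True\<close> under the integral, so \<open>F\<close> has to be differentiable only along
  the slice labelled \<open>True\<close>.\<close>

lemma integration_by_parts_coordinate:
  fixes F F' :: "('i \<Rightarrow> real \<times> bool) \<Rightarrow> real"
  assumes P: "\<And>j. scored_law m V (P j) (l j)" and I: "finite I" "i \<in> I"
    and d: "\<And>x u. ((\<lambda>u. F (x(i := (u, True)))) has_real_derivative F' (x(i := (u, True)))) (at u)"
    and c: "\<And>x. continuous_on UNIV (\<lambda>u. F' (x(i := (u, True))))"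
    and i1: "integrable (PiM I P) (\<lambda>x. of_bool (snd (x i)) * F' x)"
    and i2: "integrable (PiM I P) (\<lambda>x. of_bool (snd (x i)) * l i (fst (x i)) * F x)"
  shows "(\<integral>x. of_bool (snd (x i)) * F' x \<partial>PiM I P)
    = - (\<integral>x. of_bool (snd (x i)) * l i (fst (x i)) * F x \<partial>PiM I P)"
proof -
  let ?J = "I - {i}"
  have II: "insert i ?J = I" "finite ?J" "i \<notin> ?J" using I by auto
  interpret PP: product_prob_space P I
    by (rule product_prob_spaceI) (use P in \<open>auto simp: scored_law_def\<close>)
  have "(\<integral>x. of_bool (snd (x i)) * F' x \<partial>PiM I P)
    = (\<integral>x. (\<integral>y. of_bool (snd y) * F' (x(i := y)) \<partial>P i) \<partial>PiM ?J P)"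
    using PP.product_integral_insert[OF II(2,3), of "\<lambda>x. of_bool (snd (x i)) * F' x"] i1 II by simp
  also have "\<dots> = (\<integral>x. - (\<integral>y. of_bool (snd y) * l i (fst y) * F (x(i := y)) \<partial>P i) \<partial>PiM ?J P)"
  proof (rule Bochner_Integration.integral_cong[OF refl])
    fix x
    have "(\<integral>y. of_bool (snd y) * F' (x(i := y)) \<partial>P i) = (\<integral>y. of_bool (snd y) * F' (x(i := (fst y, True))) \<partial>P i)"
      by (rule Bochner_Integration.integral_cong) (auto simp: of_bool_def)
    also have "\<dots> = - (\<integral>y. of_bool (snd y) * l i (fst y) * F (x(i := (fst y, True))) \<partial>P i)"
    proof -
      have "\<And>g g'. (\<And>u. (g has_real_derivative g' u) (at u)) \<Longrightarrow> continuous_on UNIV g' \<Longrightarrow>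
          (\<integral>y. of_bool (snd y) * g' (fst y) \<partial>P i) = - (\<integral>y. of_bool (snd y) * l i (fst y) * g (fst y) \<partial>P i)"
        using P[of i] unfolding scored_law_def by blast
      from this[OF d c] show ?thesis .
    qed
    also have "(\<integral>y. of_bool (snd y) * l i (fst y) * F (x(i := (fst y, True))) \<partial>P i)
       = (\<integral>y. of_bool (snd y) * l i (fst y) * F (x(i := y)) \<partial>P i)"
      by (rule Bochner_Integration.integral_cong) (auto simp: of_bool_def)
    finally show "(\<integral>y. of_bool (snd y) * F' (x(i := y)) \<partial>P i)
      = - (\<integral>y. of_bool (snd y) * l i (fst y) * F (x(i := y)) \<partial>P i)" .
  qed
  also have "\<dots> = - (\<integral>x. of_bool (snd (x i)) * l i (fst (x i)) * F x \<partial>PiM I P)"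
    using PP.product_integral_insert[OF II(2,3), of "\<lambda>x. of_bool (snd (x i)) * l i (fst (x i)) * F x"] i2 II by simp
  finally show ?thesis .
qed

text \<open>With \<open>\<nabla>\<close> the derivative of speed \<open>s\<close> in all coordinates labelled \<open>True\<close>, \<open>dform\<close> is
  \<open>\<nabla>\<close> of the quadratic form, \<open>ddform\<close> its second \<open>\<nabla>\<close>-derivative, which depends on the labels
  only, and \<open>- tscore\<close> the adjoint of \<open>\<nabla>\<close> applied to \<open>1\<close>.\<close>

definition lform :: "('i \<Rightarrow> 'i \<Rightarrow> real) \<Rightarrow> 'i set \<Rightarrow> 'i \<Rightarrow> ('i \<Rightarrow> real \<times> bool) \<Rightarrow> real" where
  "lform q I i x = (\<Sum>j\<in>I. 2 * q i j * fst (x j))"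

definition dform :: "real \<Rightarrow> ('i \<Rightarrow> 'i \<Rightarrow> real) \<Rightarrow> 'i set \<Rightarrow> ('i \<Rightarrow> real \<times> bool) \<Rightarrow> real" where
  "dform s q I x = (\<Sum>i\<in>I. s * of_bool (snd (x i)) * lform q I i x)"

definition eform :: "real \<Rightarrow> ('i \<Rightarrow> 'i \<Rightarrow> real) \<Rightarrow> 'i set \<Rightarrow> 'i \<Rightarrow> ('i \<Rightarrow> real \<times> bool) \<Rightarrow> real" where
  "eform s q I i x = (\<Sum>k\<in>I. s * of_bool (snd (x k)) * (2 * q k i))"

definition ddform :: "real \<Rightarrow> ('i \<Rightarrow> 'i \<Rightarrow> real) \<Rightarrow> 'i set \<Rightarrow> ('i \<Rightarrow> real \<times> bool) \<Rightarrow> real" where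
  "ddform s q I x = (\<Sum>i\<in>I. s * of_bool (snd (x i)) * eform s q I i x)"

definition tscore :: "real \<Rightarrow> ('i \<Rightarrow> real \<Rightarrow> real) \<Rightarrow> 'i set \<Rightarrow> ('i \<Rightarrow> real \<times> bool) \<Rightarrow> real" where
  "tscore s l I x = (\<Sum>i\<in>I. s * of_bool (snd (x i)) * l i (fst (x i)))"

text \<open>The label of coordinate \<open>i\<close> stays \<open>True\<close> while its real part
  moves, so all label factors are constant in \<open>u\<close>. Symmetry of \<open>q\<close> merges
  the row and the column sum into the factor 2 of \<open>lform\<close>.\<close>

lemma forms_DERIV:
  assumes I: "finite I" "i \<in> I" and q: "q i i = 0" "\<And>j. q j i = q i j"
  shows "((\<lambda>u. qform q I (\<lambda>k. fst ((x(i := (u, True))) k))) has_real_derivative lform q I i (x(i := (u, True)))) (at u)"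
    and "((\<lambda>u. dform s q I (x(i := (u, True)))) has_real_derivative eform s q I i (x(i := (u, True)))) (at u)"
    and "continuous_on UNIV (\<lambda>u. lform q I i (x(i := (u, True))))"
    and "continuous_on UNIV (\<lambda>u. eform s q I i (x(i := (u, True))))"
proof -
  have z: "((\<lambda>u. fst ((x(i := (u, True))) k)) has_real_derivative of_bool (k = i)) (at u)" for k u
    by (cases "k = i") auto
  have lb: "of_bool (snd ((x(i := (u, True))) k)) = (of_bool (k = i \<or> snd (x k)) :: real)" for u k
    by auto
  have "((\<lambda>u. qform q I (\<lambda>k. fst ((x(i := (u, True))) k))) has_real_derivative
     (\<Sum>k\<in>I. \<Sum>j\<in>I. q k j * of_bool (k = i) * fst ((x(i := (u, True))) j)
        + q k j * fst ((x(i := (u, True))) k) * of_bool (j = i))) (at u)"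
    unfolding qform_def
    by (intro DERIV_sum) (auto intro!: derivative_eq_intros z simp del: fun_upd_apply)
  also have "(\<Sum>k\<in>I. \<Sum>j\<in>I. q k j * of_bool (k = i) * fst ((x(i := (u, True))) j)
        + q k j * fst ((x(i := (u, True))) k) * of_bool (j = i)) = lform q I i (x(i := (u, True)))"
  proof -
    have "(\<Sum>k\<in>I. \<Sum>j\<in>I. q k j * of_bool (k = i) * fst ((x(i := (u, True))) j)) 
       = (\<Sum>j\<in>I. q i j * fst ((x(i := (u, True))) j))"
    proof -
      have "(\<Sum>k\<in>I. \<Sum>j\<in>I. q k j * of_bool (k = i) * fst ((x(i := (u, True))) j))
        = (\<Sum>k\<in>I. if k = i then (\<Sum>j\<in>I. q i j * fst ((x(i := (u, True))) j)) else 0)"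
        by (intro sum.cong refl) auto
      then show ?thesis using I by simp
    qed
    moreover have "(\<Sum>k\<in>I. \<Sum>j\<in>I. q k j * fst ((x(i := (u, True))) k) * of_bool (j = i))
       = (\<Sum>k\<in>I. q i k * fst ((x(i := (u, True))) k))"
      using I by (intro sum.cong refl) (simp add: of_bool_def q(2) if_distrib[of "\<lambda>y. _ * y"] cong: if_cong)
    ultimately show ?thesis
      unfolding lform_def sum.distrib by (simp add: sum.distrib[symmetric] mult.assoc del: fun_upd_apply)
  qed
  finally show "((\<lambda>u. qform q I (\<lambda>k. fst ((x(i := (u, True))) k))) has_real_derivative lform q I i (x(i := (u, True)))) (at u)" .
  have "((\<lambda>u. dform s q I (x(i := (u, True)))) has_real_derivative
     (\<Sum>k\<in>I. s * of_bool (k = i \<or> snd (x k)) * (\<Sum>j\<in>I. 2 * q k j * of_bool (j = i)))) (at u)"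
    unfolding dform_def lform_def lb
    by (intro DERIV_sum DERIV_cmult z)
  also have "(\<Sum>k\<in>I. s * of_bool (k = i \<or> snd (x k)) * (\<Sum>j\<in>I. 2 * q k j * of_bool (j = i))) = eform s q I i (x(i := (u, True)))"
    unfolding eform_def lb using I
    by (intro sum.cong refl) (simp add: of_bool_def if_distrib[of "\<lambda>y. _ * y"] cong: if_cong)
  finally show "((\<lambda>u. dform s q I (x(i := (u, True)))) has_real_derivative eform s q I i (x(i := (u, True)))) (at u)" .
  have zc: "continuous_on UNIV (\<lambda>u. fst ((x(i := (u, True))) k))" for k
    by (cases "k = i") (auto intro!: continuous_intros)
  show "continuous_on UNIV (\<lambda>u. lform q I i (x(i := (u, True))))"
    unfolding lform_def by (intro continuous_intros zc)
  show "continuous_on UNIV (\<lambda>u. eform s q I i (x(i := (u, True))))"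
    unfolding eform_def lb by (intro continuous_intros)
qed

text \<open>The coordinatewise identity for \<phi>(U) \<psi>(Y), weighted by \<open>s\<close> and
  summed over \<open>i\<close>: the partial derivatives of \<open>U\<close> and \<open>Y\<close> add
  up to \<open>dform\<close> and \<open>ddform\<close>, the scores to \<open>tscore\<close>. Bounds
  on the four functions give integrability, as \<open>lform\<close> and the scores are integrable
  and \<open>eform\<close> is bounded.\<close>

lemma integration_by_parts_quadratic_form:
  fixes \<phi> \<phi>' \<psi> \<psi>' :: "real \<Rightarrow> real"
  assumes P: "\<And>j. scored_law m V (P j) (l j)" and I: "finite I"
    and q: "\<And>i. q i i = 0" "\<And>i j. q j i = q i j"
    and d: "\<And>x. (\<phi> has_real_derivative \<phi>' x) (at x)" "\<And>x. (\<psi> has_real_derivative \<psi>' x) (at x)"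
    and c: "continuous_on UNIV \<phi>'" "continuous_on UNIV \<psi>'"
    and b: "\<And>x. \<bar>\<phi> x\<bar> \<le> ka" "\<And>x. \<bar>\<phi>' x\<bar> \<le> kb" "\<And>x. \<bar>\<psi> x\<bar> \<le> kc" "\<And>x. \<bar>\<psi>' x\<bar> \<le> kd"
  defines "U \<equiv> \<lambda>x. qform q I (\<lambda>k. fst (x k))"
  shows "(\<integral>x. \<phi>' (U x) * \<psi> (dform s q I x) * dform s q I x + \<phi> (U x) * \<psi>' (dform s q I x) * ddform s q I x \<partial>PiM I P)
     = - (\<integral>x. \<phi> (U x) * \<psi> (dform s q I x) * tscore s l I x \<partial>PiM I P)"
    and "integrable (PiM I P) (\<lambda>x. \<phi>' (U x) * \<psi> (dform s q I x) * dform s q I x)"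
    and "integrable (PiM I P) (\<lambda>x. \<phi> (U x) * \<psi>' (dform s q I x) * ddform s q I x)"
proof -
  have pp: "prob_space (P j)" for j using P by (auto simp: scored_law_def)
  have S[measurable_cong]: "sets (P j) = sets (borel \<Otimes>\<^sub>M count_space UNIV)" for j
    using P by (auto simp: scored_law_def)
  have [measurable]: "l j \<in> borel_measurable borel" for j using P by (auto simp: scored_law_def)
  interpret PJ: prob_space "PiM I P" by (intro prob_space_PiM pp)
  have "continuous_on UNIV \<phi>" "continuous_on UNIV \<psi>"
    using d by (meson DERIV_continuous_on has_field_derivative_at_within)+
  then have [measurable]: "\<phi> \<in> borel_measurable borel" "\<psi> \<in> borel_measurable borel"
    "\<phi>' \<in> borel_measurable borel" "\<psi>' \<in> borel_measurable borel"
    using c by (auto intro: borel_measurable_continuous_onI)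
  have comp[measurable]: "(\<lambda>x. fst (x i)) \<in> borel_measurable (PiM I P)"
    "(\<lambda>x. snd (x i)) \<in> measurable (PiM I P) (count_space UNIV)" if "i \<in> I" for i
    using that by measurable
  have ob[measurable]: "(\<lambda>x. of_bool (snd (x i)) :: real) \<in> borel_measurable (PiM I P)" if "i \<in> I" for i
    unfolding of_bool_def using that by measurable
  have mU[measurable]: "U \<in> borel_measurable (PiM I P)" unfolding U_def qform_def by measurable
  have mL[measurable]: "lform q I i \<in> borel_measurable (PiM I P)" for i unfolding lform_def by measurable
  have mY[measurable]: "dform s q I \<in> borel_measurable (PiM I P)" unfolding dform_def by measurable
  have mE[measurable]: "eform s q I i \<in> borel_measurable (PiM I P)" for i unfolding eform_def by measurable
  have iu: "integrable (PiM I P) (\<lambda>x. fst (x i))" if "i \<in> I" for i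
    using PiM_component_integrable_iff[of I P i fst] pp that P[of i] by (auto simp: scored_law_def)
  have iL: "integrable (PiM I P) (lform q I i)" for i
    unfolding lform_def by (intro Bochner_Integration.integrable_sum integrable_mult_right iu)
  have il: "integrable (PiM I P) (\<lambda>x. of_bool (snd (x i)) * l i (fst (x i)))" if "i \<in> I" for i
  proof (rule PJ.square_integrable_imp_integrable)
    have "integrable (P i) (\<lambda>y. of_bool (snd y) * (l i (fst y))\<^sup>2)" using P[of i] by (auto simp: scored_law_def)
    then have "integrable (PiM I P) (\<lambda>x. of_bool (snd (x i)) * (l i (fst (x i)))\<^sup>2)"
      using PiM_component_integrable_iff[of I P i "\<lambda>y. of_bool (snd y) * (l i (fst y))\<^sup>2"] pp that by auto
    also have "(\<lambda>x. of_bool (snd (x i)) * (l i (fst (x i)))\<^sup>2) = (\<lambda>x. (of_bool (snd (x i)) * l i (fst (x i)))\<^sup>2)"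
      by (auto simp: of_bool_def)
    finally show "integrable (PiM I P) (\<lambda>x. (of_bool (snd (x i)) * l i (fst (x i)))\<^sup>2)" .
  qed (use that in measurable)
  have be: "\<bar>eform s q I i x\<bar> \<le> (\<Sum>k\<in>I. \<bar>s\<bar> * \<bar>2 * q k i\<bar>)" for i x
    unfolding eform_def
    by (rule order_trans[OF sum_abs]) (auto intro!: sum_mono simp: abs_mult of_bool_def)
  have ie: "integrable (PiM I P) (eform s q I i)" for i
    by (rule PJ.integrable_const_bound[of _ "\<Sum>k\<in>I. \<bar>s\<bar> * \<bar>2 * q k i\<bar>"]) (use be in auto)
  let ?F = "\<lambda>x. \<phi> (U x) * \<psi> (dform s q I x)"
  let ?F' = "\<lambda>i x. \<phi>' (U x) * \<psi> (dform s q I x) * lform q I i x + \<phi> (U x) * \<psi>' (dform s q I x) * eform s q I i x"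
  have bb: "\<bar>of_bool t\<bar> \<le> (1::real)" for t by auto
  have bm: "\<bar>u * v\<bar> \<le> b * b'" if "\<bar>u\<bar> \<le> b" "\<bar>v\<bar> \<le> b'" for u v b b' :: real
    using that order_trans[OF abs_ge_zero that(1)] by (auto simp: abs_mult intro!: mult_mono)
  have iF1: "integrable (PiM I P) (\<lambda>x. (of_bool (snd (x i)) * (\<phi>' (U x) * \<psi> (dform s q I x))) * lform q I i x)" if "i \<in> I" for i
  proof (rule integrable_bounded_mult[OF iL, where C = "1 * (kb * kc)"])
    note [measurable] = ob[OF that]
    show "(\<lambda>x. of_bool (snd (x i)) * (\<phi>' (U x) * \<psi> (dform s q I x))) \<in> borel_measurable (PiM I P)"
      by measurable
  qed (intro bm bb b)
  have iF2: "integrable (PiM I P) (\<lambda>x. (of_bool (snd (x i)) * (\<phi> (U x) * \<psi>' (dform s q I x))) * eform s q I i x)" if "i \<in> I" for i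
  proof (rule integrable_bounded_mult[OF ie, where C = "1 * (ka * kd)"])
    note [measurable] = ob[OF that]
    show "(\<lambda>x. of_bool (snd (x i)) * (\<phi> (U x) * \<psi>' (dform s q I x))) \<in> borel_measurable (PiM I P)"
      by measurable
  qed (intro bm bb b)
  have iF': "integrable (PiM I P) (\<lambda>x. of_bool (snd (x i)) * ?F' i x)" if "i \<in> I" for i
    using Bochner_Integration.integrable_add[OF iF1[OF that] iF2[OF that]] by (simp add: algebra_simps)
  have iF: "integrable (PiM I P) (\<lambda>x. of_bool (snd (x i)) * l i (fst (x i)) * ?F x)" if "i \<in> I" for i
    using integrable_bounded_mult[OF il[OF that], of ?F "ka * kc"] by (simp add: bm b algebra_simps)
  have ibp: "(\<integral>x. of_bool (snd (x i)) * ?F' i x \<partial>PiM I P)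
    = - (\<integral>x. of_bool (snd (x i)) * l i (fst (x i)) * ?F x \<partial>PiM I P)" if "i \<in> I" for i
  proof (rule integration_by_parts_coordinate[OF P I that _ _ iF'[OF that] iF[OF that]])
    note D = forms_DERIV[where q=q and I=I and i=i, OF I that q(1) q(2)]
    fix x
    show der: "((\<lambda>u. ?F (x(i := (u, True)))) has_real_derivative ?F' i (x(i := (u, True)))) (at u)" for u
    proof -
      have 1: "((\<lambda>u. \<phi> (U (x(i := (u, True))))) has_real_derivative \<phi>' (U (x(i := (u, True)))) * lform q I i (x(i := (u, True)))) (at u)"
        unfolding U_def by (rule DERIV_chain2[OF d(1) D(1)])
      have 2: "((\<lambda>u. \<psi> (dform s q I (x(i := (u, True))))) has_real_derivative \<psi>' (dform s q I (x(i := (u, True)))) * eform s q I i (x(i := (u, True)))) (at u)"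
        by (rule DERIV_chain2[OF d(2) D(2)])
      show ?thesis using DERIV_mult[OF 1 2] by (simp only: ac_simps)
    qed
    have U: "continuous_on UNIV (\<lambda>u. U (x(i := (u, True))))"
      unfolding U_def using D(1)[of x] by (meson DERIV_continuous_on has_field_derivative_at_within)
    have Y: "continuous_on UNIV (\<lambda>u. dform s q I (x(i := (u, True))))"
      using D(2)[of s x] by (meson DERIV_continuous_on has_field_derivative_at_within)
    have cc: "continuous_on UNIV (\<lambda>u. f (g u))" if "continuous_on UNIV f" "continuous_on UNIV g" for f g :: "real \<Rightarrow> real"
      using continuous_on_compose2[OF that(1) that(2)] by auto
    show "continuous_on UNIV (\<lambda>u. ?F' i (x(i := (u, True))))"
      using c d by (intro continuous_intros cc[OF _ U] cc[OF _ Y] D(3,4) c)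
        (auto intro: DERIV_continuous_on has_field_derivative_at_within)
  qed
  have e1: "\<phi>' (U x) * \<psi> (dform s q I x) * dform s q I x
    = (\<Sum>i\<in>I. s * ((of_bool (snd (x i)) * (\<phi>' (U x) * \<psi> (dform s q I x))) * lform q I i x))" for x
    by (subst (2) dform_def) (auto simp: sum_distrib_left intro!: sum.cong)
  have e2: "\<phi> (U x) * \<psi>' (dform s q I x) * ddform s q I x
    = (\<Sum>i\<in>I. s * ((of_bool (snd (x i)) * (\<phi> (U x) * \<psi>' (dform s q I x))) * eform s q I i x))" for x
    by (subst ddform_def) (auto simp: sum_distrib_left intro!: sum.cong)
  have e3: "\<phi> (U x) * \<psi> (dform s q I x) * tscore s l I x = (\<Sum>i\<in>I. s * (of_bool (snd (x i)) * l i (fst (x i)) * ?F x))" for x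
    by (auto simp: tscore_def sum_distrib_left intro!: sum.cong)
  show "integrable (PiM I P) (\<lambda>x. \<phi>' (U x) * \<psi> (dform s q I x) * dform s q I x)"
    unfolding e1 by (intro Bochner_Integration.integrable_sum integrable_mult_right iF1)
  show "integrable (PiM I P) (\<lambda>x. \<phi> (U x) * \<psi>' (dform s q I x) * ddform s q I x)"
    unfolding e2 by (intro Bochner_Integration.integrable_sum integrable_mult_right iF2)
  have e12: "\<phi>' (U x) * \<psi> (dform s q I x) * dform s q I x + \<phi> (U x) * \<psi>' (dform s q I x) * ddform s q I x
     = (\<Sum>i\<in>I. s * (of_bool (snd (x i)) * ?F' i x))" for x
    unfolding e1 e2 sum.distrib[symmetric] by (auto intro!: sum.cong simp: algebra_simps)
  show "(\<integral>x. \<phi>' (U x) * \<psi> (dform s q I x) * dform s q I x + \<phi> (U x) * \<psi>' (dform s q I x) * ddform s q I x \<partial>PiM I P)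
     = - (\<integral>x. \<phi> (U x) * \<psi> (dform s q I x) * tscore s l I x \<partial>PiM I P)"
    unfolding e12 e3
    by (subst (1 2) Bochner_Integration.integral_sum) (simp_all add: iF' iF ibp sum_negf)
qed

section \<open>The regularity estimate for labelled laws\<close>

lemma scored_law_basic:
  assumes "scored_law m V P l"
  shows "prob_space P" "0 \<le> m" "m \<le> 1" "0 \<le> V"
    "integrable P (\<lambda>y. of_bool (snd y) * l (fst y))" "(\<integral>y. of_bool (snd y) * l (fst y) \<partial>P) = 0"
    "integrable P (\<lambda>y. (of_bool (snd y) * l (fst y))\<^sup>2)" "(\<integral>y. (of_bool (snd y) * l (fst y))\<^sup>2 \<partial>P) \<le> V"
    "integrable P (\<lambda>y. of_bool (snd y) :: real)"
proof -
  show "prob_space P" using assms by (auto simp: scored_law_def)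
  then interpret prob_space P .
  have [measurable_cong]: "sets P = sets (borel \<Otimes>\<^sub>M count_space UNIV)"
    using assms by (auto simp: scored_law_def)
  have [measurable]: "l \<in> borel_measurable borel" using assms by (auto simp: scored_law_def)
  have [measurable]: "(\<lambda>y. of_bool (snd y) :: real) \<in> borel_measurable P"
    unfolding of_bool_def by measurable
  show ob: "integrable P (\<lambda>y. of_bool (snd y) :: real)"
    by (rule integrable_const_bound[of _ 1]) auto
  have m: "m = (\<integral>y. of_bool (snd y) \<partial>P)" using assms by (auto simp: scored_law_def)
  show "0 \<le> m" unfolding m by simp
  have "m \<le> (\<integral>y. 1 \<partial>P)" unfolding m using ob by (intro integral_mono) auto
  then show "m \<le> 1" by (simp add: prob_space)
  have sq: "(of_bool (snd y) * l (fst y))\<^sup>2 = of_bool (snd y) * (l (fst y))\<^sup>2" for y :: "real \<times> bool"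
    by (auto simp: of_bool_def)
  show i2: "integrable P (\<lambda>y. (of_bool (snd y) * l (fst y))\<^sup>2)"
    and V: "(\<integral>y. (of_bool (snd y) * l (fst y))\<^sup>2 \<partial>P) \<le> V"
    unfolding sq using assms by (auto simp: scored_law_def)
  have "0 \<le> (\<integral>y. (of_bool (snd y) * l (fst y))\<^sup>2 \<partial>P)" by simp
  then show "0 \<le> V" using V by linarith
  show "integrable P (\<lambda>y. of_bool (snd y) * l (fst y))"
    by (rule square_integrable_imp_integrable[OF _ i2]) measurable
  have "\<And>g g'. (\<And>u. (g has_real_derivative g' u) (at u)) \<Longrightarrow> continuous_on UNIV g' \<Longrightarrow>
          (\<integral>y. of_bool (snd y) * g' (fst y) \<partial>P) = - (\<integral>y. of_bool (snd y) * l (fst y) * g (fst y) \<partial>P)"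
    using assms unfolding scored_law_def by blast
  \<comment> \<open>The constant test function 1 shows that the score is centred.\<close>
  from this[of "\<lambda>_. 1" "\<lambda>_. 0"] show "(\<integral>y. of_bool (snd y) * l (fst y) \<partial>P) = 0" by simp
qed

text \<open>Up to the factor \<open>2 * s\<^sup>2\<close>, \<open>ddform\<close> sums
  \<open>q\<close> over ordered pairs of coordinates labelled \<open>True\<close>. The off-diagonal
  pairs number \<open>(N x)\<^sup>2 - N x\<close>, and each contributes at least
  \<open>1 / n\<close>.\<close>

lemma ddform_ge:
  fixes q :: "'i \<Rightarrow> 'i \<Rightarrow> real"
  assumes I: "finite I" and n: "real (card I) = n" "0 < n" and s: "s\<^sup>2 = 1 / n"
    and q: "\<And>i. q i i = 0" "\<And>i j. i \<in> I \<Longrightarrow> j \<in> I \<Longrightarrow> i \<noteq> j \<Longrightarrow> 1 / n \<le> q i j"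
  defines "N \<equiv> \<lambda>x :: 'i \<Rightarrow> real \<times> bool. (\<Sum>i\<in>I. of_bool (snd (x i)) :: real)"
  shows "2 / n\<^sup>2 * ((N x)\<^sup>2 - N x) \<le> ddform s q I x"
proof -
  let ?t = "\<lambda>i. of_bool (snd (x i)) :: real"
  have dd: "ddform s q I x = 2 / n * (\<Sum>i\<in>I. \<Sum>k\<in>I. ?t i * ?t k * q k i)"
  proof -
    have "s * a * (s * b * (2 * c)) = 2 / n * (a * b * c)" for a b c
    proof -
      have "s * a * (s * b * (2 * c)) = s\<^sup>2 * (2 * (a * b * c))" by (simp add: power2_eq_square)
      then show ?thesis unfolding s by simp
    qed
    then show ?thesis unfolding ddform_def eform_def sum_distrib_left by simp
  qed
  have "(\<Sum>i\<in>I. \<Sum>k\<in>I. ?t i * ?t k * (1 / n) - (if k = i then ?t i * ?t i * (1 / n) else 0)) \<le> (\<Sum>i\<in>I. \<Sum>k\<in>I. ?t i * ?t k * q k i)"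
  proof (intro sum_mono)
    fix i k assume ik: "i \<in> I" "k \<in> I"
    show "?t i * ?t k * (1 / n) - (if k = i then ?t i * ?t i * (1 / n) else 0) \<le> ?t i * ?t k * q k i"
      using q(2)[of k i] ik q(1)[of i] n by (cases "k = i") (auto intro!: mult_left_mono)
  qed
  also have "(\<Sum>i\<in>I. \<Sum>k\<in>I. ?t i * ?t k * (1 / n) - (if k = i then ?t i * ?t i * (1 / n) else 0))
    = ((N x)\<^sup>2 - N x) / n"
  proof -
    have "(\<Sum>i\<in>I. \<Sum>k\<in>I. ?t i * ?t k * (1 / n)) = (N x)\<^sup>2 / n"
      unfolding N_def power2_eq_square sum_product by (simp add: sum_divide_distrib)
    moreover have "(\<Sum>i\<in>I. \<Sum>k\<in>I. (if k = i then ?t i * ?t i * (1 / n) else 0)) = N x / n"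
      unfolding N_def sum_divide_distrib
    proof (intro sum.cong refl)
      fix i assume "i \<in> I"
      then have "(\<Sum>k\<in>I. if k = i then ?t i * ?t i * (1 / n) else 0) = ?t i * ?t i * (1 / n)"
        using I by simp
      then show "(\<Sum>k\<in>I. if k = i then ?t i * ?t i * (1 / n) else 0) = ?t i / n"
        by (cases "snd (x i)") simp_all
    qed
    ultimately show ?thesis by (simp add: sum_subtractf diff_divide_distrib)
  qed
  finally have "2 / n * (((N x)\<^sup>2 - N x) / n) \<le> 2 / n * (\<Sum>i\<in>I. \<Sum>k\<in>I. ?t i * ?t k * q k i)"
    using n by (intro mult_left_mono) auto
  then show ?thesis unfolding dd by (simp add: power2_eq_square)
qed

text \<open>Splits g into g Y^2/(Y^2+\<eta>) and g \<eta>/(Y^2+\<eta>). Integration by parts bounds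
  the first by means of \<phi>. The second is at most b times the mean of \<eta>/(Y^2+\<eta>), which
  is small once \<open>ddform\<close> is bounded below by m^2/4; Chebyshev's inequality for the
  number of labels \<open>True\<close> accounts for the rest and produces the term in 1/n.\<close>

lemma quadratic_form_regularity_scored:
  fixes q :: "'i \<Rightarrow> 'i \<Rightarrow> real" and \<phi> g :: "real \<Rightarrow> real"
  assumes P: "\<And>j. scored_law m V (P j) (l j)" and I: "finite I"
    and n: "real (card I) = n" "0 < n" "0 < m" "4 \<le> m * n"
    and q: "\<And>i. q i i = 0" "\<And>i j. q j i = q i j" "\<And>i j. i \<in> I \<Longrightarrow> j \<in> I \<Longrightarrow> i \<noteq> j \<Longrightarrow> 1 / n \<le> q i j"
    and d: "\<And>x. (\<phi> has_real_derivative g x) (at x)" and c: "continuous_on UNIV g"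
    and b: "\<And>x. \<bar>\<phi> x\<bar> \<le> a" "\<And>x. \<bar>g x\<bar> \<le> b" and \<eta>: "0 < \<eta>"
  shows "\<bar>\<integral>x. g (qform q I (\<lambda>k. fst (x k))) \<partial>PiM I P\<bar>
    \<le> 3 * a * ((1 + V) / 2) / sqrt \<eta> + b * (8 * sqrt \<eta> * ((1 + V) / 2) / m\<^sup>2 + 4 / (m\<^sup>2 * n))"
proof -
  define s where "s = 1 / sqrt n"
  have s2: "s\<^sup>2 = 1 / n" using n by (simp add: s_def power_divide)
  define U where "U x = qform q I (\<lambda>k. fst (x k))" for x :: "'i \<Rightarrow> real \<times> bool"
  define Y where "Y = dform s q I"
  define C where "C = ddform s q I"
  define T where "T = tscore s l I"
  define N where "N x = (\<Sum>i\<in>I. of_bool (snd (x i)) :: real)" for x :: "'i \<Rightarrow> real \<times> bool"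
  let ?t = "(1 + V) / 2"
  have pp: "prob_space (P j)" for j using P by (auto simp: scored_law_def)
  have S[measurable_cong]: "sets (P j) = sets (borel \<Otimes>\<^sub>M count_space UNIV)" for j
    using P by (auto simp: scored_law_def)
  have [measurable]: "l j \<in> borel_measurable borel" for j using P by (auto simp: scored_law_def)
  interpret PJ: prob_space "PiM I P" by (intro prob_space_PiM pp)
  have "continuous_on UNIV \<phi>" using d by (meson DERIV_continuous_on has_field_derivative_at_within)
  then have [measurable]: "\<phi> \<in> borel_measurable borel" "g \<in> borel_measurable borel"
    using c by (auto intro: borel_measurable_continuous_onI)
  have comp[measurable]: "(\<lambda>x. fst (x i)) \<in> borel_measurable (PiM I P)"
    "(\<lambda>x. snd (x i)) \<in> measurable (PiM I P) (count_space UNIV)" if "i \<in> I" for i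
    using that by measurable
  have ob[measurable]: "(\<lambda>x. of_bool (snd (x i)) :: real) \<in> borel_measurable (PiM I P)" if "i \<in> I" for i
    unfolding of_bool_def using that by measurable
  have mU[measurable]: "U \<in> borel_measurable (PiM I P)" unfolding U_def qform_def by measurable
  have mL[measurable]: "lform q I i \<in> borel_measurable (PiM I P)" for i unfolding lform_def by measurable
  have mY[measurable]: "Y \<in> borel_measurable (PiM I P)" unfolding Y_def dform_def by measurable
  have mE[measurable]: "eform s q I i \<in> borel_measurable (PiM I P)" for i unfolding eform_def by measurable
  have mC[measurable]: "C \<in> borel_measurable (PiM I P)" unfolding C_def ddform_def by measurable
  have mN[measurable]: "N \<in> borel_measurable (PiM I P)" unfolding N_def by measurable
  have q0: "0 \<le> q i j" if "i \<in> I" "j \<in> I" for i j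
  proof (cases "i = j")
    case False
    then have "1 / n \<le> q i j" using q(3) that by blast
    moreover have "0 \<le> 1 / n" using n by simp
    ultimately show ?thesis by linarith
  qed (simp add: q(1))
  have s0: "0 \<le> s" using n by (simp add: s_def)
  have C0: "0 \<le> C x" for x
    unfolding C_def ddform_def eform_def using q0 s0 by (auto intro!: sum_nonneg mult_nonneg_nonneg)
  have a0: "0 \<le> a" and b0: "0 \<le> b" using b abs_ge_zero order_trans by blast+
  note SB = scored_law_basic[OF P]
  \<comment> \<open>The summands are independent and centred with second moments at most
    \<open>s\<^sup>2 * V\<close>. As \<open>s\<^sup>2 * n = 1\<close>, the bound does not grow with
    \<open>n\<close>.\<close>
  have T: "integrable (PiM I P) T" "integrable (PiM I P) (\<lambda>x. (T x)\<^sup>2)" "(\<integral>x. (T x)\<^sup>2 \<partial>PiM I P) \<le> V"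
  proof -
    have f: "T = (\<lambda>x. \<Sum>i\<in>I. s * (of_bool (snd (x i)) * l i (fst (x i))))"
      unfolding T_def tscore_def by (simp add: mult.assoc)
    note R = PiM_sum_square[where f="\<lambda>i y. s * (of_bool (snd y) * l i (fst y))" and J=I and M=P, OF pp I]
    have R': "integrable (PiM I P) T \<and> (\<integral>x. T x \<partial>PiM I P) = 0 \<and> integrable (PiM I P) (\<lambda>x. (T x)\<^sup>2)
      \<and> (\<integral>x. (T x)\<^sup>2 \<partial>PiM I P) = (\<Sum>i\<in>I. (\<integral>y. (s * (of_bool (snd y) * l i (fst y)))\<^sup>2 \<partial>P i))"
      unfolding f by (rule R) (use SB(5-7) in \<open>auto simp: power_mult_distrib\<close>)
    then show "integrable (PiM I P) T" "integrable (PiM I P) (\<lambda>x. (T x)\<^sup>2)" by auto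
    have "(\<integral>x. (T x)\<^sup>2 \<partial>PiM I P) = (\<Sum>i\<in>I. s\<^sup>2 * (\<integral>y. (of_bool (snd y) * l i (fst y))\<^sup>2 \<partial>P i))"
      using R' by (simp add: power_mult_distrib)
    also have "\<dots> \<le> (\<Sum>i\<in>I. s\<^sup>2 * V)" by (intro sum_mono mult_left_mono SB(8)) auto
    also have "\<dots> = V" using n s2 by simp
    finally show "(\<integral>x. (T x)\<^sup>2 \<partial>PiM I P) \<le> V" .
  qed
  have ET: "(\<integral>x. \<bar>T x\<bar> \<partial>PiM I P) \<le> ?t"
  proof -
    have "\<bar>y\<bar> \<le> (1 + y\<^sup>2) / 2" for y :: real
      using zero_le_power2[of "\<bar>y\<bar> - 1"] by (simp add: power2_eq_square algebra_simps)
    then have "(\<integral>x. \<bar>T x\<bar> \<partial>PiM I P) \<le> (\<integral>x. (1 + (T x)\<^sup>2) / 2 \<partial>PiM I P)"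
      using T by (intro integral_mono) auto
    also have "\<dots> \<le> ?t" using T by (simp add: PJ.prob_space)
    finally show ?thesis .
  qed
  have bT: "\<bar>\<integral>x. f x * T x \<partial>PiM I P\<bar> \<le> k * ?t" if k: "\<And>x. \<bar>f x\<bar> \<le> k" for f :: "('i \<Rightarrow> real \<times> bool) \<Rightarrow> real" and k
  proof -
    have k0: "0 \<le> k" using k abs_ge_zero order_trans by blast
    have "\<bar>\<integral>x. f x * T x \<partial>PiM I P\<bar> \<le> (\<integral>x. \<bar>f x * T x\<bar> \<partial>PiM I P)" by (rule integral_abs_bound)
    also have "\<dots> \<le> (\<integral>x. k * \<bar>T x\<bar> \<partial>PiM I P)"
      by (rule integral_mono') (use T k k0 in \<open>auto simp: abs_mult intro!: mult_right_mono\<close>)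
    also have "\<dots> \<le> k * ?t" using mult_left_mono[OF ET k0] by simp
    finally show ?thesis .
  qed
  have den: "0 < y\<^sup>2 + \<eta>" "y\<^sup>2 + \<eta> \<noteq> 0" for y :: real using \<eta> zero_le_power2[of y] by linarith+
  have sq\<eta>: "0 < sqrt \<eta>" "sqrt \<eta> * sqrt \<eta> = \<eta>" using \<eta> by auto
  text \<open>Two integrations by parts: \<open>sqrt \<eta> * arctan (Y / sqrt \<eta>)\<close> shows that \<open>Y\<close> is rarely small,
    and \<open>\<phi> U * Y / (Y\<^sup>2 + \<eta>)\<close> replaces \<open>g = \<phi>'\<close> by \<open>\<phi>\<close> where \<open>Y\<close> is not small.\<close>
  let ?e = "\<lambda>y. \<eta> / (y\<^sup>2 + \<eta>)"
  have e01: "0 \<le> ?e y" "?e y \<le> 1" for y :: real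
    using \<eta> den[of y] by (auto simp: divide_simps)
  have pi2: "pi / 2 \<le> 2" using pi_less_4 by simp
  have d1: "((\<lambda>y. sqrt \<eta> * arctan (y / sqrt \<eta>)) has_real_derivative ?e y) (at y)" for y
    using sq\<eta> \<eta> den[of y]
    by (auto intro!: derivative_eq_intros simp: divide_simps power2_eq_square algebra_simps)
  have A1: "\<bar>sqrt \<eta> * arctan (y / sqrt \<eta>)\<bar> \<le> 2 * sqrt \<eta>" for y
  proof -
    have "\<bar>arctan (y / sqrt \<eta>)\<bar> \<le> 2"
      using arctan_bounded[of "y / sqrt \<eta>"] pi2 by (auto simp: abs_le_iff)
    then show ?thesis using sq\<eta> by (simp add: abs_mult mult.commute)
  qed
  have con_e: "continuous_on UNIV ?e" using den by (intro continuous_intros) auto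
  have triv: "continuous_on UNIV (\<lambda>_::real. 0::real)" "\<bar>1::real\<bar> \<le> 1" "\<bar>0::real\<bar> \<le> 0" "\<bar>?e y\<bar> \<le> 1" for y
    using e01[of y] by (auto simp del: abs_divide)
  \<comment> \<open>With \<phi> constant the first term drops out. What remains bounds the mean of C
    \<eta>/(Y^2+\<eta>) by the sup of an antiderivative of \<eta>/(y^2+\<eta>), which is of order
    sqrt \<eta>.\<close>
  note B1 = integration_by_parts_quadratic_form[where P=P and l=l and q=q and \<phi>="\<lambda>_. 1" and \<phi>'="\<lambda>_. 0" and \<psi>="\<lambda>y. sqrt \<eta> * arctan (y / sqrt \<eta>)"
      and \<psi>'="?e" and ka=1 and kb=0 and kc="2 * sqrt \<eta>" and kd=1 and s=s, OF P I q(1,2) DERIV_const d1 triv(1) con_e triv(2,3) A1 triv(4), folded U_def Y_def C_def T_def]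
  have iCe: "integrable (PiM I P) (\<lambda>x. C x * ?e (Y x))"
    using B1(3) by (simp add: mult.commute)
  have Ce: "(\<integral>x. C x * ?e (Y x) \<partial>PiM I P) \<le> 2 * sqrt \<eta> * ?t"
  proof -
    have "(\<integral>x. C x * ?e (Y x) \<partial>PiM I P) = - (\<integral>x. (sqrt \<eta> * arctan (Y x / sqrt \<eta>)) * T x \<partial>PiM I P)"
      using B1(1) by (simp add: mult.commute)
    then show ?thesis using bT[of "\<lambda>x. sqrt \<eta> * arctan (Y x / sqrt \<eta>)" "2 * sqrt \<eta>", OF A1] by linarith
  qed
  let ?w = "\<lambda>y. y / (y\<^sup>2 + \<eta>)"
  let ?w' = "\<lambda>y. (\<eta> - y\<^sup>2) / (y\<^sup>2 + \<eta>)\<^sup>2"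
  have d2: "(?w has_real_derivative ?w' y) (at y)" for y
    using den[of y] by (auto intro!: derivative_eq_intros simp: divide_simps power2_eq_square algebra_simps)
  have A2: "\<bar>?w y\<bar> \<le> 1 / sqrt \<eta>" for y
  proof -
    have "\<bar>y\<bar> * sqrt \<eta> \<le> y\<^sup>2 + \<eta>"
    proof -
      have "0 \<le> (\<bar>y\<bar> - sqrt \<eta>)\<^sup>2" by simp
      then have "2 * (\<bar>y\<bar> * sqrt \<eta>) \<le> y\<^sup>2 + \<eta>" using sq\<eta> \<eta> by (simp add: power2_diff)
      moreover have "0 \<le> \<bar>y\<bar> * sqrt \<eta>" using sq\<eta> by simp
      ultimately show ?thesis by linarith
    qed
    then have "\<bar>y\<bar> \<le> (y\<^sup>2 + \<eta>) / sqrt \<eta>" by (simp only: pos_le_divide_eq[OF sq\<eta>(1)])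
    then have "\<bar>y\<bar> \<le> 1 / sqrt \<eta> * (y\<^sup>2 + \<eta>)" by simp
    then have "\<bar>y\<bar> / (y\<^sup>2 + \<eta>) \<le> 1 / sqrt \<eta>" by (simp only: pos_divide_le_eq[OF den(1)])
    then show ?thesis using den(1)[of y] by (simp only: abs_divide abs_of_pos)
  qed
  \<comment> \<open>This finer bound links the two integrations by parts: the term with the
    derivative of the weight becomes \<open>a / \<eta>\<close> times the quantity already estimated
    in \<open>Ce\<close>.\<close>
  have A3': "\<bar>?w' y\<bar> \<le> ?e y / \<eta>" for y
  proof -
    have "\<bar>?w' y\<bar> = \<bar>\<eta> - y\<^sup>2\<bar> / (y\<^sup>2 + \<eta>)\<^sup>2" by simp
    also have "\<dots> \<le> (y\<^sup>2 + \<eta>) / (y\<^sup>2 + \<eta>)\<^sup>2" using \<eta> by (intro divide_right_mono) (auto simp: abs_le_iff)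
    also have "\<dots> = ?e y / \<eta>" using \<eta> den[of y] by (simp add: power2_eq_square)
    finally show ?thesis .
  qed
  have A3: "\<bar>?w' y\<bar> \<le> 1 / \<eta>" for y
    using A3'[of y] e01[of y] \<eta> by (meson divide_right_mono less_imp_le order_trans)
  have con_w: "continuous_on UNIV ?w'" using den by (intro continuous_intros) auto
  note B2 = integration_by_parts_quadratic_form[where P=P and l=l and q=q and \<phi>=\<phi> and \<phi>'=g and \<psi>="?w"
      and \<psi>'="?w'" and ka=a and kb=b and kc="1 / sqrt \<eta>" and kd="1 / \<eta>" and s=s,
      OF P I q(1,2) d d2 c con_w b A2 A3, folded U_def Y_def C_def T_def]
  have i1: "integrable (PiM I P) (\<lambda>x. g (U x) * ?w (Y x) * Y x)" by (rule B2(2))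
  have i2: "integrable (PiM I P) (\<lambda>x. \<phi> (U x) * ?w' (Y x) * C x)" by (rule B2(3))
  \<comment> \<open>Of the factor 3, one unit comes from the score and two from the derivative of
    the weight.\<close>
  have main1: "\<bar>\<integral>x. g (U x) * ?w (Y x) * Y x \<partial>PiM I P\<bar> \<le> 3 * a * ?t / sqrt \<eta>"
  proof -
    have "(\<integral>x. g (U x) * ?w (Y x) * Y x \<partial>PiM I P) + (\<integral>x. \<phi> (U x) * ?w' (Y x) * C x \<partial>PiM I P)
       = - (\<integral>x. (\<phi> (U x) * ?w (Y x)) * T x \<partial>PiM I P)"
      using B2(1) by (subst Bochner_Integration.integral_add[symmetric, OF i1 i2]) simp
    moreover have "\<bar>\<integral>x. (\<phi> (U x) * ?w (Y x)) * T x \<partial>PiM I P\<bar> \<le> (a * (1 / sqrt \<eta>)) * ?t"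
    proof (rule bT)
      show "\<bar>\<phi> (U x) * ?w (Y x)\<bar> \<le> a * (1 / sqrt \<eta>)" for x
        unfolding abs_mult by (intro mult_mono b A2 a0) auto
    qed
    moreover have "\<bar>\<integral>x. \<phi> (U x) * ?w' (Y x) * C x \<partial>PiM I P\<bar> \<le> a / \<eta> * (2 * sqrt \<eta> * ?t)"
    proof -
      have "\<bar>\<integral>x. \<phi> (U x) * ?w' (Y x) * C x \<partial>PiM I P\<bar> \<le> (\<integral>x. \<bar>\<phi> (U x) * ?w' (Y x) * C x\<bar> \<partial>PiM I P)"
        by (rule integral_abs_bound)
      also have "\<dots> \<le> (\<integral>x. a / \<eta> * (C x * ?e (Y x)) \<partial>PiM I P)"
      proof (intro integral_mono)
        fix x
        have "\<bar>\<phi> (U x) * ?w' (Y x) * C x\<bar> = \<bar>\<phi> (U x)\<bar> * \<bar>?w' (Y x)\<bar> * C x"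
          using C0[of x] by (simp add: abs_mult)
        also have "\<dots> \<le> a * (?e (Y x) / \<eta>) * C x"
          by (intro mult_right_mono mult_mono b A3' a0 C0) auto
        also have "a * (e / \<eta>) * k = a / \<eta> * (k * e)" for e k by simp
        finally show "\<bar>\<phi> (U x) * ?w' (Y x) * C x\<bar> \<le> a / \<eta> * (C x * ?e (Y x))" .
      next
        show "integrable (PiM I P) (\<lambda>x. \<bar>\<phi> (U x) * ?w' (Y x) * C x\<bar>)" by (rule integrable_abs[OF i2])
        show "integrable (PiM I P) (\<lambda>x. a / \<eta> * (C x * ?e (Y x)))" by (rule integrable_mult_right[OF iCe])
      qed
      also have "\<dots> = a / \<eta> * (\<integral>x. C x * ?e (Y x) \<partial>PiM I P)" by (rule integral_mult_right_zero)
      also have "\<dots> \<le> a / \<eta> * (2 * sqrt \<eta> * ?t)" using Ce a0 \<eta> by (intro mult_left_mono) auto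
      finally show ?thesis .
    qed
    moreover have "a / \<eta> * (2 * sqrt \<eta> * ?t) = 2 * (a * ?t / sqrt \<eta>)"
    proof -
      have "sqrt \<eta> / \<eta> = 1 / sqrt \<eta>" using sq\<eta> \<eta> by (simp add: divide_eq_eq real_div_sqrt)
      moreover have "a / \<eta> * (2 * sqrt \<eta> * t) = 2 * (a * t) * (sqrt \<eta> / \<eta>)" for t by simp
      ultimately show ?thesis by (simp only:) simp
    qed
    moreover have "(a * (1 / sqrt \<eta>)) * ?t = a * ?t / sqrt \<eta>" "3 * a * ?t / sqrt \<eta> = 3 * (a * ?t / sqrt \<eta>)"
      by simp_all
    ultimately show ?thesis by linarith
  qed
  have EN: "integrable (PiM I P) (\<lambda>x. (N x - m * n)\<^sup>2)" "(\<integral>x. (N x - m * n)\<^sup>2 \<partial>PiM I P) \<le> n"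
  proof -
    have f: "N x - m * n = (\<Sum>i\<in>I. of_bool (snd (x i)) - m)" for x
      unfolding N_def n(1)[symmetric] by (simp add: sum_subtractf)
    have le1: "(of_bool t - m)\<^sup>2 \<le> 1" for t
      using SB(2,3) by (cases t) (auto simp: abs_square_le_1)
    have int2: "integrable (P i) (\<lambda>y. (of_bool (snd y) - m)\<^sup>2)" for i
    proof -
      interpret prob_space "P i" by (rule pp)
      have [measurable]: "(\<lambda>y. of_bool (snd y) :: real) \<in> borel_measurable (P i)" using SB(9) by auto
      show ?thesis by (rule integrable_const_bound[of _ 1]) (use le1 in auto)
    qed
    have me: "(\<integral>y. of_bool (snd y) - m \<partial>P i) = 0" for i
    proof -
      interpret prob_space "P i" by (rule pp)
      show ?thesis using SB(9)[of i] P[of i] by (simp add: scored_law_def prob_space)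
    qed
    have int1: "integrable (P i) (\<lambda>y. of_bool (snd y) - m)" for i
    proof -
      interpret prob_space "P i" by (rule pp)
      show ?thesis using SB(9)[of i] by simp
    qed
    have R: "integrable (PiM I P) (\<lambda>x. (N x - m * n)\<^sup>2)
      \<and> (\<integral>x. (N x - m * n)\<^sup>2 \<partial>PiM I P) = (\<Sum>i\<in>I. (\<integral>y. (of_bool (snd y) - m)\<^sup>2 \<partial>P i))"
      unfolding f using PiM_sum_square[where f="\<lambda>i y. of_bool (snd y) - m" and J=I and M=P, OF pp I int1 me int2] by auto
    then show "integrable (PiM I P) (\<lambda>x. (N x - m * n)\<^sup>2)" by auto
    have "(\<integral>y. (of_bool (snd y) - m)\<^sup>2 \<partial>P i) \<le> 1" for i
    proof -
      interpret prob_space "P i" by (rule pp)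
      have "(\<integral>y. (of_bool (snd y) - m)\<^sup>2 \<partial>P i) \<le> (\<integral>y. 1 \<partial>P i)"
        using int2[of i] le1 by (intro integral_mono) auto
      then show ?thesis by (simp add: prob_space)
    qed
    then have "(\<Sum>i\<in>I. (\<integral>y. (of_bool (snd y) - m)\<^sup>2 \<partial>P i)) \<le> (\<Sum>i\<in>I. 1)" by (intro sum_mono)
    then show "(\<integral>x. (N x - m * n)\<^sup>2 \<partial>PiM I P) \<le> n" using R n by simp
  qed
  \<comment> \<open>Either at least half the expected number of labels is \<open>True\<close>, and
    \<open>C x\<close> is at least \<open>m\<^sup>2 / 4\<close>; or the count is off by
    \<open>m * n / 2\<close>, and the last term is at least 1.\<close>
  have pw: "?e (Y x) \<le> 4 / m\<^sup>2 * (C x * ?e (Y x)) + 4 / (m\<^sup>2 * n\<^sup>2) * (N x - m * n)\<^sup>2" for x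
  proof (cases "m * n / 2 \<le> N x")
    case True
    \<comment> \<open>The condition \<open>4 \<le> m * n\<close> enters here: from 2 on, removing
      the diagonal pairs leaves at least half of the square.\<close>
    have "2 \<le> N x" using True n by linarith
    have "N x * 2 \<le> N x * N x" using \<open>2 \<le> N x\<close> by (intro mult_left_mono) auto
    then have "(N x)\<^sup>2 / 2 \<le> (N x)\<^sup>2 - N x" by (simp add: power2_eq_square)
    moreover have "(m * n / 2)\<^sup>2 \<le> (N x)\<^sup>2" using True n by (intro power_mono) auto
    ultimately have "(m * n / 2)\<^sup>2 / 2 \<le> (N x)\<^sup>2 - N x" by linarith
    then have "2 / n\<^sup>2 * ((m * n / 2)\<^sup>2 / 2) \<le> 2 / n\<^sup>2 * ((N x)\<^sup>2 - N x)" by (intro mult_left_mono) auto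
    also have "\<dots> \<le> C x"
      unfolding C_def N_def by (rule ddform_ge[OF I n(1,2) s2 q(1,3)])
    finally have "m\<^sup>2 / 4 \<le> C x" using n by (simp add: power_mult_distrib power_divide)
    then have "1 \<le> 4 / m\<^sup>2 * C x" using n by (simp add: field_simps)
    then have "1 * ?e (Y x) \<le> 4 / m\<^sup>2 * C x * ?e (Y x)" using e01 by (intro mult_right_mono) auto
    moreover have "0 \<le> 4 / (m\<^sup>2 * n\<^sup>2) * (N x - m * n)\<^sup>2" by simp
    ultimately show ?thesis by (simp only: mult.assoc mult_1)
  next
    case False
    then have "m * n / 2 \<le> \<bar>N x - m * n\<bar>" by linarith
    then have "(m * n / 2)\<^sup>2 \<le> \<bar>N x - m * n\<bar>\<^sup>2" using n by (intro power_mono) auto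
    then have "1 \<le> 4 / (m\<^sup>2 * n\<^sup>2) * (N x - m * n)\<^sup>2" using n by (simp add: field_simps power_mult_distrib)
    moreover have "0 \<le> 4 / m\<^sup>2 * (C x * ?e (Y x))" by (intro mult_nonneg_nonneg C0 e01) auto
    ultimately show ?thesis using e01(2)[of "Y x"] by linarith
  qed
  have ie: "integrable (PiM I P) (\<lambda>x. ?e (Y x))"
  proof (rule PJ.integrable_const_bound[of _ 1])
    show "AE x in PiM I P. norm (?e (Y x)) \<le> 1" by (rule AE_I2) (simp only: real_norm_def triv)
  qed measurable
  have Ee: "(\<integral>x. ?e (Y x) \<partial>PiM I P) \<le> 8 * sqrt \<eta> * ?t / m\<^sup>2 + 4 / (m\<^sup>2 * n)"
  proof -
    have "(\<integral>x. ?e (Y x) \<partial>PiM I P) \<le> (\<integral>x. 4 / m\<^sup>2 * (C x * ?e (Y x)) + 4 / (m\<^sup>2 * n\<^sup>2) * (N x - m * n)\<^sup>2 \<partial>PiM I P)"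
      by (rule integral_mono[OF ie _ pw])
        (intro Bochner_Integration.integrable_add integrable_mult_right iCe EN(1))
    also have "\<dots> = 4 / m\<^sup>2 * (\<integral>x. C x * ?e (Y x) \<partial>PiM I P) + 4 / (m\<^sup>2 * n\<^sup>2) * (\<integral>x. (N x - m * n)\<^sup>2 \<partial>PiM I P)"
      by (subst Bochner_Integration.integral_add[OF integrable_mult_right[OF iCe] integrable_mult_right[OF EN(1)]])
        (simp only: integral_mult_right_zero)
    also have "\<dots> \<le> 4 / m\<^sup>2 * (2 * sqrt \<eta> * ?t) + 4 / (m\<^sup>2 * n\<^sup>2) * n"
      using Ce EN by (intro add_mono mult_left_mono) auto
    also have "\<dots> = 8 * sqrt \<eta> * ?t / m\<^sup>2 + 4 / (m\<^sup>2 * n)" using n by (simp add: power2_eq_square)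
    finally show ?thesis .
  qed
  have ig: "integrable (PiM I P) (\<lambda>x. g (U x) * ?e (Y x))"
    using integrable_bounded_mult[OF ie, of "\<lambda>x. g (U x)" b] b by simp
  have "g (U x) = g (U x) * ?w (Y x) * Y x + g (U x) * ?e (Y x)" for x
  proof -
    have "g (U x) * ?w (Y x) * Y x + g (U x) * ?e (Y x) = g (U x) * ((Y x)\<^sup>2 + \<eta>) / ((Y x)\<^sup>2 + \<eta>)"
      by (simp add: power2_eq_square add_divide_distrib[symmetric] distrib_left)
    then show ?thesis using den(2)[of "Y x"] by simp
  qed
  then have "(\<integral>x. g (U x) \<partial>PiM I P) = (\<integral>x. g (U x) * ?w (Y x) * Y x + g (U x) * ?e (Y x) \<partial>PiM I P)"
    by (intro Bochner_Integration.integral_cong) auto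
  also have "\<dots> = (\<integral>x. g (U x) * ?w (Y x) * Y x \<partial>PiM I P) + (\<integral>x. g (U x) * ?e (Y x) \<partial>PiM I P)"
    by (rule Bochner_Integration.integral_add[OF i1 ig])
  finally have eq: "(\<integral>x. g (U x) \<partial>PiM I P) = (\<integral>x. g (U x) * ?w (Y x) * Y x \<partial>PiM I P) + (\<integral>x. g (U x) * ?e (Y x) \<partial>PiM I P)" .
  have "\<bar>\<integral>x. g (U x) * ?e (Y x) \<partial>PiM I P\<bar> \<le> (\<integral>x. \<bar>g (U x) * ?e (Y x)\<bar> \<partial>PiM I P)" by (rule integral_abs_bound)
  also have "\<dots> \<le> (\<integral>x. b * ?e (Y x) \<partial>PiM I P)"
  proof (intro integral_mono)
    show "\<bar>g (U x) * ?e (Y x)\<bar> \<le> b * ?e (Y x)" for x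
      unfolding abs_mult abs_of_nonneg[OF e01(1)] by (intro mult_right_mono b e01)
  next
    show "integrable (PiM I P) (\<lambda>x. \<bar>g (U x) * ?e (Y x)\<bar>)" by (rule integrable_abs[OF ig])
    show "integrable (PiM I P) (\<lambda>x. b * ?e (Y x))" by (rule integrable_mult_right[OF ie])
  qed
  also have "\<dots> = b * (\<integral>x. ?e (Y x) \<partial>PiM I P)" by (rule integral_mult_right_zero)
  also have "\<dots> \<le> b * (8 * sqrt \<eta> * ?t / m\<^sup>2 + 4 / (m\<^sup>2 * n))" by (intro mult_left_mono Ee b0)
  finally have "\<bar>\<integral>x. g (U x) * ?e (Y x) \<partial>PiM I P\<bar> \<le> b * (8 * sqrt \<eta> * ?t / m\<^sup>2 + 4 / (m\<^sup>2 * n))" .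
  then show ?thesis using main1 eq unfolding U_def[symmetric] by linarith
qed

section \<open>Smooth components of laws that dominate a multiple of Lebesgue measure\<close>

lemma lborel_minorant_density:
  fixes \<mu> :: "real measure"
  assumes "prob_space \<mu>" and sb: "sets \<mu> = sets borel" and e: "0 < e" and S: "S \<in> sets borel" "emeasure lborel S < \<infinity>"
    and minor: "\<And>A. A \<in> sets borel \<Longrightarrow> A \<subseteq> S \<Longrightarrow> e * measure lborel A \<le> measure \<mu> A"
  obtains w :: "real \<Rightarrow> real" where "w \<in> borel_measurable borel" "\<And>u. 0 \<le> w u" "\<And>u. w u \<le> 1"
    "\<And>f. f \<in> borel_measurable borel \<Longrightarrow>
       (\<integral>\<^sup>+ u. ennreal (w u) * f u \<partial>\<mu>) = (\<integral>\<^sup>+ u. ennreal (e * indicator S u) * f u \<partial>lborel)"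
proof -
  interpret prob_space \<mu> by fact
  have [measurable_cong]: "sets \<mu> = sets borel" by fact
  have [measurable]: "S \<in> sets borel" by fact
  define \<nu> where "\<nu> = density lborel (\<lambda>u. ennreal (e * indicator S u))"
  have s\<nu>: "sets \<nu> = sets \<mu>" by (simp add: \<nu>_def sb)
  have le: "emeasure \<nu> A \<le> emeasure \<mu> A" if "A \<in> sets borel" for A
  proof -
    have [measurable]: "A \<in> sets borel" by fact
    have fin: "emeasure lborel (A \<inter> S) < \<infinity>"
      using S(2) emeasure_mono[of "A \<inter> S" S lborel] by (auto intro: le_less_trans)
    have "emeasure \<nu> A = (\<integral>\<^sup>+ u. ennreal e * indicator (A \<inter> S) u \<partial>lborel)"
      unfolding \<nu>_def by (subst emeasure_density) (auto intro!: nn_integral_cong split: split_indicator)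
    also have "\<dots> = ennreal e * emeasure lborel (A \<inter> S)"
      by (subst nn_integral_cmult_indicator) auto
    also have "\<dots> = ennreal (e * measure lborel (A \<inter> S))"
      using fin e by (simp add: emeasure_eq_ennreal_measure ennreal_mult)
    also have "\<dots> \<le> ennreal (measure \<mu> (A \<inter> S))"
      using minor[of "A \<inter> S"] by (intro ennreal_leI) auto
    also have "\<dots> = emeasure \<mu> (A \<inter> S)" by (simp add: emeasure_eq_measure)
    also have "\<dots> \<le> emeasure \<mu> A" by (rule emeasure_mono) auto
    finally show ?thesis .
  qed
  \<comment> \<open>Since \<open>\<nu>\<close> is below \<open>\<mu>\<close> on all Borel sets, its
    Radon-Nikodym derivative is at most 1 almost everywhere. Capped at 1 everywhere, it is
    \<open>w\<close>: the share of the mass at a point that belongs to the Lebesgue part.\<close>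
  have ac: "absolutely_continuous \<mu> \<nu>"
    unfolding absolutely_continuous_def
  proof
    fix A assume "A \<in> null_sets \<mu>"
    then show "A \<in> null_sets \<nu>" using le[of A] s\<nu> sb by (auto simp: null_sets_def)
  qed
  define \<rho> where "\<rho> = RN_deriv \<mu> \<nu>"
  have [measurable]: "\<rho> \<in> borel_measurable borel"
    using borel_measurable_RN_deriv[of \<mu> \<nu>] unfolding \<rho>_def by (simp cong: measurable_cong_sets)
  have d: "density \<mu> \<rho> = \<nu>" unfolding \<rho>_def by (rule density_RN_deriv[OF ac s\<nu>])
  have \<rho>1: "AE u in \<mu>. \<rho> u \<le> 1"
  proof -
    let ?A = "{u. 1 < \<rho> u}"
    have A[measurable]: "?A \<in> sets borel" by measurable
    have e1: "(\<integral>\<^sup>+ u. \<rho> u * indicator ?A u \<partial>\<mu>) = emeasure \<nu> ?A"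
      unfolding d[symmetric] by (subst emeasure_density) auto
    have "(\<integral>\<^sup>+ u. \<rho> u * indicator ?A u - indicator ?A u \<partial>\<mu>)
      = (\<integral>\<^sup>+ u. \<rho> u * indicator ?A u \<partial>\<mu>) - (\<integral>\<^sup>+ u. indicator ?A u \<partial>\<mu>)"
      by (rule nn_integral_diff) (auto simp: emeasure_eq_measure split: split_indicator)
    also have "\<dots> = 0" using le[OF A] le_less_trans[OF le[OF A], of top] unfolding e1
      by (simp add: sb diff_eq_0_iff_ennreal emeasure_eq_measure)
    finally have "AE u in \<mu>. \<rho> u * indicator ?A u - indicator ?A u = 0"
      by (subst (asm) nn_integral_0_iff_AE) auto
    then show ?thesis
    proof eventually_elim
      case (elim u)
      show ?case
      proof (rule ccontr)
        assume "\<not> \<rho> u \<le> 1"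
        then have "1 < \<rho> u" by simp
        then have "\<rho> u - 1 = 0" using elim by simp
        then show False using \<open>1 < \<rho> u\<close> ennreal_minus_eq_0[of "\<rho> u" 1] by (simp add: not_le[symmetric])
      qed
    qed
  qed
  define w where "w u = enn2real (min 1 (\<rho> u))" for u
  have wm[measurable]: "w \<in> borel_measurable borel" unfolding w_def by measurable
  have fin: "min 1 (\<rho> u) < top" for u by (simp add: min_less_iff_disj)
  have wr: "ennreal (w u) = min 1 (\<rho> u)" for u using fin[of u] by (simp add: w_def)
  show ?thesis
  proof (rule that[OF wm])
    show "0 \<le> w u" for u by (simp add: w_def)
    show "w u \<le> 1" for u
    proof -
      have "ennreal (w u) \<le> 1" unfolding wr by simp
      then show ?thesis by simp
    qed
    fix f :: "real \<Rightarrow> ennreal" assume [measurable]: "f \<in> borel_measurable borel"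
    have "(\<integral>\<^sup>+ u. ennreal (w u) * f u \<partial>\<mu>) = (\<integral>\<^sup>+ u. \<rho> u * f u \<partial>\<mu>)"
      using \<rho>1 by (intro nn_integral_cong_AE) (auto simp: wr min_absorb2)
    also have "\<dots> = (\<integral>\<^sup>+ u. f u \<partial>\<nu>)"
      unfolding d[symmetric] by (subst nn_integral_density) auto
    also have "\<dots> = (\<integral>\<^sup>+ u. ennreal (e * indicator S u) * f u \<partial>lborel)"
      unfolding \<nu>_def by (subst nn_integral_density) auto
    finally show "(\<integral>\<^sup>+ u. ennreal (w u) * f u \<partial>\<mu>) = (\<integral>\<^sup>+ u. ennreal (e * indicator S u) * f u \<partial>lborel)" .
  qed
qed

text \<open>A point u drawn from \<mu> is labelled \<open>True\<close> with probability
  \<open>w u * k u\<close>. The part labelled \<open>True\<close> then has density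
  \<open>e * k\<close>, and forgetting the label returns \<mu>. With v = (u-c)/r the bump k is
  (1-v^2)^2: it vanishes at the ends, so there are no boundary terms, and with its logarithmic
  derivative l the product k l^2 = 16 v^2/r^2 stays bounded. Its integral over [-1,1] is 16/15,
  which gives the mass; 16 e/r^2 times the length 2r gives 32 e/r.\<close>

lemma scored_law_exists:
  fixes \<mu> :: "real measure"
  assumes "prob_space \<mu>" and sb: "sets \<mu> = sets borel" and int: "integrable \<mu> (\<lambda>u. u)"
    and e: "0 < e" and r: "0 < r"
    and minor: "\<And>A. A \<in> sets borel \<Longrightarrow> A \<subseteq> {c - r<..<c + r} \<Longrightarrow> e * measure lborel A \<le> measure \<mu> A"
  shows "\<exists>P l. scored_law (16 / 15 * e * r) (32 * e / r) P l \<and> distr P borel fst = \<mu>"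
proof -
  interpret prob_space \<mu> by fact
  have [measurable_cong]: "sets \<mu> = sets borel" by fact
  obtain w where [measurable]: "w \<in> borel_measurable borel" and w01: "\<And>u. 0 \<le> w u" "\<And>u. w u \<le> 1"
    and w: "\<And>f. f \<in> borel_measurable borel \<Longrightarrow>
       (\<integral>\<^sup>+ u. ennreal (w u) * f u \<partial>\<mu>) = (\<integral>\<^sup>+ u. ennreal (e * indicator {c - r<..<c + r} u) * f u \<partial>lborel)"
    using lborel_minorant_density[OF \<open>prob_space \<mu>\<close> sb e, of "{c - r<..<c + r}"] minor r by (auto simp: ennreal_less_top)
  define V where "V u = (u - c) / r" for u
  have [measurable]: "V \<in> borel_measurable borel" unfolding V_def by measurable
  have Vi: "\<bar>V u\<bar> \<le> 1 \<longleftrightarrow> u \<in> {c - r..c + r}" for u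
    using r by (auto simp: V_def abs_le_iff field_simps)
  have Vi': "\<bar>V u\<bar> < 1 \<longleftrightarrow> u \<in> {c - r<..<c + r}" for u
    using r by (auto simp: V_def abs_less_iff field_simps)
  define k where "k u = (1 - (V u)\<^sup>2)\<^sup>2 * indicator {c - r..c + r} u" for u
  have [measurable]: "k \<in> borel_measurable borel" unfolding k_def by measurable
  have k01: "0 \<le> k u" "k u \<le> 1" for u
  proof -
    show "0 \<le> k u" by (simp add: k_def)
    show "k u \<le> 1"
    proof (cases "u \<in> {c - r..c + r}")
      case True
      then have "\<bar>V u\<bar> \<le> 1" using Vi by blast
      then have "(V u)\<^sup>2 \<le> 1" "0 \<le> (V u)\<^sup>2" by (auto simp: abs_square_le_1)
      then have "\<bar>1 - (V u)\<^sup>2\<bar> \<le> 1" by linarith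
      then have "(1 - (V u)\<^sup>2)\<^sup>2 \<le> 1" by (simp only: abs_square_le_1)
      then show ?thesis using True by (simp add: k_def)
    qed (simp add: k_def)
  qed
  \<comment> \<open>As the bump is zero at the endpoints, the open interval of the minorant and the
    closed one of the integration formulas are interchangeable.\<close>
  have kS: "indicator {c - r<..<c + r} u * k u = k u" for u
  proof (cases "\<bar>V u\<bar> = 1")
    case True
    then have "(V u)\<^sup>2 = 1" by (simp add: abs_square_eq_1)
    then show ?thesis by (simp add: k_def)
  next
    case False
    then show ?thesis using Vi[of u] Vi'[of u] by (auto simp: k_def split: split_indicator)
  qed
  \<comment> \<open>The logarithmic derivative of the bump. At the endpoints division by zero yields
    0, which is harmless because \<open>k\<close> vanishes there.\<close>
  define l where "l u = - 4 * V u / (r * (1 - (V u)\<^sup>2))" for u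
  have lm[measurable]: "l \<in> borel_measurable borel" unfolding l_def by measurable
  define W where "W u = w u * k u" for u
  have [measurable]: "W \<in> borel_measurable borel" unfolding W_def by measurable
  have W01: "0 \<le> W u" "W u \<le> 1" for u
    unfolding W_def using w01[of u] k01[of u] by (auto simp: mult_le_one)
  define P where "P = density (\<mu> \<Otimes>\<^sub>M count_space (UNIV :: bool set)) (\<lambda>y. ennreal (if snd y then W (fst y) else 1 - W (fst y)))"
  have sP: "sets P = sets (borel \<Otimes>\<^sub>M count_space UNIV)"
    unfolding P_def sets_density by (intro sets_pair_measure_cong sb refl)
  note [measurable_cong] = sP
  interpret cs: sigma_finite_measure "count_space (UNIV :: bool set)"
    by (rule sigma_finite_measure_count_space_finite) simp
  have nnP: "(\<integral>\<^sup>+ y. f y \<partial>P) = (\<integral>\<^sup>+ u. ennreal (W u) * f (u, True) + ennreal (1 - W u) * f (u, False) \<partial>\<mu>)"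
    if f[measurable]: "f \<in> borel_measurable (borel \<Otimes>\<^sub>M count_space UNIV)" for f :: "real \<times> bool \<Rightarrow> ennreal"
  proof -
    have "(\<integral>\<^sup>+ y. f y \<partial>P) = (\<integral>\<^sup>+ y. ennreal (if snd y then W (fst y) else 1 - W (fst y)) * f y \<partial>(\<mu> \<Otimes>\<^sub>M count_space UNIV))"
      unfolding P_def by (subst nn_integral_density) auto
    also have "\<dots> = (\<integral>\<^sup>+ u. (\<integral>\<^sup>+ t. ennreal (if t then W u else 1 - W u) * f (u, t) \<partial>count_space UNIV) \<partial>\<mu>)"
    proof -
      have "(\<lambda>y. ennreal (if snd y then W (fst y) else 1 - W (fst y)) * f y) \<in> borel_measurable (\<mu> \<Otimes>\<^sub>M count_space UNIV)"
        by measurable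
      from cs.nn_integral_fst[OF this] show ?thesis by (simp only: fst_conv snd_conv)
    qed
    also have "\<dots> = (\<integral>\<^sup>+ u. ennreal (W u) * f (u, True) + ennreal (1 - W u) * f (u, False) \<partial>\<mu>)"
      by (intro nn_integral_cong) (simp add: nn_integral_count_space_finite UNIV_bool add.commute)
    finally show ?thesis .
  qed
  have dist: "distr P borel fst = \<mu>"
  proof (rule measure_eqI)
    fix A assume "A \<in> sets (distr P borel fst)"
    then have A[measurable]: "A \<in> sets borel" by simp
    have "emeasure (distr P borel fst) A = (\<integral>\<^sup>+ y. indicator A (fst y) \<partial>P)"
    proof -
      have "(\<integral>\<^sup>+ y. indicator A (fst y) \<partial>P) = (\<integral>\<^sup>+ u. indicator A u \<partial>distr P borel fst)"
        by (subst nn_integral_distr) auto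
      then show ?thesis by simp
    qed
    also have "\<dots> = (\<integral>\<^sup>+ u. ennreal (W u) * indicator A u + ennreal (1 - W u) * indicator A u \<partial>\<mu>)"
      by (subst nnP) auto
    also have "\<dots> = (\<integral>\<^sup>+ u. indicator A u \<partial>\<mu>)"
    proof (intro nn_integral_cong)
      fix u
      have "ennreal (W u) + ennreal (1 - W u) = 1"
        using W01[of u] by (subst ennreal_plus[symmetric]) auto
      then show "ennreal (W u) * indicator A u + ennreal (1 - W u) * indicator A u = indicator A u"
        by (simp add: distrib_right[symmetric])
    qed
    finally show "emeasure (distr P borel fst) A = emeasure \<mu> A" by simp
  qed (simp add: sb)
  have pP: "prob_space P"
  proof (rule prob_spaceI)
    have "emeasure P (space P) = emeasure (distr P borel fst) UNIV"
      by (subst emeasure_distr) (auto intro!: arg_cong2[where f=emeasure])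
    also have "\<dots> = emeasure \<mu> (space \<mu>)" unfolding dist using sb by (metis sets_eq_imp_space_eq space_borel)
    finally show "emeasure P (space P) = 1" by (simp add: emeasure_space_1)
  qed
  interpret P: prob_space P by (rule pP)
  have [measurable]: "(\<lambda>y. of_bool (snd y) :: real) \<in> borel_measurable P"
    unfolding of_bool_def by measurable
  let ?b = "\<lambda>u. e * k u"
  have D: "distr (density P (\<lambda>y. ennreal (of_bool (snd y)))) borel fst = density lborel (\<lambda>u. ennreal (?b u))"
  proof (rule measure_eqI)
    fix A assume "A \<in> sets (distr (density P (\<lambda>y. ennreal (of_bool (snd y)))) borel fst)"
    then have A[measurable]: "A \<in> sets borel" by simp
    have [measurable]: "(\<lambda>y. ennreal (of_bool (snd y))) \<in> borel_measurable (borel \<Otimes>\<^sub>M count_space UNIV :: (real \<times> bool) measure)"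
      unfolding of_bool_def by measurable
    have "emeasure (distr (density P (\<lambda>y. ennreal (of_bool (snd y)))) borel fst) A
       = (\<integral>\<^sup>+ u. indicator A u \<partial>distr (density P (\<lambda>y. ennreal (of_bool (snd y)))) borel fst)"
      by (subst nn_integral_indicator) auto
    also have "\<dots> = (\<integral>\<^sup>+ y. indicator A (fst y) \<partial>density P (\<lambda>y. ennreal (of_bool (snd y))))"
      by (subst nn_integral_distr) auto
    also have "\<dots> = (\<integral>\<^sup>+ y. ennreal (of_bool (snd y)) * indicator A (fst y) \<partial>P)"
      by (subst nn_integral_density) auto
    also have "\<dots> = (\<integral>\<^sup>+ u. ennreal (W u) * indicator A u \<partial>\<mu>)"
      by (subst nnP) auto
    also have "\<dots> = (\<integral>\<^sup>+ u. ennreal (w u) * (ennreal (k u) * indicator A u) \<partial>\<mu>)"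
      using w01 k01 by (simp add: W_def ennreal_mult mult.assoc)
    also have "\<dots> = (\<integral>\<^sup>+ u. ennreal (e * indicator {c - r<..<c + r} u) * (ennreal (k u) * indicator A u) \<partial>lborel)"
      by (rule w) measurable
    also have "\<dots> = (\<integral>\<^sup>+ u. ennreal (?b u) * indicator A u \<partial>lborel)"
    proof (intro nn_integral_cong)
      fix u
      have "ennreal (e * indicator {c - r<..<c + r} u) * ennreal (k u) = ennreal (e * (indicator {c - r<..<c + r} u * k u))"
        using e k01 by (subst ennreal_mult[symmetric]) (auto simp: mult.assoc)
      then show "ennreal (e * indicator {c - r<..<c + r} u) * (ennreal (k u) * indicator A u) = ennreal (?b u) * indicator A u"
        unfolding kS by (simp add: mult.assoc[symmetric])
    qed
    also have "\<dots> = emeasure (density lborel (\<lambda>u. ennreal (?b u))) A"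
      by (subst emeasure_density) auto
    finally show "emeasure (distr (density P (\<lambda>y. ennreal (of_bool (snd y)))) borel fst) A
      = emeasure (density lborel (\<lambda>u. ennreal (?b u))) A" .
  qed simp
  have intD: "(\<integral>y. of_bool (snd y) * G (fst y) \<partial>P) = (\<integral>u. ?b u * G u \<partial>lborel)"
    if [measurable]: "G \<in> borel_measurable borel" for G :: "real \<Rightarrow> real"
  proof -
    have "(\<integral>y. of_bool (snd y) * G (fst y) \<partial>P) = (\<integral>y. G (fst y) \<partial>density P (\<lambda>y. ennreal (of_bool (snd y))))"
      by (subst integral_density) auto
    also have "\<dots> = (\<integral>u. G u \<partial>distr (density P (\<lambda>y. ennreal (of_bool (snd y)))) borel fst)"
      by (subst integral_distr) auto
    also have "\<dots> = (\<integral>u. ?b u * G u \<partial>lborel)"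
      unfolding D using e k01 by (subst integral_density) auto
    finally show ?thesis .
  qed
  have intbD: "integrable P (\<lambda>y. of_bool (snd y) * G (fst y)) \<longleftrightarrow> integrable lborel (\<lambda>u. ?b u * G u)"
    if [measurable]: "G \<in> borel_measurable borel" for G :: "real \<Rightarrow> real"
  proof -
    have "integrable P (\<lambda>y. of_bool (snd y) * G (fst y)) \<longleftrightarrow> integrable (density P (\<lambda>y. ennreal (of_bool (snd y)))) (\<lambda>y. G (fst y))"
      by (subst integrable_density) auto
    also have "\<dots> \<longleftrightarrow> integrable (distr (density P (\<lambda>y. ennreal (of_bool (snd y)))) borel fst) G"
      by (subst integrable_distr_eq) auto
    also have "\<dots> \<longleftrightarrow> integrable lborel (\<lambda>u. ?b u * G u)"
      unfolding D using e k01 by (subst integrable_density) auto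
    finally show ?thesis .
  qed
  have cr: "c - r \<le> c + r" using r by simp
  have Vd: "(V has_real_derivative 1 / r) (at u)" for u
    unfolding V_def using r by (auto intro!: derivative_eq_intros)
  have Vc: "isCont V u" for u using Vd by (rule DERIV_isCont)
  have Ve: "V (c + r) = 1" "V (c - r) = -1" using r by (simp_all add: V_def)
  have mass: "(\<integral>u. ?b u * 1 \<partial>lborel) = 16 / 15 * e * r"
  proof -
    let ?F = "\<lambda>u. e * r * (V u - 2 / 3 * V u ^ 3 + 1 / 5 * V u ^ 5)"
    have "(\<integral>u. (e * (1 - (V u)\<^sup>2)\<^sup>2) * indicator {c - r..c + r} u \<partial>lborel) = ?F (c + r) - ?F (c - r)"
    proof (rule integral_FTC_Icc_real[OF cr])
      fix u
      have "(?F has_real_derivative e * r * (1 / r - 2 / 3 * (3 * V u ^ 2 * (1 / r)) + 1 / 5 * (5 * V u ^ 4 * (1 / r)))) (at u)"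
        by (auto intro!: derivative_eq_intros Vd)
      also have "e * r * (1 / r - 2 / 3 * (3 * V u ^ 2 * (1 / r)) + 1 / 5 * (5 * V u ^ 4 * (1 / r))) = e * (1 - (V u)\<^sup>2)\<^sup>2"
        using r by (simp add: field_simps power2_eq_square power4_eq_xxxx)
      finally show "(?F has_real_derivative e * (1 - (V u)\<^sup>2)\<^sup>2) (at u)" .
      show "isCont (\<lambda>u. e * (1 - (V u)\<^sup>2)\<^sup>2) u" by (intro continuous_intros Vc)
    qed
    also have "\<dots> = 16 / 15 * e * r" unfolding Ve by simp
    finally show ?thesis by (simp add: k_def mult.assoc)
  qed
  have kl: "k u * l u = - 4 * V u * (1 - (V u)\<^sup>2) / r * indicator {c - r..c + r} u" for u
  proof (cases "(V u)\<^sup>2 = 1")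
    case False
    then show ?thesis using r by (simp add: k_def l_def power2_eq_square divide_simps)
  qed (simp add: k_def l_def)
  have kl2: "?b u * (l u)\<^sup>2 \<le> 16 * e / r\<^sup>2 * indicator {c - r..c + r} u" for u
  proof (cases "u \<in> {c - r..c + r}")
    case True
    then have V1: "(V u)\<^sup>2 \<le> 1" using Vi[of u] by (simp add: abs_square_le_1)
    have "?b u * (l u)\<^sup>2 = e * (k u * l u) * l u" by (simp add: power2_eq_square)
    also have "\<dots> \<le> 16 * e / r\<^sup>2"
    proof (cases "(V u)\<^sup>2 = 1")
      case True then show ?thesis using e by (simp add: l_def)
    next
      case False
      then have "e * (k u * l u) * l u = 16 * e / r\<^sup>2 * (V u)\<^sup>2"
        unfolding kl using r True by (simp add: l_def power2_eq_square divide_simps)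
      also have "\<dots> \<le> 16 * e / r\<^sup>2 * 1" using V1 e by (intro mult_left_mono) auto
      finally show ?thesis by simp
    qed
    finally show ?thesis using True by simp
  qed (simp add: k_def)
  have ii: "integrable lborel (\<lambda>u. 16 * e / r\<^sup>2 * indicator {c - r..c + r} u :: real)"
    using cr by (intro integrable_mult_right integrable_real_indicator) (auto simp: ennreal_less_top)
  have il: "integrable lborel (\<lambda>u. ?b u * (l u)\<^sup>2)"
  proof (rule Bochner_Integration.integrable_bound[OF ii])
    show "AE u in lborel. norm (?b u * (l u)\<^sup>2) \<le> norm (16 * e / r\<^sup>2 * indicator {c - r..c + r} u)"
      using kl2 e k01 by (auto simp: abs_mult intro!: order_trans[OF _ abs_ge_self])
  qed measurable
  have Vl: "(\<integral>u. ?b u * (l u)\<^sup>2 \<partial>lborel) \<le> 32 * e / r"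
  proof -
    have "(\<integral>u. ?b u * (l u)\<^sup>2 \<partial>lborel) \<le> (\<integral>u. 16 * e / r\<^sup>2 * indicator {c - r..c + r} u \<partial>lborel)"
      by (rule integral_mono[OF il ii kl2])
    also have "\<dots> = 32 * e / r" using r by (simp add: power2_eq_square)
    finally show ?thesis .
  qed
  have ibp: "(\<integral>y. of_bool (snd y) * g' (fst y) \<partial>P) = - (\<integral>y. of_bool (snd y) * l (fst y) * g (fst y) \<partial>P)"
    if g: "\<And>u. (g has_real_derivative g' u) (at u)" and c': "continuous_on UNIV g'" for g g' :: "real \<Rightarrow> real"
  proof -
    have gc: "isCont g u" for u using g by (rule DERIV_isCont)
    have "continuous_on UNIV g" using gc by (simp add: continuous_at_imp_continuous_on)
    then have [measurable]: "g \<in> borel_measurable borel" "g' \<in> borel_measurable borel"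
      using c' by (auto intro: borel_measurable_continuous_onI)
    have c'': "isCont g' u" for u using c' by (simp add: continuous_on_eq_continuous_at)
    let ?B = "\<lambda>u. e * (1 - (V u)\<^sup>2)\<^sup>2" and ?B' = "\<lambda>u. - 4 * e * V u * (1 - (V u)\<^sup>2) / r"
    have Bd: "(?B has_real_derivative ?B' u) (at u)" for u
      by (auto intro!: derivative_eq_intros Vd)
    have I: "(\<integral>u. (?B u * g' u) * indicator {c - r..c + r} u \<partial>lborel)
      = ?B (c + r) * g (c + r) - ?B (c - r) * g (c - r) - (\<integral>u. (?B' u * g u) * indicator {c - r..c + r} u \<partial>lborel)"
    proof (rule integral_by_parts[OF cr])
      show "isCont ?B' u" for u using r by (intro continuous_intros Vc) auto
    qed (use c'' Bd g in auto)
    have e1: "(\<lambda>u. (?B u * g' u) * indicator {c - r..c + r} u) = (\<lambda>u. ?b u * g' u)"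
      by (auto simp: k_def)
    have e2: "(\<lambda>u. (?B' u * g u) * indicator {c - r..c + r} u) = (\<lambda>u. ?b u * (l u * g u))"
    proof
      fix u
      have "?b u * (l u * g u) = e * (k u * l u) * g u" by simp
      then show "(?B' u * g u) * indicator {c - r..c + r} u = ?b u * (l u * g u)"
        unfolding kl by simp
    qed
    have "(\<integral>u. ?b u * g' u \<partial>lborel) = - (\<integral>u. ?b u * (l u * g u) \<partial>lborel)"
      using I unfolding e1 e2 Ve by simp
    then show ?thesis using intD[of g'] intD[of "\<lambda>u. l u * g u"] by (simp add: mult.assoc)
  qed
  have "scored_law (16 / 15 * e * r) (32 * e / r) P l"
    unfolding scored_law_def
  proof (intro conjI allI impI)
    have "integrable (distr P borel fst) (\<lambda>u. u)" unfolding dist by (rule int)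
    then show "integrable P fst" by (subst (asm) integrable_distr_eq) auto
    show "(\<integral>y. of_bool (snd y) \<partial>P) = 16 / 15 * e * r" using intD[of "\<lambda>_. 1"] mass by simp
    show "integrable P (\<lambda>y. of_bool (snd y) * (l (fst y))\<^sup>2)" using intbD[of "\<lambda>u. (l u)\<^sup>2"] il by simp
    show "(\<integral>y. of_bool (snd y) * (l (fst y))\<^sup>2 \<partial>P) \<le> 32 * e / r" using intD[of "\<lambda>u. (l u)\<^sup>2"] Vl by simp
  qed (use pP sP lm ibp in auto)
  then show ?thesis using dist by blast
qed

text \<open>The sum of the three coefficients in the bound for labelled laws with m = 16/15 e r and
  V = 32 e/r, so that one constant dominates each term.\<close>

definition reg_const :: "real \<Rightarrow> real \<Rightarrow> real" where
  "reg_const e r = (3 + 8 / (16 / 15 * e * r)\<^sup>2) * ((1 + 32 * e / r) / 2) + 4 / (16 / 15 * e * r)\<^sup>2"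

text \<open>The product of the \<mu> is the image of a product of labelled laws under forgetting the
  labels, and the quadratic form reads the real coordinates only.\<close>

lemma quadratic_form_regularity:
  fixes q :: "'i \<Rightarrow> 'i \<Rightarrow> real" and \<phi> g :: "real \<Rightarrow> real" and \<mu> :: "'i \<Rightarrow> real measure"
  assumes \<mu>: "\<And>j. std_law K (\<mu> j)" and e: "0 < e" and r: "0 < r"
    and minor: "\<And>j A. A \<in> sets borel \<Longrightarrow> A \<subseteq> {c j - r<..<c j + r} \<Longrightarrow> e * measure lborel A \<le> measure (\<mu> j) A"
    and I: "finite I" and n: "real (card I) = n" "0 < n" "4 \<le> 16 / 15 * e * r * n"
    and q: "\<And>i. q i i = 0" "\<And>i j. q j i = q i j" "\<And>i j. i \<in> I \<Longrightarrow> j \<in> I \<Longrightarrow> i \<noteq> j \<Longrightarrow> 1 / n \<le> q i j"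
    and d: "\<And>x. (\<phi> has_real_derivative g x) (at x)" and cg: "continuous_on UNIV g"
    and b: "\<And>x. \<bar>\<phi> x\<bar> \<le> a" "\<And>x. \<bar>g x\<bar> \<le> b" and \<eta>: "0 < \<eta>"
  shows "\<bar>\<integral>x. g (qform q I x) \<partial>PiM I \<mu>\<bar> \<le> reg_const e r * (a / sqrt \<eta> + b * (sqrt \<eta> + 1 / n))"
proof -
  have S: "sets (\<mu> j) = sets borel" and pp: "prob_space (\<mu> j)" for j using \<mu> by (auto simp: std_law_def)
  have "\<exists>P l. scored_law (16 / 15 * e * r) (32 * e / r) P l \<and> distr P borel fst = \<mu> j" for j
    using std_law_integrable(1)[OF \<mu>[of j], of 1] minor
    by (intro scored_law_exists[OF pp S _ e r, where c="c j"]) auto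
  then obtain P l where P: "\<And>j. scored_law (16 / 15 * e * r) (32 * e / r) (P j) (l j)"
    and d\<mu>: "\<And>j. distr (P j) borel fst = \<mu> j" by metis
  have pP: "prob_space (P j)" and sP: "sets (P j) = sets (borel \<Otimes>\<^sub>M count_space UNIV)" for j
    using P by (auto simp: scored_law_def)
  note [measurable_cong] = S sP
  have fm: "fst \<in> measurable (P j) (\<mu> j)" for j by measurable
  have D: "distr (P j) (\<mu> j) fst = \<mu> j" for j
    using d\<mu>[of j] by (simp add: S cong: distr_cong)
  have dist: "distr (PiM I P) (PiM I \<mu>) (compose I fst) = PiM I \<mu>"
    using distr_PiM_finite_prob_space'[OF I pP pp fm] by (simp add: D)
  have "(\<lambda>x. compose I fst x) \<in> measurable (PiM I P) (PiM I \<mu>)"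
    unfolding compose_def using fm by measurable
  moreover have "(\<lambda>x. g (qform q I x)) \<in> borel_measurable (PiM I \<mu>)"
    using borel_measurable_continuous_onI[OF cg] qform_measurable[OF S I, of q] by measurable
  ultimately have "(\<integral>x. g (qform q I x) \<partial>distr (PiM I P) (PiM I \<mu>) (compose I fst)) = (\<integral>x. g (qform q I (compose I fst x)) \<partial>PiM I P)"
    by (intro integral_distr)
  moreover have "qform q I (compose I fst x) = qform q I (\<lambda>k. fst (x k))" for x :: "'i \<Rightarrow> real \<times> bool"
    unfolding qform_def by (intro sum.cong) (auto simp: compose_def)
  ultimately have eq: "(\<integral>x. g (qform q I x) \<partial>PiM I \<mu>) = (\<integral>x. g (qform q I (\<lambda>k. fst (x k))) \<partial>PiM I P)"
    by (simp only: dist)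
  define m t where "m = 16 / 15 * e * r" and "t = (1 + 32 * e / r) / 2"
  have t0: "0 \<le> t" using r e by (auto simp: t_def)
  have a0: "0 \<le> a" and b0: "0 \<le> b" using b abs_ge_zero order_trans by blast+
  have "\<bar>\<integral>x. g (qform q I x) \<partial>PiM I \<mu>\<bar>
    \<le> 3 * a * t / sqrt \<eta> + b * (8 * sqrt \<eta> * t / m\<^sup>2 + 4 / (m\<^sup>2 * n))"
    unfolding eq m_def t_def
    by (rule quadratic_form_regularity_scored[OF P I n(1,2) _ n(3) q d cg b \<eta>]) (use e r in auto)
  also have "\<dots> = (3 * t) * (a / sqrt \<eta>) + (8 / m\<^sup>2 * t) * (b * sqrt \<eta>) + 4 / m\<^sup>2 * (b * (1 / n))"
    by (simp add: algebra_simps)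
  also have "\<dots> \<le> reg_const e r * (a / sqrt \<eta>) + reg_const e r * (b * sqrt \<eta>) + reg_const e r * (b * (1 / n))"
  proof -
    have R: "reg_const e r = (3 * t) + (8 / m\<^sup>2 * t) + 4 / m\<^sup>2"
    proof -
      have "reg_const e r = (3 + 8 / m\<^sup>2) * t + 4 / m\<^sup>2" by (simp only: reg_const_def m_def t_def)
      then show ?thesis by (simp only: distrib_right)
    qed
    have "0 \<le> 3 * t" "0 \<le> 8 / m\<^sup>2 * t" "0 \<le> 4 / m\<^sup>2" using t0 by auto
    then show ?thesis unfolding R
      by (intro add_mono mult_right_mono) (use a0 b0 \<eta> n in auto)
  qed
  also have "\<dots> = reg_const e r * (a / sqrt \<eta> + b * (sqrt \<eta> + 1 / n))" by (simp add: distrib_left)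
  finally show ?thesis .
qed

section \<open>Approximation of the double integral on a grid\<close>

text \<open>The isometry as an inequality. A new coordinate multiplies a linear form in the old ones
  and is centred, so the cross term has mean zero. The coefficients may be asymmetric, and
  \<open>(b i j + b j i)\<^sup>2\<close> is at most twice the sum of the two squares; hence the
  factor 2.\<close>

lemma PiM_quadratic_form_second_moment:
  fixes b :: "'i \<Rightarrow> 'i \<Rightarrow> real" and v :: "'i \<Rightarrow> real"
  assumes P: "\<And>j. prob_space (M j)" and i1: "\<And>j. integrable (M j) (\<lambda>x. x)" "\<And>j. (\<integral>x. x \<partial>M j) = 0"
    and i2: "\<And>j. integrable (M j) (\<lambda>x. x\<^sup>2)" "\<And>j. (\<integral>x. x\<^sup>2 \<partial>M j) = v j" and sb: "\<And>j. sets (M j) = sets borel"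
    and b: "\<And>j. b j j = 0" and J: "finite J"
  shows "integrable (PiM J M) (\<lambda>x. (qform b J x)\<^sup>2) \<and>
    (\<integral>x. (qform b J x)\<^sup>2 \<partial>PiM J M) \<le> 2 * (\<Sum>j\<in>J. \<Sum>k\<in>J. (b j k)\<^sup>2 * v j * v k)"
  using J
proof (induction J rule: finite_induct)
  case empty
  then show ?case using prob_space_PiM[of "{}" M] by (simp add: qform_def)
next
  case (insert i J)
  note [measurable_cong] = sb
  interpret PJ: prob_space "PiM J M" by (intro prob_space_PiM P)
  let ?a = "\<lambda>j. b i j + b j i"
  let ?L = "\<lambda>x. \<Sum>j\<in>J. ?a j * x j"
  have v0: "0 \<le> v j" for j unfolding i2(2)[symmetric] by simp
  have eq: "qform b (insert i J) x = qform b J x + x i * ?L x" for x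
    using insert.hyps b[of i] unfolding qform_def
    by (simp add: sum.distrib sum_distrib_left algebra_simps)
  have L: "integrable (PiM J M) ?L" "integrable (PiM J M) (\<lambda>x. (?L x)\<^sup>2)"
    "(\<integral>x. (?L x)\<^sup>2 \<partial>PiM J M) = (\<Sum>j\<in>J. (?a j)\<^sup>2 * v j)"
    using PiM_sum_square[where f="\<lambda>j y. ?a j * y" and J=J and M=M, OF P insert.hyps(1)] i1 i2
    by (auto simp: power_mult_distrib)
  have m: "qform b J \<in> borel_measurable (PiM J M)" by (rule qform_measurable[OF sb insert.hyps(1)])
  have iV: "integrable (PiM J M) (\<lambda>x. (qform b J x)\<^sup>2)"
    and vV: "(\<integral>x. (qform b J x)\<^sup>2 \<partial>PiM J M) \<le> 2 * (\<Sum>j\<in>J. \<Sum>k\<in>J. (b j k)\<^sup>2 * v j * v k)"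
    using insert.IH by auto
  have iVL: "integrable (PiM J M) (\<lambda>x. qform b J x * ?L x)"
  proof (rule Bochner_Integration.integrable_bound)
    show "integrable (PiM J M) (\<lambda>x. (qform b J x)\<^sup>2 + (?L x)\<^sup>2)" using iV L by simp
    have "\<bar>y * z\<bar> \<le> y\<^sup>2 + z\<^sup>2" for y z :: real
    proof -
      have "2 * \<bar>y * z\<bar> \<le> y\<^sup>2 + z\<^sup>2"
        using zero_le_power2[of "\<bar>y\<bar> - \<bar>z\<bar>"] by (simp add: power2_diff abs_mult)
      then show ?thesis using abs_ge_zero[of "y * z"] by linarith
    qed
    then show "AE x in PiM J M. norm (qform b J x * ?L x) \<le> norm ((qform b J x)\<^sup>2 + (?L x)\<^sup>2)" by auto
  qed (use m L in auto)
  have uL: "?L (x(i := y)) = ?L (restrict x J)" for x y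
    using sum_upd_eq[of i J "\<lambda>j z. ?a j * z"] insert.hyps by simp
  have uV: "qform b J (x(i := y)) = qform b J (restrict x J)" for x y
    unfolding qform_def using insert.hyps by (intro sum.cong refl) (auto intro!: sum.cong)
  note A = PiM_insert_mult[where g="\<lambda>x. qform b J x * ?L x", OF P insert.hyps i1(1)[of i] iVL]
  note B = PiM_insert_mult[where g="\<lambda>x. (?L x)\<^sup>2", OF P insert.hyps i2(1)[of i] L(2)]
  note C = PiM_insert_mult(3,4)[where g="\<lambda>x. (qform b J x)\<^sup>2", OF P insert.hyps i1(1)[of i] iV]
  have A': "integrable (PiM (insert i J) M) (\<lambda>x. x i * (qform b J x * ?L x))" 
    "(\<integral>x. x i * (qform b J x * ?L x) \<partial>PiM (insert i J) M) = 0"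
    using A(1,2) uL uV i1 by auto
  have B': "integrable (PiM (insert i J) M) (\<lambda>x. (x i)\<^sup>2 * (?L x)\<^sup>2)" 
    "(\<integral>x. (x i)\<^sup>2 * (?L x)\<^sup>2 \<partial>PiM (insert i J) M) = v i * (\<Sum>j\<in>J. (?a j)\<^sup>2 * v j)"
    using B(1,2) uL i2 L by auto
  have C': "integrable (PiM (insert i J) M) (\<lambda>x. (qform b J x)\<^sup>2)" 
    "(\<integral>x. (qform b J x)\<^sup>2 \<partial>PiM (insert i J) M) = (\<integral>x. (qform b J x)\<^sup>2 \<partial>PiM J M)"
    using C uV by auto
  have e2: "(\<lambda>x. (qform b (insert i J) x)\<^sup>2) = (\<lambda>x. (qform b J x)\<^sup>2 + 2 * (x i * (qform b J x * ?L x)) + (x i)\<^sup>2 * (?L x)\<^sup>2)"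
    unfolding eq by (auto simp: power2_eq_square algebra_simps)
  have int: "integrable (PiM (insert i J) M) (\<lambda>x. (qform b (insert i J) x)\<^sup>2)"
    unfolding e2 using A' B' C' by (intro Bochner_Integration.integrable_add integrable_mult_right) auto
  have "(\<integral>x. (qform b (insert i J) x)\<^sup>2 \<partial>PiM (insert i J) M) = (\<integral>x. (qform b J x)\<^sup>2 \<partial>PiM J M) + v i * (\<Sum>j\<in>J. (?a j)\<^sup>2 * v j)"
    unfolding e2 using A' B' C' by (simp del: sum.insert)
  also have "\<dots> \<le> 2 * (\<Sum>j\<in>J. \<Sum>k\<in>J. (b j k)\<^sup>2 * v j * v k) + v i * (\<Sum>j\<in>J. (2 * (b i j)\<^sup>2 + 2 * (b j i)\<^sup>2) * v j)"
  proof (intro add_mono vV mult_left_mono sum_mono mult_right_mono v0)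
    show "(b i j + b j i)\<^sup>2 \<le> 2 * (b i j)\<^sup>2 + 2 * (b j i)\<^sup>2" for j
      using zero_le_power2[of "b i j - b j i"] by (simp add: power2_diff power2_sum)
  qed
  also have "\<dots> = 2 * (\<Sum>j\<in>insert i J. \<Sum>k\<in>insert i J. (b j k)\<^sup>2 * v j * v k)"
  proof -
    have "v i * (\<Sum>j\<in>J. (2 * (b i j)\<^sup>2 + 2 * (b j i)\<^sup>2) * v j)
       = 2 * (\<Sum>k\<in>J. (b i k)\<^sup>2 * v i * v k) + 2 * (\<Sum>k\<in>J. (b k i)\<^sup>2 * v k * v i)"
      unfolding sum_distrib_left sum.distrib[symmetric] by (intro sum.cong) (auto simp: algebra_simps)
    then show ?thesis using insert.hyps b[of i] by (simp add: sum.distrib)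
  qed
  finally show ?case using int by simp
qed

lemma sum_square_disjoint:
  fixes f :: "'c \<Rightarrow> real"
  assumes "finite A" "\<And>a a'. a \<in> A \<Longrightarrow> a' \<in> A \<Longrightarrow> f a \<noteq> 0 \<Longrightarrow> f a' \<noteq> 0 \<Longrightarrow> a = a'"
  shows "(\<Sum>a\<in>A. f a)\<^sup>2 = (\<Sum>a\<in>A. (f a)\<^sup>2)"
proof (cases "\<exists>a\<in>A. f a \<noteq> 0")
  case True
  then obtain a where a: "a \<in> A" "f a \<noteq> 0" by blast
  then have z: "f a' = 0" if "a' \<in> A - {a}" for a' using assms(2)[of a' a] that by blast
  have "(\<Sum>a\<in>A. f a) = f a" "(\<Sum>a\<in>A. (f a)\<^sup>2) = (f a)\<^sup>2"
    using z by (simp_all add: sum.remove[OF assms(1) a(1)])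
  then show ?thesis by simp
qed simp

lemma elem_kernel_measurable [measurable]: "elem_kernel ts a \<in> borel_measurable borel"
  unfolding elem_kernel_def case_prod_beta' borel_prod[symmetric] by measurable

text \<open>The rectangles are disjoint: at any point at most one summand is nonzero, and the square
  has no cross terms.\<close>

lemma elem_kernel_L2:
  assumes ad: "elem_admissible ts a"
  shows "(\<integral>\<^sup>+ u. ennreal ((elem_kernel ts a u)\<^sup>2) * indicator ({0..1} \<times> {0..1}) u \<partial>lborel)
    = ennreal (\<Sum>j<length ts - 1. \<Sum>k<length ts - 1. (a j k)\<^sup>2 * (ts ! Suc j - ts ! j) * (ts ! Suc k - ts ! k))"
proof -
  let ?n = "length ts - 1"
  let ?c = "\<lambda>j. {ts ! j..<ts ! Suc j}"
  have so: "sorted_wrt (<) ts" and s01: "set ts \<subseteq> {0..1}" using ad by (auto simp: elem_admissible_def)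
  have lt: "ts ! i < ts ! j" if "i < j" "j < length ts" for i j
    using so that by (simp add: sorted_wrt_iff_nth_less)
  have le: "ts ! i \<le> ts ! j" if "i \<le> j" "j < length ts" for i j
    using lt[of i j] that by (cases "i = j") auto
  have inc: "0 \<le> ts ! Suc j - ts ! j" if "j < ?n" for j using le[of j "Suc j"] that by auto
  have c01: "?c j \<subseteq> {0..1}" if "j < ?n" for j
  proof -
    have "ts ! j \<in> {0..1}" "ts ! Suc j \<in> {0..1}" using that subsetD[OF s01 nth_mem[of j ts]] subsetD[OF s01 nth_mem[of "Suc j" ts]] by auto
    then show ?thesis by auto
  qed
  have disj: "j = j'" if "s \<in> ?c j" "s \<in> ?c j'" "j < ?n" "j' < ?n" for s j j'
  proof (rule ccontr)
    assume "j \<noteq> j'"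
    then consider "j < j'" | "j' < j" by linarith
    then show False
    proof cases
      case 1 then show ?thesis using le[of "Suc j" j'] that by force
    next
      case 2 then show ?thesis using le[of "Suc j'" j] that by force
    qed
  qed
  let ?f = "\<lambda>(s, t) (j, k). a j k * indicator (?c j) s * indicator (?c k) t"
  have K: "elem_kernel ts a u = (\<Sum>x\<in>{..<?n} \<times> {..<?n}. ?f u x)" for u
    by (cases u) (simp only: elem_kernel_def prod.case sum.cartesian_product)
  have sq: "(elem_kernel ts a u)\<^sup>2 = (\<Sum>x\<in>{..<?n} \<times> {..<?n}. (?f u x)\<^sup>2)" for u
    unfolding K
  proof (rule sum_square_disjoint)
    fix x y assume xy: "x \<in> {..<?n} \<times> {..<?n}" "y \<in> {..<?n} \<times> {..<?n}" "?f u x \<noteq> 0" "?f u y \<noteq> 0"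
    obtain s t j k j' k' where e: "u = (s, t)" "x = (j, k)" "y = (j', k')" by (metis surj_pair)
    have "s \<in> ?c j" "t \<in> ?c k" "s \<in> ?c j'" "t \<in> ?c k'"
      using xy unfolding e by (auto simp: indicator_def split: if_splits)
    then show "x = y" using xy disj unfolding e by blast
  qed simp
  have pt: "ennreal ((elem_kernel ts a u)\<^sup>2) * indicator ({0..1} \<times> {0..1}) u
     = (\<Sum>x\<in>{..<?n} \<times> {..<?n}. ennreal ((a (fst x) (snd x))\<^sup>2) * indicator (?c (fst x) \<times> ?c (snd x)) u)" for u
  proof -
    have s1: "ennreal ((elem_kernel ts a u)\<^sup>2) = (\<Sum>x\<in>{..<?n} \<times> {..<?n}. ennreal ((?f u x)\<^sup>2))"
      unfolding sq by (rule sum_ennreal[symmetric]) simp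
    have "ennreal ((elem_kernel ts a u)\<^sup>2) * indicator ({0..1} \<times> {0..1}) u = (\<Sum>x\<in>{..<?n} \<times> {..<?n}. ennreal ((?f u x)\<^sup>2) * indicator ({0..1} \<times> {0..1}) u)"
      unfolding s1 by (rule sum_distrib_right)
    also have "\<dots> = (\<Sum>x\<in>{..<?n} \<times> {..<?n}. ennreal ((a (fst x) (snd x))\<^sup>2) * indicator (?c (fst x) \<times> ?c (snd x)) u)"
    proof (rule sum.cong[OF refl])
      fix x assume x: "x \<in> {..<?n} \<times> {..<?n}"
      obtain s t where u: "u = (s, t)" by (cases u)
      obtain j k where e: "x = (j, k)" by (cases x)
      have c: "?c j \<subseteq> {0..1}" "?c k \<subseteq> {0..1}" using x c01 unfolding e by auto
      show "ennreal ((?f u x)\<^sup>2) * indicator ({0..1} \<times> {0..1}) u = ennreal ((a (fst x) (snd x))\<^sup>2) * indicator (?c (fst x) \<times> ?c (snd x)) u"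
      proof (cases "s \<in> ?c j \<and> t \<in> ?c k")
        case True
        then have "s \<in> {0..1}" "t \<in> {0..1}" using c by blast+
        then show ?thesis using True unfolding u e by simp
      next
        case False
        then have "indicator (?c j) s * indicator (?c k) t = (0::real)" by (auto simp: indicator_def)
        then have "(?f u x)\<^sup>2 = 0" unfolding u e by (simp add: mult.assoc del: indicator_simps)
        moreover have "indicator (?c j \<times> ?c k) (s, t) = (0::ennreal)" using False by (simp add: indicator_def)
        ultimately show ?thesis unfolding u e by simp
      qed
    qed
    finally show ?thesis .
  qed
  have "(\<integral>\<^sup>+ u. ennreal ((elem_kernel ts a u)\<^sup>2) * indicator ({0..1} \<times> {0..1}) u \<partial>lborel)
    = (\<Sum>x\<in>{..<?n} \<times> {..<?n}. \<integral>\<^sup>+ u. ennreal ((a (fst x) (snd x))\<^sup>2) * indicator (?c (fst x) \<times> ?c (snd x)) u \<partial>lborel)"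
    unfolding pt by (rule nn_integral_sum)
      (auto intro!: borel_measurable_times_ennreal borel_measurable_indicator borel_Times)
  also have "\<dots> = (\<Sum>x\<in>{..<?n} \<times> {..<?n}. ennreal ((a (fst x) (snd x))\<^sup>2 * (ts ! Suc (fst x) - ts ! fst x) * (ts ! Suc (snd x) - ts ! snd x)))"
  proof (rule sum.cong[OF refl])
    fix x assume x: "x \<in> {..<?n} \<times> {..<?n}"
    have i: "0 \<le> ts ! Suc (fst x) - ts ! fst x" "0 \<le> ts ! Suc (snd x) - ts ! snd x" using x inc by auto
    have "(\<integral>\<^sup>+ u. ennreal ((a (fst x) (snd x))\<^sup>2) * indicator (?c (fst x) \<times> ?c (snd x)) u \<partial>lborel)
      = ennreal ((a (fst x) (snd x))\<^sup>2) * emeasure (lborel \<Otimes>\<^sub>M lborel) (?c (fst x) \<times> ?c (snd x))"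
      unfolding lborel_prod by (rule nn_integral_cmult_indicator) (auto simp: borel_Times)
    also have "emeasure (lborel \<Otimes>\<^sub>M lborel) (?c (fst x) \<times> ?c (snd x)) = ennreal (ts ! Suc (fst x) - ts ! fst x) * ennreal (ts ! Suc (snd x) - ts ! snd x)"
      using i by (subst lborel.emeasure_pair_measure_Times) auto
    finally show "(\<integral>\<^sup>+ u. ennreal ((a (fst x) (snd x))\<^sup>2) * indicator (?c (fst x) \<times> ?c (snd x)) u \<partial>lborel)
       = ennreal ((a (fst x) (snd x))\<^sup>2 * (ts ! Suc (fst x) - ts ! fst x) * (ts ! Suc (snd x) - ts ! snd x))"
      using i by (simp add: ennreal_mult mult.assoc)
  qed
  also have "\<dots> = ennreal (\<Sum>x\<in>{..<?n} \<times> {..<?n}. (a (fst x) (snd x))\<^sup>2 * (ts ! Suc (fst x) - ts ! fst x) * (ts ! Suc (snd x) - ts ! snd x))"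
    using inc by (intro sum_ennreal) (auto intro!: mult_nonneg_nonneg)
  finally show ?thesis by (simp add: sum.cartesian_product case_prod_beta')
qed

lemma std_BM_increment_normal:
  assumes W: "std_BM N W" and st: "0 \<le> s" "s < t"
  shows "distr N borel (\<lambda>\<omega>. W t \<omega> - W s \<omega>) = density lborel (\<lambda>x. ennreal (normal_density 0 (sqrt (t - s)) x))"
proof -
  have "distributed N lborel (\<lambda>\<omega>. W t \<omega> - W s \<omega>) (\<lambda>x. ennreal (normal_density 0 (sqrt (t - s)) x))"
    using W st unfolding std_BM_def by blast
  then show ?thesis by (auto simp: distributed_def cong: distr_cong)
qed

lemma normal_law_moments:
  assumes "0 < \<sigma>"
  defines "M \<equiv> density lborel (\<lambda>x. ennreal (normal_density 0 \<sigma> x))"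
  shows "prob_space M" "sets M = sets borel" "integrable M (\<lambda>x. x ^ k)" "(\<integral>x. x \<partial>M) = 0" "(\<integral>x. x\<^sup>2 \<partial>M) = \<sigma>\<^sup>2"
proof -
  show "prob_space M" unfolding M_def by (rule prob_space_normal_density[OF assms(1)])
  show "sets M = sets borel" by (simp add: M_def)
  show "integrable M (\<lambda>x. x ^ k)"
    unfolding M_def using integrable_normal_moment[OF assms(1), of 0 k] by (subst integrable_density) auto
  show "(\<integral>x. x \<partial>M) = 0"
    unfolding M_def using integral_normal_moment_odd[OF assms(1), of 0 0] by (subst integral_density) auto
  show "(\<integral>x. x\<^sup>2 \<partial>M) = \<sigma>\<^sup>2"
    unfolding M_def using integral_normal_moment_even[OF assms(1), of 0 1] by (subst integral_density) auto
qed

text \<open>The increments are independent centred normals whose variances are the interval lengths,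
  so the moment bound for quadratic forms on product spaces applies, and its right-hand side is the
  squared norm of the kernel.\<close>

lemma elem_I2_second_moment:
  assumes W: "std_BM N W" and ad: "elem_admissible ts a"
  shows "(\<integral>\<^sup>+ \<omega>. ennreal ((elem_I2 W ts a \<omega>)\<^sup>2) \<partial>N)
    \<le> 2 * (\<integral>\<^sup>+ u. ennreal ((elem_kernel ts a u)\<^sup>2) * indicator ({0..1} \<times> {0..1}) u \<partial>lborel)"
proof (cases "length ts - 1 = 0")
  case True
  then show ?thesis by (simp add: elem_I2_def)
next
  case False
  interpret prob_space N using W by (auto simp: std_BM_def)
  have [measurable]: "W t \<in> borel_measurable N" for t using W by (auto simp: std_BM_def)
  let ?n = "length ts - 1"
  define I where "I = {..<?n}"
  define \<Delta> where "\<Delta> k \<omega> = W (ts ! Suc k) \<omega> - W (ts ! k) \<omega>" for k \<omega>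
  have [measurable]: "\<Delta> k \<in> borel_measurable N" for k unfolding \<Delta>_def by measurable
  have so: "sorted_wrt (<) ts" and s01: "set ts \<subseteq> {0..1}" and a0: "\<And>j. a j j = 0"
    using ad by (auto simp: elem_admissible_def)
  \<comment> \<open>The value 1 beyond the last interval makes every \<open>M k\<close> a normal
    law, as the moment bound asks this of all indices.\<close>
  define v where "v k = (if k < ?n then ts ! Suc k - ts ! k else 1)" for k
  have v0: "0 < v k" for k
    using so by (auto simp: v_def sorted_wrt_iff_nth_less)
  define M where "M k = density lborel (\<lambda>x. ennreal (normal_density 0 (sqrt (v k)) x))" for k
  have lawD: "distr N borel (\<Delta> k) = M k" if "k \<in> I" for k
  proof -
    have "k < length ts" using that by (auto simp: I_def)
    then have "0 \<le> ts ! k" using subsetD[OF s01 nth_mem[of k ts]] by auto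
    moreover have "ts ! k < ts ! Suc k" using v0[of k] that by (auto simp: v_def I_def)
    ultimately have "distr N borel (\<lambda>\<omega>. W (ts ! Suc k) \<omega> - W (ts ! k) \<omega>)
      = density lborel (\<lambda>x. ennreal (normal_density 0 (sqrt (ts ! Suc k - ts ! k)) x))"
      by (rule std_BM_increment_normal[OF W])
    then show ?thesis using that by (simp add: \<Delta>_def[abs_def] M_def v_def I_def)
  qed
  have "indep_vars (\<lambda>_. borel) \<Delta> I"
  proof -
    have "set ts \<subseteq> {0..}" using s01 by auto
    then show ?thesis using W so unfolding std_BM_def I_def \<Delta>_def[abs_def] by blast
  qed
  then have "distr N (\<Pi>\<^sub>M i\<in>I. borel) (\<lambda>x. \<lambda>i\<in>I. \<Delta> i x) = (\<Pi>\<^sub>M i\<in>I. distr N borel (\<Delta> i))"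
    using False by (subst (asm) indep_vars_iff_distr_eq_PiM) (auto simp: I_def lessThan_empty_iff)
  also have "\<dots> = PiM I M" by (intro PiM_cong) (auto simp: lawD)
  finally have law: "distr N (\<Pi>\<^sub>M i\<in>I. borel) (\<lambda>x. \<lambda>i\<in>I. \<Delta> i x) = PiM I M" .
  have R: "integrable (PiM I M) (\<lambda>x. (qform a I x)\<^sup>2) \<and>
    (\<integral>x. (qform a I x)\<^sup>2 \<partial>PiM I M) \<le> 2 * (\<Sum>j\<in>I. \<Sum>k\<in>I. (a j k)\<^sup>2 * v j * v k)"
  proof (rule PiM_quadratic_form_second_moment)
    fix j
    have vj: "0 < sqrt (v j)" using v0 by simp
    show "prob_space (M j)" "sets (M j) = sets borel" "(\<integral>x. x \<partial>M j) = 0"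
      using normal_law_moments[OF vj, folded M_def] by auto
    show "integrable (M j) (\<lambda>x. x)" using normal_law_moments(3)[OF vj, of 1, folded M_def] by simp
    show "integrable (M j) (\<lambda>x. x\<^sup>2)" using normal_law_moments(3)[OF vj, of 2, folded M_def] by simp
    show "(\<integral>x. x\<^sup>2 \<partial>M j) = v j" using normal_law_moments(5)[OF vj, folded M_def] v0[of j] by simp
  qed (auto simp: a0 I_def)
  have qe: "elem_I2 W ts a \<omega> = qform a I (\<lambda>i\<in>I. \<Delta> i \<omega>)" for \<omega>
    unfolding elem_I2_def qform_def I_def \<Delta>_def by (intro sum.cong refl) auto
  have "(\<integral>\<^sup>+ \<omega>. ennreal ((elem_I2 W ts a \<omega>)\<^sup>2) \<partial>N) = (\<integral>\<^sup>+ x. ennreal ((qform a I x)\<^sup>2) \<partial>distr N (\<Pi>\<^sub>M i\<in>I. borel) (\<lambda>x. \<lambda>i\<in>I. \<Delta> i x))"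
    unfolding qe by (subst nn_integral_distr) (auto intro!: qform_measurable simp: I_def)
  also have "\<dots> = (\<integral>\<^sup>+ x. ennreal ((qform a I x)\<^sup>2) \<partial>PiM I M)" unfolding law ..
  also have "\<dots> = ennreal (\<integral>x. (qform a I x)\<^sup>2 \<partial>PiM I M)"
    using R by (intro nn_integral_eq_integral) auto
  also have "\<dots> \<le> ennreal (2 * (\<Sum>j\<in>I. \<Sum>k\<in>I. (a j k)\<^sup>2 * v j * v k))"
    using R by (intro ennreal_leI) auto
  also have "\<dots> = 2 * ennreal (\<Sum>j\<in>I. \<Sum>k\<in>I. (a j k)\<^sup>2 * v j * v k)"
    using v0 by (subst ennreal_mult) (auto intro!: sum_nonneg mult_nonneg_nonneg simp: less_imp_le)
  also have "(\<Sum>j\<in>I. \<Sum>k\<in>I. (a j k)\<^sup>2 * v j * v k)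
     = (\<Sum>j<?n. \<Sum>k<?n. (a j k)\<^sup>2 * (ts ! Suc j - ts ! j) * (ts ! Suc k - ts ! k))"
    unfolding I_def v_def by (intro sum.cong refl) auto
  finally show ?thesis unfolding elem_kernel_L2[OF ad] .
qed

text \<open>Both \<open>elem_I2\<close> and \<open>elem_kernel\<close> are bilinear sums over increments, the latter of
  \<open>\<lambda>z. of_bool (s < z)\<close> instead of the Brownian path, so one refinement lemma serves both.\<close>

definition incr_form :: "real list \<Rightarrow> (nat \<Rightarrow> nat \<Rightarrow> real) \<Rightarrow> (real \<Rightarrow> real) \<Rightarrow> (real \<Rightarrow> real) \<Rightarrow> real" where
  "incr_form ts a F G = (\<Sum>j<length ts - 1. \<Sum>k<length ts - 1.
     a j k * (F (ts ! Suc j) - F (ts ! j)) * (G (ts ! Suc k) - G (ts ! k)))"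

lemma elem_I2_incr_form: "elem_I2 W ts a \<omega> = incr_form ts a (\<lambda>t. W t \<omega>) (\<lambda>t. W t \<omega>)"
  by (simp add: elem_I2_def incr_form_def)

lemma elem_kernel_incr_form:
  assumes "sorted_wrt (<) ts"
  shows "elem_kernel ts a (s, t) = incr_form ts a (\<lambda>z. of_bool (s < z)) (\<lambda>z. of_bool (t < z))"
proof -
  have "ts ! j < ts ! Suc j" if "j < length ts - 1" for j
    using assms that by (simp add: sorted_wrt_iff_nth_less)
  then have "indicator {ts ! j..<ts ! Suc j} s = (of_bool (s < ts ! Suc j) - of_bool (s < ts ! j) :: real)"
    if "j < length ts - 1" for j s
    using that[THEN \<open>\<And>j. j < length ts - 1 \<Longrightarrow> ts ! j < ts ! Suc j\<close>] by (auto simp: indicator_def)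
  then show ?thesis unfolding elem_kernel_def incr_form_def by simp
qed

text \<open>The points of \<open>us\<close> in \<open>[x, y)\<close> are exactly the left endpoints
  of the steps that lead from \<open>x\<close> to \<open>y\<close>.\<close>

lemma increment_telescope:
  fixes F :: "real \<Rightarrow> real"
  assumes us: "sorted_wrt (<) us" and xy: "x \<in> set us" "y \<in> set us" "x < y"
  shows "F y - F x = (\<Sum>j<length us - 1. indicator {x..<y} (us ! j) * (F (us ! Suc j) - F (us ! j)))"
proof -
  obtain p q where p: "p < length us" "us ! p = x" and q: "q < length us" "us ! q = y"
    using xy by (auto simp: in_set_conv_nth)
  have mono: "us ! i < us ! j \<longleftrightarrow> i < j" if "i < length us" "j < length us" for i j
    using us that by (metis linorder_neqE_nat order_less_asym sorted_wrt_iff_nth_less less_irrefl)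
  have pq: "p < q" using mono[of p q] p q xy by auto
  have ind: "indicator {x..<y} (us ! j) = (of_bool (p \<le> j \<and> j < q) :: real)" if "j < length us - 1" for j
    using mono[of j p] mono[of j q] that p q by (auto simp: indicator_def not_less[symmetric])
  have "(\<Sum>j<length us - 1. indicator {x..<y} (us ! j) * (F (us ! Suc j) - F (us ! j)))
    = (\<Sum>j<length us - 1. if j \<in> {p..<q} then F (us ! Suc j) - F (us ! j) else 0)"
    by (intro sum.cong refl) (auto simp: ind)
  also have "\<dots> = (\<Sum>j\<in>{..<length us - 1} \<inter> {p..<q}. F (us ! Suc j) - F (us ! j))"
    by (rule sum.inter_restrict[symmetric]) simp
  also have "{..<length us - 1} \<inter> {p..<q} = {p..<q}" using q by auto
  also have "(\<Sum>j\<in>{p..<q}. F (us ! Suc j) - F (us ! j)) = F (us ! q) - F (us ! p)"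
    using pq by (intro sum_Suc_diff') auto
  finally show ?thesis using p q by simp
qed

text \<open>Each coarse increment telescopes into fine ones. After the sums are exchanged, the
  coefficient of a pair of fine steps is the coarse kernel at their left endpoints, in keeping with
  cells closed on the left.\<close>

lemma incr_form_refine:
  assumes ts: "sorted_wrt (<) ts" and us: "sorted_wrt (<) us" and sub: "set ts \<subseteq> set us"
  shows "incr_form ts a F G = incr_form us (\<lambda>j k. elem_kernel ts a (us ! j, us ! k)) F G"
proof -
  let ?n = "length ts - 1" and ?m = "length us - 1"
  let ?i = "\<lambda>j z. indicator {ts ! j..<ts ! Suc j} z :: real"
  let ?F = "\<lambda>j. F (us ! Suc j) - F (us ! j)" and ?G = "\<lambda>j. G (us ! Suc j) - G (us ! j)"
  have D: "H (ts ! Suc j) - H (ts ! j) = (\<Sum>l<?m. ?i j (us ! l) * (H (us ! Suc l) - H (us ! l)))"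
    if "j < ?n" for j and H :: "real \<Rightarrow> real"
  proof (rule increment_telescope[OF us])
    show "ts ! j \<in> set us" "ts ! Suc j \<in> set us" using that sub by (auto intro!: subsetD[OF sub] nth_mem)
    show "ts ! j < ts ! Suc j" using ts that by (simp add: sorted_wrt_iff_nth_less)
  qed
  have "incr_form ts a F G = (\<Sum>j<?n. \<Sum>k<?n. a j k * (\<Sum>l<?m. ?i j (us ! l) * ?F l) * (\<Sum>r<?m. ?i k (us ! r) * ?G r))"
    unfolding incr_form_def by (intro sum.cong refl) (simp add: D)
  also have "\<dots> = (\<Sum>j<?n. \<Sum>k<?n. \<Sum>l<?m. \<Sum>r<?m. a j k * ?i j (us ! l) * ?i k (us ! r) * ?F l * ?G r)"
    by (simp only: sum_product sum_distrib_left sum_distrib_right mult_ac)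
  also have "\<dots> = (\<Sum>j<?n. \<Sum>l<?m. \<Sum>k<?n. \<Sum>r<?m. a j k * ?i j (us ! l) * ?i k (us ! r) * ?F l * ?G r)"
    by (intro sum.cong refl sum.swap)
  also have "\<dots> = (\<Sum>l<?m. \<Sum>j<?n. \<Sum>k<?n. \<Sum>r<?m. a j k * ?i j (us ! l) * ?i k (us ! r) * ?F l * ?G r)"
    by (rule sum.swap)
  also have "\<dots> = (\<Sum>l<?m. \<Sum>j<?n. \<Sum>r<?m. \<Sum>k<?n. a j k * ?i j (us ! l) * ?i k (us ! r) * ?F l * ?G r)"
    by (intro sum.cong refl sum.swap)
  also have "\<dots> = (\<Sum>l<?m. \<Sum>r<?m. \<Sum>j<?n. \<Sum>k<?n. a j k * ?i j (us ! l) * ?i k (us ! r) * ?F l * ?G r)"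
    by (intro sum.cong refl sum.swap)
  also have "\<dots> = incr_form us (\<lambda>j k. elem_kernel ts a (us ! j, us ! k)) F G"
    unfolding incr_form_def elem_kernel_def by (simp only: prod.case sum_distrib_right)
  finally show ?thesis .
qed

text \<open>Keeps refinements admissible: sampled on a finer partition, the kernel again has
  vanishing diagonal coefficients, because rectangles over two different intervals do not meet the
  diagonal.\<close>

lemma elem_kernel_diagonal:
  assumes "elem_admissible ts a"
  shows "elem_kernel ts a (s, s) = 0"
proof -
  have so: "sorted_wrt (<) ts" and a0: "\<And>j. a j j = 0" using assms by (auto simp: elem_admissible_def)
  have le: "ts ! i \<le> ts ! j" if "i \<le> j" "j < length ts" for i j
    using so that by (cases "i = j") (auto simp: sorted_wrt_iff_nth_less less_imp_le)
  have z: "indicator {ts ! j..<ts ! Suc j} s * indicator {ts ! k..<ts ! Suc k} s = (0 :: real)"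
    if "j < k" "k < length ts - 1" for j k
  proof -
    have "ts ! Suc j \<le> ts ! k" by (rule le) (use that in auto)
    then show ?thesis by (auto simp: indicator_def)
  qed
  have z0: "a j k * indicator {ts ! j..<ts ! Suc j} s * indicator {ts ! k..<ts ! Suc k} s = 0"
    if "j < length ts - 1" "k < length ts - 1" for j k
  proof -
    consider "j = k" | "j < k" | "k < j" by linarith
    then show ?thesis
    proof cases
      case 2 then show ?thesis using z[of j k] that by (simp only: mult.assoc mult_zero_right)
    next
      case 3 then show ?thesis using z[of k j] that by (simp only: mult.assoc mult.commute[of "indicator {ts ! j..<ts ! Suc j} s"] mult_zero_right)
    qed (simp add: a0)
  qed
  show ?thesis
    unfolding elem_kernel_def prod.case by (intro sum.neutral ballI z0) (simp_all only: lessThan_iff)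
qed

lemma elem_I2_measurable:
  assumes "std_BM N W" shows "elem_I2 W ts a \<in> borel_measurable N"
proof -
  have [measurable]: "W t \<in> borel_measurable N" for t using assms by (auto simp: std_BM_def)
  show ?thesis unfolding elem_I2_def by measurable
qed

text \<open>On the union of both partitions the difference becomes a single elementary integral, to
  which the isometry bound applies.\<close>

lemma elem_I2_diff_second_moment:
  assumes W: "std_BM N W" and a: "elem_admissible ts a" and b: "elem_admissible ts' b"
  shows "(\<integral>\<^sup>+ \<omega>. ennreal ((elem_I2 W ts a \<omega> - elem_I2 W ts' b \<omega>)\<^sup>2) \<partial>N)
    \<le> 2 * (\<integral>\<^sup>+ u. ennreal ((elem_kernel ts a u - elem_kernel ts' b u)\<^sup>2) * indicator ({0..1} \<times> {0..1}) u \<partial>lborel)"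
proof -
  define us where "us = sorted_list_of_set (set ts \<union> set ts')"
  have us: "sorted_wrt (<) us" unfolding us_def by (rule strict_sorted_list_of_set)
  have sub: "set ts \<subseteq> set us" "set ts' \<subseteq> set us" by (auto simp: us_def)
  have so: "sorted_wrt (<) ts" "sorted_wrt (<) ts'" using a b by (auto simp: elem_admissible_def)
  define c where "c j k = elem_kernel ts a (us ! j, us ! k) - elem_kernel ts' b (us ! j, us ! k)" for j k
  have ad: "elem_admissible us c"
    using us a b unfolding elem_admissible_def[of us] c_def
    by (auto simp: us_def elem_admissible_def elem_kernel_diagonal)
  have diff: "incr_form ts a F G - incr_form ts' b F G = incr_form us c F G" for F G
    unfolding incr_form_refine[OF so(1) us sub(1)] incr_form_refine[OF so(2) us sub(2)]
    unfolding incr_form_def c_def by (simp add: sum_subtractf[symmetric] left_diff_distrib)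
  have 1: "elem_I2 W ts a \<omega> - elem_I2 W ts' b \<omega> = elem_I2 W us c \<omega>" for \<omega>
    unfolding elem_I2_incr_form by (rule diff)
  have 2: "elem_kernel ts a u - elem_kernel ts' b u = elem_kernel us c u" for u
    by (cases u) (simp add: elem_kernel_incr_form so us diff)
  show ?thesis unfolding 1 2 by (rule elem_I2_second_moment[OF W ad])
qed

lemma nn_integral_square_triangle:
  fixes f g h :: "'a \<Rightarrow> real" and k :: "'a \<Rightarrow> ennreal"
  assumes [measurable]: "f \<in> borel_measurable M" "g \<in> borel_measurable M" "h \<in> borel_measurable M" "k \<in> borel_measurable M"
  shows "(\<integral>\<^sup>+ x. ennreal ((f x - h x)\<^sup>2) * k x \<partial>M)
    \<le> 2 * (\<integral>\<^sup>+ x. ennreal ((f x - g x)\<^sup>2) * k x \<partial>M) + 2 * (\<integral>\<^sup>+ x. ennreal ((g x - h x)\<^sup>2) * k x \<partial>M)"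
proof -
  have "(\<integral>\<^sup>+ x. ennreal ((f x - h x)\<^sup>2) * k x \<partial>M)
    \<le> (\<integral>\<^sup>+ x. 2 * (ennreal ((f x - g x)\<^sup>2) * k x) + 2 * (ennreal ((g x - h x)\<^sup>2) * k x) \<partial>M)"
  proof (intro nn_integral_mono)
    fix x
    have "(f x - h x)\<^sup>2 \<le> 2 * (f x - g x)\<^sup>2 + 2 * (g x - h x)\<^sup>2"
      using zero_le_power2[of "(f x - g x) - (g x - h x)"] by (simp add: power2_eq_square algebra_simps)
    then have "ennreal ((f x - h x)\<^sup>2) \<le> ennreal (2 * (f x - g x)\<^sup>2 + 2 * (g x - h x)\<^sup>2)" by (rule ennreal_leI)
    also have "\<dots> = 2 * ennreal ((f x - g x)\<^sup>2) + 2 * ennreal ((g x - h x)\<^sup>2)"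
      by (simp add: ennreal_mult)
    finally have "ennreal ((f x - h x)\<^sup>2) * k x \<le> (2 * ennreal ((f x - g x)\<^sup>2) + 2 * ennreal ((g x - h x)\<^sup>2)) * k x"
      by (rule mult_right_mono) simp
    then show "ennreal ((f x - h x)\<^sup>2) * k x \<le> 2 * (ennreal ((f x - g x)\<^sup>2) * k x) + 2 * (ennreal ((g x - h x)\<^sup>2) * k x)"
      by (simp add: distrib_right mult.assoc)
  qed
  also have "\<dots> = 2 * (\<integral>\<^sup>+ x. ennreal ((f x - g x)\<^sup>2) * k x \<partial>M) + 2 * (\<integral>\<^sup>+ x. ennreal ((g x - h x)\<^sup>2) * k x \<partial>M)"
    by (subst nn_integral_add) (simp_all add: nn_integral_cmult)
  finally show ?thesis .
qed

text \<open>The isometry bound passes to the limit along the sequence that defines \<open>X\<close>.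
  The constant 8 collects two uses of (a+b)^2 \<le> 2a^2 + 2b^2 and the factor 2 of the isometry.
  Nonnegative integrals spare all questions of integrability.\<close>

lemma double_WI_approx:
  assumes W: "std_BM N W" and X: "is_double_WI N W \<psi> X" and a: "elem_admissible ts a"
    and \<psi>: "\<psi> \<in> borel_measurable borel"
  shows "(\<integral>\<^sup>+ \<omega>. ennreal ((X \<omega> - elem_I2 W ts a \<omega>)\<^sup>2) \<partial>N)
    \<le> 8 * (\<integral>\<^sup>+ u. ennreal ((\<psi> u - elem_kernel ts a u)\<^sup>2) * indicator ({0..1} \<times> {0..1}) u \<partial>lborel)"
proof -
  note [measurable] = \<psi> elem_I2_measurable[OF W]
  have sq[measurable]: "indicator ({0..1} \<times> {0..1}) \<in> borel_measurable (borel :: (real \<times> real) measure)"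
    by (intro borel_measurable_indicator borel_Times) auto
  obtain tsq aq where adm: "\<And>n. elem_admissible (tsq n) (aq n)"
    and K: "(\<lambda>n. \<integral>\<^sup>+ u. ennreal ((\<psi> u - elem_kernel (tsq n) (aq n) u)\<^sup>2) * indicator ({0..1} \<times> {0..1}) u \<partial>lborel) \<longlonglongrightarrow> 0"
    and L: "(\<lambda>n. \<integral>\<^sup>+ \<omega>. ennreal ((X \<omega> - elem_I2 W (tsq n) (aq n) \<omega>)\<^sup>2) \<partial>N) \<longlonglongrightarrow> 0"
    and [measurable]: "X \<in> borel_measurable N"
    using X unfolding is_double_WI_def by blast
  let ?k = "\<lambda>n. \<integral>\<^sup>+ u. ennreal ((\<psi> u - elem_kernel (tsq n) (aq n) u)\<^sup>2) * indicator ({0..1} \<times> {0..1}) u \<partial>lborel"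
  let ?l = "\<lambda>n. \<integral>\<^sup>+ \<omega>. ennreal ((X \<omega> - elem_I2 W (tsq n) (aq n) \<omega>)\<^sup>2) \<partial>N"
  let ?K = "\<integral>\<^sup>+ u. ennreal ((\<psi> u - elem_kernel ts a u)\<^sup>2) * indicator ({0..1} \<times> {0..1}) u \<partial>lborel"
  have le: "(\<integral>\<^sup>+ \<omega>. ennreal ((X \<omega> - elem_I2 W ts a \<omega>)\<^sup>2) \<partial>N) \<le> 2 * ?l n + 2 * (2 * (2 * ?k n + 2 * ?K))" for n
  proof -
    have sw: "(x - y)\<^sup>2 = (y - x)\<^sup>2" for x y :: real by (rule power2_commute)
    have "(\<integral>\<^sup>+ \<omega>. ennreal ((X \<omega> - elem_I2 W ts a \<omega>)\<^sup>2) \<partial>N)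
      \<le> 2 * ?l n + 2 * (\<integral>\<^sup>+ \<omega>. ennreal ((elem_I2 W (tsq n) (aq n) \<omega> - elem_I2 W ts a \<omega>)\<^sup>2) \<partial>N)"
      using nn_integral_square_triangle[of X N "elem_I2 W (tsq n) (aq n)" "elem_I2 W ts a" "\<lambda>_. 1"] by simp
    also have "\<dots> \<le> 2 * ?l n + 2 * (2 * (\<integral>\<^sup>+ u. ennreal ((elem_kernel (tsq n) (aq n) u - elem_kernel ts a u)\<^sup>2) * indicator ({0..1} \<times> {0..1}) u \<partial>lborel))"
      by (intro add_left_mono mult_left_mono elem_I2_diff_second_moment[OF W adm a]) simp
    also have "\<dots> \<le> 2 * ?l n + 2 * (2 * (2 * ?k n + 2 * ?K))"
      using nn_integral_square_triangle[of "elem_kernel (tsq n) (aq n)" lborel \<psi> "elem_kernel ts a" "indicator ({0..1} \<times> {0..1})"]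
      by (intro add_left_mono mult_left_mono) (simp_all add: sw[of "elem_kernel (tsq n) (aq n) u" "\<psi> u" for u])
    finally show ?thesis .
  qed
  have "(\<lambda>n. 2 * ?l n + 2 * (2 * (2 * ?k n + 2 * ?K))) \<longlonglongrightarrow> 2 * 0 + 2 * (2 * (2 * 0 + 2 * ?K))"
    by (intro tendsto_add ennreal_tendsto_cmult tendsto_const K L) auto
  then have "(\<integral>\<^sup>+ \<omega>. ennreal ((X \<omega> - elem_I2 W ts a \<omega>)\<^sup>2) \<partial>N) \<le> 2 * 0 + 2 * (2 * (2 * 0 + 2 * ?K))"
    by (rule LIMSEQ_le_const) (use le in auto)
  also have "2 * 0 + 2 * (2 * (2 * 0 + 2 * ?K)) = 8 * ?K" by (simp add: mult.assoc[symmetric])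
  finally show ?thesis .
qed

section \<open>The step kernel on the uniform grid\<close>

definition grid :: "nat \<Rightarrow> real list" where
  "grid n = map (\<lambda>i. real i / real n) [0..<Suc n]"

text \<open>Off the diagonal this is \<open>psi p\<close> at the point (j/n, k/n).\<close>

definition grid_coeff :: "real \<Rightarrow> nat \<Rightarrow> nat \<Rightarrow> nat \<Rightarrow> real" where
  "grid_coeff p n j k = (if j = k then 0 else \<bar>real j - real k\<bar> powr (- p) * real n powr p)"

lemma grid_length: "length (grid n) = Suc n" and grid_nth: "j \<le> n \<Longrightarrow> grid n ! j = real j / real n"
  by (simp_all add: grid_def nth_append del: upt_Suc)

lemma grid_admissible:
  assumes "0 < n" shows "elem_admissible (grid n) (grid_coeff p n)"
  using assms unfolding elem_admissible_def
  by (auto simp: sorted_wrt_iff_nth_less grid_length grid_nth divide_strict_right_mono grid_coeff_def)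
     (auto simp: grid_def divide_simps simp del: upt_Suc)

text \<open>Scaled to unit variance and numbered from 1, to stand in for the variables in
  \<open>S_np\<close>.\<close>

definition BM_incr :: "(real \<Rightarrow> 'b \<Rightarrow> real) \<Rightarrow> nat \<Rightarrow> nat \<Rightarrow> 'b \<Rightarrow> real" where
  "BM_incr W n i \<omega> = sqrt (real n) * (W (real i / real n) \<omega> - W ((real i - 1) / real n) \<omega>)"

text \<open>The two factors \<open>sqrt (real n)\<close> turn the normalisation n^(-(1-p)) into n^p,
  the factor in \<open>grid_coeff\<close>.\<close>

lemma S_np_BM_incr:
  assumes n: "0 < n"
  shows "S_np (BM_incr W n) p n \<omega> = elem_I2 W (grid n) (grid_coeff p n) \<omega>"
proof -
  have pw: "real n powr (- (1 - p)) * real n = real n powr p"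
    using n powr_add[of "real n" "p - 1" 1] by simp
  have "S_np (BM_incr W n) p n \<omega> = real n powr (- (1 - p)) * (\<Sum>i<n. \<Sum>j<n. 
     if i \<noteq> j then \<bar>real i - real j\<bar> powr (- p) * BM_incr W n (Suc i) \<omega> * BM_incr W n (Suc j) \<omega> else 0)"
    unfolding S_np_def by (simp add: sum.atLeast1_atMost_eq del: sum.op_ivl_Suc cong: if_cong)
  also have "\<dots> = (\<Sum>i<n. \<Sum>j<n. grid_coeff p n i j * (W (grid n ! Suc i) \<omega> - W (grid n ! i) \<omega>) * (W (grid n ! Suc j) \<omega> - W (grid n ! j) \<omega>))"
    unfolding sum_distrib_left
  proof (intro sum.cong refl)
    fix i j assume ij: "i \<in> {..<n}" "j \<in> {..<n}"
    let ?a = "W (grid n ! Suc i) \<omega> - W (grid n ! i) \<omega>" and ?b = "W (grid n ! Suc j) \<omega> - W (grid n ! j) \<omega>"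
    have B: "BM_incr W n (Suc i) \<omega> = sqrt (real n) * ?a" "BM_incr W n (Suc j) \<omega> = sqrt (real n) * ?b"
      using ij by (simp_all add: BM_incr_def grid_nth)
    show "real n powr (- (1 - p)) * (if i \<noteq> j then \<bar>real i - real j\<bar> powr (- p) * BM_incr W n (Suc i) \<omega> * BM_incr W n (Suc j) \<omega> else 0)
      = grid_coeff p n i j * ?a * ?b"
    proof (cases "i = j")
      case False
      have e: "real n powr (- (1 - p)) * (k * (sqrt (real n) * a) * (sqrt (real n) * b)) = k * (real n powr (- (1 - p)) * real n) * a * b" for k a b
      proof -
        have e: "real n powr (- (1 - p)) * (k * (sqrt (real n) * a) * (sqrt (real n) * b))
          = real n powr (- (1 - p)) * (sqrt (real n) * sqrt (real n)) * k * a * b" by (simp only: mult_ac)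
        then show ?thesis by (simp only: real_sqrt_mult_self abs_of_nat mult_ac)
      qed
      show ?thesis using False by (simp only: B e pw grid_coeff_def if_False if_True simp_thms)
    qed (simp add: grid_coeff_def)
  qed
  finally show ?thesis by (simp add: elem_I2_def grid_length)
qed

lemma grid_kernel_value:
  assumes n: "0 < n" and s: "0 \<le> s" "s < 1" and t: "0 \<le> t" "t < 1"
  shows "elem_kernel (grid n) a (s, t) = a (nat \<lfloor>real n * s\<rfloor>) (nat \<lfloor>real n * t\<rfloor>)"
proof -
  have ind: "indicator {grid n ! j..<grid n ! Suc j} s = (of_bool (j = nat \<lfloor>real n * s\<rfloor>) :: real)"
    if "j < n" "0 \<le> s" for j s
  proof -
    have "s \<in> {grid n ! j..<grid n ! Suc j} \<longleftrightarrow> real j \<le> real n * s \<and> real n * s < real j + 1"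
      using n that by (auto simp: grid_nth field_simps)
    also have "\<dots> \<longleftrightarrow> \<lfloor>real n * s\<rfloor> = int j" by (simp add: floor_eq_iff)
    also have "\<dots> \<longleftrightarrow> j = nat \<lfloor>real n * s\<rfloor>" using that by (auto simp: nat_eq_iff)
    finally show ?thesis by (simp add: indicator_def)
  qed
  have lt: "nat \<lfloor>real n * s\<rfloor> < n" if "0 \<le> s" "s < 1" for s
  proof -
    have "real n * s < real n" using that n by simp
    then show ?thesis using that by (simp add: nat_less_iff floor_less_iff)
  qed
  have "elem_kernel (grid n) a (s, t) = (\<Sum>j<n. \<Sum>k<n. a j k * of_bool (j = nat \<lfloor>real n * s\<rfloor>) * of_bool (k = nat \<lfloor>real n * t\<rfloor>))"
    unfolding elem_kernel_def prod.case grid_length using s t by (intro sum.cong) (auto simp: ind)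
  also have "\<dots> = (\<Sum>j<n. \<Sum>k<n. if k = nat \<lfloor>real n * t\<rfloor> then a j k * of_bool (j = nat \<lfloor>real n * s\<rfloor>) else 0)"
    by (intro sum.cong refl) auto
  also have "\<dots> = (\<Sum>j<n. if j = nat \<lfloor>real n * s\<rfloor> then a j (nat \<lfloor>real n * t\<rfloor>) else 0)"
    using lt[of t] t by (intro sum.cong refl) (simp add: sum.delta)
  also have "\<dots> = a (nat \<lfloor>real n * s\<rfloor>) (nat \<lfloor>real n * t\<rfloor>)"
    using lt[of s] s by (simp add: sum.delta)
  finally show ?thesis .
qed

text \<open>Two bounds to be interpolated: a crude one for points near the diagonal, and the mean
  value theorem on \<open>[d / 2, \<infinity>)\<close> for points away from it. The constant 4 is
  2^2: halving the base multiplies a negative power of order at most 2 by no more than that.\<close>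

lemma powr_neg_diff_bound:
  fixes d D p :: real
  assumes p: "0 < p" "p < 1" and d: "0 < d" "d / 2 \<le> D"
  shows "\<bar>d powr (- p) - D powr (- p)\<bar> \<le> 4 * d powr (- p)"
    and "\<bar>d powr (- p) - D powr (- p)\<bar> \<le> 4 * \<bar>d - D\<bar> * d powr (- p - 1)"
proof -
  have D: "0 < D" using d by linarith
  have two: "(d / 2) powr (- r) \<le> 4 * d powr (- r)" if "0 < r" "r \<le> 2" for r
  proof -
    have "(d / 2) powr (- r) = d powr (- r) * 2 powr r"
      using d by (simp add: powr_divide powr_minus divide_simps)
    also have "\<dots> \<le> d powr (- r) * 2 powr 2" using that by (intro mult_left_mono powr_mono) auto
    finally show ?thesis by simp
  qed
  have Dd: "D powr (- p) \<le> 4 * d powr (- p)"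
    using order_trans[OF powr_mono2'[of "- p" "d / 2" D] two[of p]] d p by simp
  have "0 \<le> d powr (- p)" "0 \<le> D powr (- p)" by simp_all
  then show "\<bar>d powr (- p) - D powr (- p)\<bar> \<le> 4 * d powr (- p)" using Dd by linarith
  have der: "((\<lambda>x. x powr (- p)) has_real_derivative (- p) * x powr (- p - 1)) (at x within {d / 2..})" if "x \<in> {d / 2..}" for x
  proof -
    have "0 < x" using that d by simp
    from has_field_derivative_at_within[OF has_real_derivative_powr[OF this, of "- p"]] show ?thesis by simp
  qed
  have "\<bar>d powr (- p) - D powr (- p)\<bar> \<le> (4 * d powr (- p - 1)) * \<bar>d - D\<bar>"
    unfolding real_norm_def[symmetric]
  proof (rule field_differentiable_bound[OF _ der])
    show "convex {d / 2..}" by simp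
    show "d \<in> {d / 2..}" "D \<in> {d / 2..}" using d by auto
    fix x assume x: "x \<in> {d / 2..}"
    have "\<bar>- p * x powr (- p - 1)\<bar> = p * x powr (- (p + 1))" using p by (simp add: abs_mult)
    also have "\<dots> \<le> 1 * x powr (- (p + 1))" using p by (intro mult_right_mono) auto
    also have "\<dots> \<le> (d / 2) powr (- (p + 1))" using powr_mono2'[of "- (p + 1)" "d / 2" x] x d p by simp
    also have "\<dots> \<le> 4 * d powr (- (p + 1))" by (rule two) (use p in auto)
    finally show "norm (- p * x powr (- p - 1)) \<le> 4 * d powr (- p - 1)" by simp
  qed auto
  then show "\<bar>d powr (- p) - D powr (- p)\<bar> \<le> 4 * \<bar>d - D\<bar> * d powr (- p - 1)" by (simp add: mult_ac)
qed

text \<open>With y = 1/(n|s-t|) the error is at most 4|s-t|^(-p) min(1,y), and min(1,y) \<le> y^b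
  for 0 \<le> b \<le> 1. The exponent b trades a stronger singularity on the diagonal for a power of
  n.\<close>

lemma grid_kernel_error:
  assumes n: "0 < n" and p: "0 < p" "p < 1 / 2" and s: "0 \<le> s" "s < 1" and t: "0 \<le> t" "t < 1"
  shows "(psi p (s, t) - elem_kernel (grid n) (grid_coeff p n) (s, t))\<^sup>2
    \<le> 16 * real n powr (- (1 - 2 * p) / 2) * \<bar>s - t\<bar> powr (- (1 - (1 - 2 * p) / 2))"
proof -
  let ?j = "nat \<lfloor>real n * s\<rfloor>" and ?k = "nat \<lfloor>real n * t\<rfloor>"
  let ?d = "\<bar>s - t\<bar>" and ?D = "\<bar>real ?j - real ?k\<bar> / real n"
  have K: "elem_kernel (grid n) (grid_coeff p n) (s, t) = grid_coeff p n ?j ?k"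
    by (rule grid_kernel_value[OF n s t])
  show ?thesis
  proof (cases "s = t")
    \<comment> \<open>Both kernels vanish on the diagonal: \<open>0 powr (- p)\<close> is 0.\<close>
    case True
    then show ?thesis unfolding K by (simp add: psi_def grid_coeff_def)
  next
    case False
    then have d: "0 < ?d" by simp
    have fl: "real (nat \<lfloor>real n * x\<rfloor>) \<le> real n * x" "real n * x < real (nat \<lfloor>real n * x\<rfloor>) + 1" if "0 \<le> x" for x
      using that by (auto simp: of_nat_nat floor_correct)
    \<comment> \<open>Rounding down moves each of n s and n t by an amount in [0,1), hence their
      difference by at most 1.\<close>
    have dD: "\<bar>?d - ?D\<bar> \<le> 1 / real n"
    proof -
      have "\<bar>(real ?j - real ?k) - (real n * s - real n * t)\<bar> \<le> 1" using fl[OF s(1)] fl[OF t(1)] by linarith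
      then have "\<bar>\<bar>real ?j - real ?k\<bar> - \<bar>real n * s - real n * t\<bar>\<bar> \<le> 1" by linarith
      also have "\<bar>real n * s - real n * t\<bar> = real n * ?d" by (simp add: abs_mult right_diff_distrib[symmetric])
      finally have "\<bar>real n * ?d - \<bar>real ?j - real ?k\<bar>\<bar> \<le> 1" by (simp only: abs_minus_commute)
      moreover have "real n * \<bar>x - y / real n\<bar> = \<bar>real n * x - y\<bar>" for x y
      proof -
        have "real n * \<bar>x - y / real n\<bar> = \<bar>real n * (x - y / real n)\<bar>" by (simp add: abs_mult)
        then show ?thesis using n by (simp add: right_diff_distrib)
      qed
      ultimately have "real n * \<bar>?d - ?D\<bar> \<le> 1" by (simp only:)
      then show ?thesis using n by (simp add: field_simps)
    qed
    let ?e = "\<bar>psi p (s, t) - elem_kernel (grid n) (grid_coeff p n) (s, t)\<bar>"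
    have main: "?e \<le> 4 * ?d powr (- p) \<and> ?e \<le> 4 * ?d powr (- p) * (1 / (real n * ?d))"
    proof (cases "?j = ?k")
      case True
      then have e: "?e = ?d powr (- p)" unfolding K by (simp add: psi_def grid_coeff_def)
      have "?d \<le> 1 / real n" using dD True by simp
      then have "1 \<le> 1 / (real n * ?d)" using n d by (simp add: field_simps)
      then have "?d powr (- p) * 1 \<le> ?d powr (- p) * (1 / (real n * ?d))" by (intro mult_left_mono) auto
      moreover have "0 \<le> ?d powr (- p)" by simp
      ultimately show ?thesis unfolding e by linarith
    next
      case False
      then have "1 \<le> \<bar>real ?j - real ?k\<bar>" by linarith
      then have "1 / real n \<le> ?D" using n by (simp add: divide_right_mono)
      \<comment> \<open>In different cells D is at least 1/n, the bound on the rounding error, so d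
        \<le> D + 1/n \<le> 2D.\<close>
      have half: "k \<le> D \<Longrightarrow> \<bar>d - D\<bar> \<le> k \<Longrightarrow> d / 2 \<le> D" for k d D :: real by linarith
      have D2: "?d / 2 \<le> ?D" by (rule half[OF \<open>1 / real n \<le> ?D\<close> dD])
      have "grid_coeff p n ?j ?k = ?D powr (- p)"
        using False n by (simp add: grid_coeff_def powr_divide powr_minus divide_simps)
      then have e: "?e = \<bar>?d powr (- p) - ?D powr (- p)\<bar>" unfolding K by (simp add: psi_def)
      have p1: "p < 1" using p by simp
      have "?e \<le> 4 * \<bar>?d - ?D\<bar> * ?d powr (- p - 1)"
        unfolding e by (rule powr_neg_diff_bound(2)[OF p(1) p1 d D2])
      also have "\<dots> \<le> 4 * (1 / real n) * ?d powr (- p - 1)" using dD by (intro mult_right_mono mult_left_mono) auto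
      also have "?d powr (- p - 1) = ?d powr (- p) * (1 / ?d)"
        using d powr_add[of ?d "- p" "- 1"] by (simp add: powr_minus_divide)
      finally have "?e \<le> 4 * ?d powr (- p) * (1 / (real n * ?d))" by simp
      then show ?thesis using powr_neg_diff_bound(1)[OF p(1) p1 d D2] unfolding e by blast
    qed
    \<comment> \<open>Half of the available room: 2p + 2b is midway between 2p and 1, so the squared
      error keeps an integrable singularity.\<close>
    define b where "b = (1 - 2 * p) / 4"
    have b: "0 \<le> b" "b \<le> 1" using p by (auto simp: b_def)
    define y where "y = 1 / (real n * ?d)"
    have y: "0 < y" using n d by (simp add: y_def)
    have le: "?e \<le> 4 * ?d powr (- p) * y powr b"
    proof (cases "y \<le> 1")
      case True
      then have "y powr 1 \<le> y powr b" using b y by (intro powr_mono') auto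
      then have "4 * ?d powr (- p) * y \<le> 4 * ?d powr (- p) * y powr b" using y by (intro mult_left_mono) auto
      then show ?thesis using main by (simp add: y_def)
    next
      case False
      then have "1 \<le> y powr b" using b by (simp add: ge_one_powr_ge_zero)
      then have "4 * ?d powr (- p) * 1 \<le> 4 * ?d powr (- p) * y powr b" by (intro mult_left_mono) auto
      then show ?thesis using main by simp
    qed
    have "(psi p (s, t) - elem_kernel (grid n) (grid_coeff p n) (s, t))\<^sup>2 = ?e\<^sup>2" by simp
    also have "\<dots> \<le> (4 * ?d powr (- p) * y powr b)\<^sup>2" by (rule power_mono[OF le]) simp
    also have "\<dots> = 16 * (?d powr (- p) * ?d powr (- p)) * (y powr b * y powr b)" by (simp add: power2_eq_square)
    also have "\<dots> = 16 * ?d powr (- 2 * p) * y powr (2 * b)" by (simp add: powr_add[symmetric])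
    also have "y powr (2 * b) = real n powr (- 2 * b) * ?d powr (- 2 * b)"
      using n d by (simp add: y_def powr_divide powr_mult powr_minus divide_simps)
    also have "16 * ?d powr (- 2 * p) * (real n powr (- 2 * b) * ?d powr (- 2 * b))
       = 16 * real n powr (- 2 * b) * (?d powr (- 2 * p) * ?d powr (- 2 * b))" by (simp only: mult_ac)
    also have "?d powr (- 2 * p) * ?d powr (- 2 * b) = ?d powr (- 2 * p - 2 * b)"
      by (simp add: powr_add[symmetric])
    also have "- 2 * p - 2 * b = - (1 - (1 - 2 * p) / 2)" by (simp add: b_def field_simps)
    also have "- 2 * b = - (1 - 2 * p) / 2" by (simp add: b_def)
    finally show ?thesis .
  qed
qed

text \<open>Splitting at \<open>t = s\<close> and translating or reflecting, each half is dominated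
  by the integral of v^(-g) over [0,1].\<close>

lemma nn_integral_abs_powr:
  assumes g: "0 < g" "g < 1" and s: "s \<in> {0..1}"
  shows "(\<integral>\<^sup>+ t. ennreal (\<bar>s - t\<bar> powr (- g)) * indicator {0..1} t \<partial>lborel) \<le> ennreal (2 / (1 - g))"
proof -
  let ?h = "\<lambda>v. ennreal (indicator {0..1} v * v powr (- g))"
  have "((\<lambda>x. x powr (- g)) has_integral (1 powr (- g + 1) / (- g + 1))) {0..1}"
    using g by (intro has_integral_powr_from_0) auto
  then have h: "(\<integral>\<^sup>+ v. ?h v \<partial>lborel) = ennreal (1 / (1 - g))"
    using g by (subst nn_integral_has_integral_lebesgue) auto
  have hm[measurable]: "?h \<in> borel_measurable borel" by measurable
  have "(\<integral>\<^sup>+ t. ennreal (\<bar>s - t\<bar> powr (- g)) * indicator {0..1} t \<partial>lborel) \<le> (\<integral>\<^sup>+ t. ?h (- s + 1 * t) + ?h (s + (- 1) * t) \<partial>lborel)"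
  proof (intro nn_integral_mono)
    fix t
    show "ennreal (\<bar>s - t\<bar> powr (- g)) * indicator {0..1} t \<le> ?h (- s + 1 * t) + ?h (s + (- 1) * t)"
    proof (cases "t \<in> {0..1}")
      case True
      show ?thesis
      proof (cases "s \<le> t")
        case le: True
        then have "\<bar>s - t\<bar> = - s + 1 * t" "- s + 1 * t \<in> {0..1}" using s True by auto
        then show ?thesis using True by (simp add: add_increasing2)
      next
        case False
        then have "\<bar>s - t\<bar> = s + (- 1) * t" "s + (- 1) * t \<in> {0..1}" using s True by auto
        then show ?thesis using True by (simp add: add_increasing)
      qed
    qed simp
  qed
  also have "\<dots> = (\<integral>\<^sup>+ t. ?h (- s + 1 * t) \<partial>lborel) + (\<integral>\<^sup>+ t. ?h (s + (- 1) * t) \<partial>lborel)"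
    by (rule nn_integral_add) measurable
  also have "(\<integral>\<^sup>+ t. ?h (- s + 1 * t) \<partial>lborel) = (\<integral>\<^sup>+ v. ?h v \<partial>lborel)"
    using nn_integral_real_affine[of ?h 1 "- s", OF hm] by simp
  also have "(\<integral>\<^sup>+ t. ?h (s + (- 1) * t) \<partial>lborel) = (\<integral>\<^sup>+ v. ?h v \<partial>lborel)"
    using nn_integral_real_affine[of ?h "- 1" s, OF hm] by simp
  also have "(\<integral>\<^sup>+ v. ?h v \<partial>lborel) + (\<integral>\<^sup>+ v. ?h v \<partial>lborel) = ennreal (2 / (1 - g))"
    unfolding h using g by (subst ennreal_plus[symmetric]) auto
  finally show ?thesis .
qed

lemma psi_measurable [measurable]: "psi p \<in> borel_measurable borel"
  unfolding psi_def case_prod_beta' borel_prod[symmetric] by measurable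

lemma grid_kernel_L2_error:
  assumes n: "0 < n" and p: "0 < p" "p < 1 / 2"
  shows "(\<integral>\<^sup>+ u. ennreal ((psi p u - elem_kernel (grid n) (grid_coeff p n) u)\<^sup>2) * indicator ({0..1} \<times> {0..1}) u \<partial>lborel)
    \<le> ennreal (64 / (1 - 2 * p) * real n powr (- (1 - 2 * p) / 2))"
proof -
  define g where "g = 1 - (1 - 2 * p) / 2"
  have g: "0 < g" "g < 1" using p by (auto simp: g_def)
  let ?c = "16 * real n powr (- (1 - 2 * p) / 2)"
  let ?E = "\<lambda>u. ennreal ((psi p u - elem_kernel (grid n) (grid_coeff p n) u)\<^sup>2) * indicator ({0..1} \<times> {0..1}) u"
  have [measurable]: "indicator ({0..1} \<times> {0..1}) \<in> borel_measurable (borel :: (real \<times> real) measure)"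
    by (intro borel_measurable_indicator borel_Times) auto
  have Em: "?E \<in> borel_measurable (lborel \<Otimes>\<^sub>M lborel)" unfolding lborel_prod by measurable
  have "(\<integral>\<^sup>+ u. ?E u \<partial>lborel) = (\<integral>\<^sup>+ s. \<integral>\<^sup>+ t. ?E (s, t) \<partial>lborel \<partial>lborel)"
    using lborel.nn_integral_fst[OF Em] unfolding lborel_prod by simp
  also have "\<dots> \<le> (\<integral>\<^sup>+ (s::real). ennreal (?c * (2 / (1 - g))) * indicator {0..1} s \<partial>lborel)"
  proof (rule nn_integral_mono_AE)
    \<comment> \<open>The cells are half-open, so the pointwise bound is available for
      \<open>s < 1\<close> and \<open>t < 1\<close>; the excluded points are null sets.\<close>
    have "AE s in lborel. s \<noteq> (1::real)" by (rule AE_lborel_singleton)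
    then show "AE s in lborel. (\<integral>\<^sup>+ t. ?E (s, t) \<partial>lborel) \<le> ennreal (?c * (2 / (1 - g))) * indicator {0..1} s"
    proof eventually_elim
      case (elim s)
      show ?case
      proof (cases "s \<in> {0..1}")
        case True
        have "(\<integral>\<^sup>+ t. ?E (s, t) \<partial>lborel) \<le> (\<integral>\<^sup>+ t. ennreal ?c * (ennreal (\<bar>s - t\<bar> powr (- g)) * indicator {0..1} t) \<partial>lborel)"
        proof (rule nn_integral_mono_AE)
          have "AE t in lborel. t \<noteq> (1::real)" by (rule AE_lborel_singleton)
          then show "AE t in lborel. ?E (s, t) \<le> ennreal ?c * (ennreal (\<bar>s - t\<bar> powr (- g)) * indicator {0..1} t)"
          proof eventually_elim
            case t: (elim t)
            show ?case
            proof (cases "t \<in> {0..1}")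
              case t1: True
              have "(psi p (s, t) - elem_kernel (grid n) (grid_coeff p n) (s, t))\<^sup>2 \<le> ?c * \<bar>s - t\<bar> powr (- g)"
                unfolding g_def using True t1 t elim by (intro grid_kernel_error[OF n p]) auto
              then have "ennreal ((psi p (s, t) - elem_kernel (grid n) (grid_coeff p n) (s, t))\<^sup>2) \<le> ennreal ?c * ennreal (\<bar>s - t\<bar> powr (- g))"
                by (subst ennreal_mult[symmetric]) (auto intro!: ennreal_leI)
              then show ?thesis using True t1 by simp
            qed simp
          qed
        qed
        also have "\<dots> = ennreal ?c * (\<integral>\<^sup>+ t. ennreal (\<bar>s - t\<bar> powr (- g)) * indicator {0..1} t \<partial>lborel)"
          by (rule nn_integral_cmult) measurable
        also have "\<dots> \<le> ennreal ?c * ennreal (2 / (1 - g))"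
          by (intro mult_left_mono nn_integral_abs_powr[OF g True]) simp
        also have "\<dots> = ennreal (?c * (2 / (1 - g)))" using g by (subst ennreal_mult) auto
        finally show ?thesis using True by simp
      next
        case False
        then have "indicator ({0..1} \<times> {0..1}) (s, t) = (0 :: ennreal)" for t :: real
          by (auto simp: indicator_def)
        then show ?thesis by simp
      qed
    qed
  qed
  also have "\<dots> = ennreal (?c * (2 / (1 - g)))"
    by (subst nn_integral_cmult_indicator) auto
  also have "?c * (2 / (1 - g)) = 64 / (1 - 2 * p) * real n powr (- (1 - 2 * p) / 2)"
    using p by (simp add: g_def field_simps)
  finally show ?thesis .
qed

lemma S_np_BM_L2_error:
  assumes W: "std_BM N W" and X: "is_double_WI N W (psi p) X" and n: "0 < n" and p: "0 < p" "p < 1 / 2"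
  shows "(\<integral>\<^sup>+ \<omega>. ennreal ((X \<omega> - S_np (BM_incr W n) p n \<omega>)\<^sup>2) \<partial>N)
    \<le> ennreal (512 / (1 - 2 * p) * real n powr (- (1 - 2 * p) / 2))"
proof -
  have "(\<integral>\<^sup>+ \<omega>. ennreal ((X \<omega> - S_np (BM_incr W n) p n \<omega>)\<^sup>2) \<partial>N)
    \<le> 8 * (\<integral>\<^sup>+ u. ennreal ((psi p u - elem_kernel (grid n) (grid_coeff p n) u)\<^sup>2) * indicator ({0..1} \<times> {0..1}) u \<partial>lborel)"
    unfolding S_np_BM_incr[OF n] by (rule double_WI_approx[OF W X grid_admissible[OF n] psi_measurable])
  also have "\<dots> \<le> 8 * ennreal (64 / (1 - 2 * p) * real n powr (- (1 - 2 * p) / 2))"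
    by (intro mult_left_mono grid_kernel_L2_error[OF n p]) simp
  also have "\<dots> = ennreal (8 * (64 / (1 - 2 * p) * real n powr (- (1 - 2 * p) / 2)))"
    using p by (subst ennreal_mult) auto
  finally show ?thesis by simp
qed

section \<open>The two distances\<close>

text \<open>Serves to number the variables from 0, with \<open>f = Suc\<close>. A family of events
  over \<open>J\<close> is carried to the image of \<open>J\<close> through the inverse of
  \<open>f\<close>, where independence is known.\<close>

lemma (in prob_space) indep_vars_reindex_inj:
  assumes ind: "indep_vars (\<lambda>_. borel) X (f ` I)" and f: "inj_on f I"
  shows "indep_vars (\<lambda>_. borel) (\<lambda>i. X (f i)) I"
proof -
  let ?S = "\<lambda>i. {X i -` A \<inter> space M | A. A \<in> sets borel}"
  have rv: "\<forall>i\<in>I. random_variable borel (X (f i))" and ids: "indep_sets ?S (f ` I)"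
    using ind unfolding indep_vars_def2 by auto
  have "indep_sets (\<lambda>i. ?S (f i)) I"
    unfolding indep_sets_def
  proof (intro conjI ballI allI impI)
    fix i assume "i \<in> I"
    then show "?S (f i) \<subseteq> events" using ids unfolding indep_sets_def by blast
  next
    fix J A assume J: "J \<subseteq> I" "J \<noteq> {}" "finite J" and A: "A \<in> Pi J (\<lambda>i. ?S (f i))"
    let ?g = "the_inv_into J f"
    have fJ: "inj_on f J" using f J inj_on_subset by blast
    have g: "?g (f j) = j" if "j \<in> J" for j using fJ that by (rule the_inv_into_f_f)
    have "prob (\<Inter>k\<in>f ` J. A (?g k)) = (\<Prod>k\<in>f ` J. prob (A (?g k)))"
    proof -
      have "(\<lambda>k. A (?g k)) \<in> Pi (f ` J) ?S"
      proof (rule Pi_I)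
        fix k assume "k \<in> f ` J"
        then obtain j where j: "j \<in> J" "k = f j" by blast
        have "A j \<in> ?S (f j)" using A j(1) by (rule Pi_mem)
        then show "A (?g k) \<in> ?S k" using j g by simp
      qed
      moreover have "f ` J \<subseteq> f ` I" "f ` J \<noteq> {}" "finite (f ` J)" using J by auto
      ultimately show ?thesis using ids unfolding indep_sets_def by blast
    qed
    moreover have "(\<Inter>k\<in>f ` J. A (?g k)) = (\<Inter>j\<in>J. A j)" using g by auto
    moreover have "(\<Prod>k\<in>f ` J. prob (A (?g k))) = (\<Prod>j\<in>J. prob (A j))"
      using g by (subst prod.reindex[OF fJ]) (auto intro!: prod.cong)
    ultimately show "prob (\<Inter>j\<in>J. A j) = (\<Prod>j\<in>J. prob (A j))" by simp
  qed
  then show ?thesis using rv unfolding indep_vars_def2 by blast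
qed

section \<open>Size of the coefficients\<close>

definition kcoeff :: "real \<Rightarrow> nat \<Rightarrow> nat \<Rightarrow> nat \<Rightarrow> real" where
  "kcoeff p n i j = (if i \<noteq> j then real n powr (- (1 - p)) * \<bar>real i - real j\<bar> powr (- p) else 0)"

lemma S_np_qform: "S_np Z p n \<omega> = qform (kcoeff p n) {..<n} (\<lambda>i. Z (Suc i) \<omega>)"
proof -
  have "S_np Z p n \<omega> = real n powr (- (1 - p)) * (\<Sum>i<n. \<Sum>j<n.
     if i \<noteq> j then \<bar>real i - real j\<bar> powr (- p) * Z (Suc i) \<omega> * Z (Suc j) \<omega> else 0)"
    unfolding S_np_def by (simp add: sum.atLeast1_atMost_eq del: sum.op_ivl_Suc cong: if_cong)
  also have "\<dots> = qform (kcoeff p n) {..<n} (\<lambda>i. Z (Suc i) \<omega>)"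
    unfolding qform_def sum_distrib_left by (intro sum.cong refl) (simp add: kcoeff_def)
  finally show ?thesis .
qed

lemma kcoeff_sym: "kcoeff p n j i = kcoeff p n i j" and kcoeff_diag: "kcoeff p n i i = 0"
  by (auto simp: kcoeff_def abs_minus_commute)

text \<open>Distances are at most n and the power is decreasing, so each coefficient is at least
  n^(-(1-p)) n^(-p) = 1/n. This supplies the lower bound on \<open>q\<close> in the regularity
  estimate.\<close>

lemma kcoeff_ge:
  assumes "0 < p" "i < n" "j < n" "i \<noteq> j"
  shows "1 / real n \<le> kcoeff p n i j"
proof -
  have n: "0 < real n" using assms by auto
  have d: "0 < \<bar>real i - real j\<bar>" "\<bar>real i - real j\<bar> \<le> real n" using assms by auto
  have "1 / real n = real n powr (- (1 - p)) * real n powr (- p)"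
    using n powr_add[of "real n" "- (1 - p)" "- p"] by (simp add: powr_minus_divide)
  also have "\<dots> \<le> real n powr (- (1 - p)) * \<bar>real i - real j\<bar> powr (- p)"
    using d assms by (intro mult_left_mono powr_mono2') auto
  finally show ?thesis using assms by (simp add: kcoeff_def)
qed

text \<open>Comparison with the integral of x^(-s), carried out step by step with the mean value
  theorem; at 0 the power is 0 by convention, which starts the induction.\<close>

lemma sum_powr_neg_le:
  assumes s: "0 < s" "s < 1"
  shows "(\<Sum>k=1..n. real k powr (- s)) \<le> real n powr (1 - s) / (1 - s)"
proof (induction n)
  case (Suc n)
  have "(1 - s) * real (Suc n) powr (- s) \<le> real (Suc n) powr (1 - s) - real n powr (1 - s)"
  proof (cases "n = 0")
    case False
    have "\<exists>z. real n < z \<and> z < real (Suc n) \<and> real (Suc n) powr (1 - s) - real n powr (1 - s)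
      = (real (Suc n) - real n) * ((1 - s) * z powr (1 - s - 1))"
    proof (intro MVT2)
      fix x assume "real n \<le> x"
      then have "0 < x" using False by linarith
      then show "((\<lambda>a. a powr (1 - s)) has_real_derivative (1 - s) * x powr (1 - s - 1)) (at x)"
        by (rule has_real_derivative_powr)
    qed simp
    then obtain z where z: "real n < z" "z < real (Suc n)"
      "real (Suc n) powr (1 - s) - real n powr (1 - s) = (1 - s) * z powr (- s)" by auto
    have "real (Suc n) powr (- s) \<le> z powr (- s)" using z s by (intro powr_mono2') auto
    then show ?thesis unfolding z(3) using s by (intro mult_left_mono) auto
  qed (use s in simp)
  then have "real (Suc n) powr (- s) \<le> (real (Suc n) powr (1 - s) - real n powr (1 - s)) / (1 - s)"
    using s by (simp add: field_simps)
  then show ?case using Suc s by (simp add: diff_divide_distrib)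
qed simp

text \<open>The influence of one variable. Each side of the diagonal contributes at most the sum of
  k^(-2p), of order n^(1-2p) because 2p < 1; the squared normalisation n^(-(2-2p)) leaves 1/n. The
  bound is written as a square in order to serve as \<open>\<tau>\<^sup>2\<close>.\<close>

lemma kcoeff_row_sum:
  assumes p: "0 < p" "p < 1 / 2" and i: "i < n"
  shows "(\<Sum>j<n. (2 * kcoeff p n i j)\<^sup>2) \<le> (sqrt (8 / ((1 - 2 * p) * real n)))\<^sup>2"
proof -
  have n: "0 < real n" using i by auto
  let ?f = "\<lambda>k. real k powr (- (2 * p))"
  let ?H = "\<Sum>k=1..n. ?f k"
  have sq: "(\<bar>real i - real j\<bar> powr (- p))\<^sup>2 = \<bar>real i - real j\<bar> powr (- (2 * p))" for j
    by (simp add: power2_eq_square powr_add[symmetric])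
  have sqn: "(real n powr (- (1 - p)))\<^sup>2 = real n powr (- (2 * (1 - p)))"
    by (simp add: power2_eq_square powr_add[symmetric])
  have c2: "(2 * kcoeff p n i j)\<^sup>2 = 4 * real n powr (- (2 * (1 - p))) * (if i \<noteq> j then \<bar>real i - real j\<bar> powr (- (2 * p)) else 0)" for j
  proof (cases "i = j")
    case False
    then have "(2 * kcoeff p n i j)\<^sup>2 = 4 * (real n powr (- (1 - p)))\<^sup>2 * (\<bar>real i - real j\<bar> powr (- p))\<^sup>2"
      by (simp add: kcoeff_def power_mult_distrib)
    then show ?thesis using False unfolding sq sqn by simp
  qed (simp add: kcoeff_def)
  have split: "(\<Sum>j<n. if i \<noteq> j then \<bar>real i - real j\<bar> powr (- (2 * p)) else 0)
    = (\<Sum>j\<in>{..<i}. \<bar>real i - real j\<bar> powr (- (2 * p))) + (\<Sum>j\<in>{i<..<n}. \<bar>real i - real j\<bar> powr (- (2 * p)))"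
  proof -
    have "(\<Sum>j<n. if i \<noteq> j then \<bar>real i - real j\<bar> powr (- (2 * p)) else 0)
      = (\<Sum>j\<in>{..<i} \<union> {i<..<n}. \<bar>real i - real j\<bar> powr (- (2 * p)))"
      using i by (intro sum.mono_neutral_cong_right) auto
    then show ?thesis by (subst (asm) sum.union_disjoint) auto
  qed
  have lower: "(\<Sum>j\<in>{..<i}. \<bar>real i - real j\<bar> powr (- (2 * p))) \<le> ?H"
  proof -
    have "(\<Sum>j\<in>{..<i}. \<bar>real i - real j\<bar> powr (- (2 * p))) = (\<Sum>j\<in>{..<i}. ?f (i - j))"
      by (intro sum.cong) (auto simp: of_nat_diff)
    also have "\<dots> = (\<Sum>k\<in>(\<lambda>j. i - j) ` {..<i}. ?f k)"
      by (subst sum.reindex) (auto simp: inj_on_def)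
    also have "\<dots> \<le> ?H" using i by (intro sum_mono2) auto
    finally show ?thesis .
  qed
  have upper: "(\<Sum>j\<in>{i<..<n}. \<bar>real i - real j\<bar> powr (- (2 * p))) \<le> ?H"
  proof -
    have "(\<Sum>j\<in>{i<..<n}. \<bar>real i - real j\<bar> powr (- (2 * p))) = (\<Sum>j\<in>{i<..<n}. ?f (j - i))"
      by (intro sum.cong) (auto simp: of_nat_diff)
    also have "\<dots> = (\<Sum>k\<in>(\<lambda>j. j - i) ` {i<..<n}. ?f k)"
      by (subst sum.reindex) (auto simp: inj_on_def)
    also have "\<dots> \<le> ?H" by (intro sum_mono2) auto
    finally show ?thesis .
  qed
  have H: "(\<Sum>j<n. if i \<noteq> j then \<bar>real i - real j\<bar> powr (- (2 * p)) else 0) \<le> 2 * ?H"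
    using lower upper unfolding split by linarith
  have "(\<Sum>j<n. (2 * kcoeff p n i j)\<^sup>2) \<le> 4 * real n powr (- (2 * (1 - p))) * (2 * ?H)"
    unfolding c2 sum_distrib_left[symmetric] using H by (intro mult_left_mono) auto
  also have "\<dots> \<le> 4 * real n powr (- (2 * (1 - p))) * (2 * (real n powr (1 - 2 * p) / (1 - 2 * p)))"
    using sum_powr_neg_le[of "2 * p" n] p by (intro mult_left_mono) auto
  also have "\<dots> = 8 / (1 - 2 * p) * (real n powr (- (2 * (1 - p))) * real n powr (1 - 2 * p))" by simp
  also have "real n powr (- (2 * (1 - p))) * real n powr (1 - 2 * p) = 1 / real n"
    using n powr_add[of "real n" "- (2 * (1 - p))" "1 - 2 * p"] by (simp add: powr_minus_divide algebra_simps)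
  also have "8 / (1 - 2 * p) * (1 / real n) = (sqrt (8 / ((1 - 2 * p) * real n)))\<^sup>2"
    using p n by simp
  finally show ?thesis .
qed

section \<open>Laws of the sums and comparison with Brownian motion\<close>

lemma (in prob_space) expectation_S_np:
  fixes f :: "real \<Rightarrow> real"
  assumes X: "\<And>i. Y i \<in> borel_measurable M" and ind: "indep_vars (\<lambda>_. borel) (\<lambda>i. Y (Suc i)) {..<n}"
    and law: "\<And>i. i < n \<Longrightarrow> distr M borel (Y (Suc i)) = \<mu> i" and n: "0 < n" and f: "f \<in> borel_measurable borel"
  shows "expectation (\<lambda>\<omega>. f (S_np Y p n \<omega>)) = (\<integral>x. f (qform (kcoeff p n) {..<n} x) \<partial>PiM {..<n} \<mu>)"
proof -
  note [measurable] = X f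
  have "distr M (\<Pi>\<^sub>M i\<in>{..<n}. borel) (\<lambda>x. \<lambda>i\<in>{..<n}. Y (Suc i) x) = (\<Pi>\<^sub>M i\<in>{..<n}. distr M borel (Y (Suc i)))"
    using ind n by (subst (asm) indep_vars_iff_distr_eq_PiM) (auto simp: lessThan_empty_iff)
  also have "\<dots> = PiM {..<n} \<mu>" by (intro PiM_cong) (auto simp: law)
  finally have L: "distr M (\<Pi>\<^sub>M i\<in>{..<n}. borel) (\<lambda>x. \<lambda>i\<in>{..<n}. Y (Suc i) x) = PiM {..<n} \<mu>" .
  have q: "qform (kcoeff p n) {..<n} (\<lambda>i\<in>{..<n}. Y (Suc i) \<omega>) = S_np Y p n \<omega>" for \<omega>
    unfolding S_np_qform qform_def by (intro sum.cong refl) auto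
  have "(\<integral>x. f (qform (kcoeff p n) {..<n} x) \<partial>distr M (\<Pi>\<^sub>M i\<in>{..<n}. borel) (\<lambda>x. \<lambda>i\<in>{..<n}. Y (Suc i) x))
     = (\<integral>\<omega>. f (qform (kcoeff p n) {..<n} (\<lambda>i\<in>{..<n}. Y (Suc i) \<omega>)) \<partial>M)"
    by (subst integral_distr) (auto intro!: measurable_compose[OF qform_measurable f])
  then show ?thesis unfolding L q by simp
qed

definition gauss :: "real measure" where
  "gauss = density lborel (\<lambda>x. ennreal (normal_density 0 1 x))"

lemma gauss_std_law: "3 \<le> K \<Longrightarrow> std_law K gauss"
  using normal_law_moments[of 1, folded gauss_def] normal_law_moments(3)[of 1 4, folded gauss_def]
    integral_normal_moment_even[of 1 0 2]
  unfolding std_law_def gauss_def by (auto simp: integral_density fact_numeral)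

text \<open>On (-1,1) the normal density is at least its value at 1. Centre 0 and radius 1 are
  displayed to match the minorisation premise of the regularity estimate.\<close>

lemma gauss_minorant:
  assumes A: "A \<in> sets borel" "A \<subseteq> {0 - 1<..<0 + 1}"
  shows "exp (- 1 / 2) / sqrt (2 * pi) * measure lborel A \<le> measure gauss A"
proof -
  let ?e = "exp (- 1 / 2) / sqrt (2 * pi)"
  have e: "0 < ?e" by simp
  interpret prob_space gauss using normal_law_moments(1)[of 1] by (simp add: gauss_def)
  have fin: "emeasure lborel A < \<infinity>"
    using emeasure_mono[OF A(2), of lborel] by (auto intro: le_less_trans simp: ennreal_less_top)
  have "ennreal (?e * measure lborel A) = ennreal ?e * emeasure lborel A"
    using fin e by (subst ennreal_mult) (auto simp: emeasure_eq_ennreal_measure)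
  also have "\<dots> = (\<integral>\<^sup>+ x. ennreal ?e * indicator A x \<partial>lborel)"
    using A by (subst nn_integral_cmult_indicator) auto
  also have "\<dots> \<le> (\<integral>\<^sup>+ x. ennreal (normal_density 0 1 x) * indicator A x \<partial>lborel)"
  proof (intro nn_integral_mono)
    fix x :: real
    show "ennreal ?e * indicator A x \<le> ennreal (normal_density 0 1 x) * indicator A x"
    proof (cases "x \<in> A")
      case True
      then have "\<bar>x\<bar> \<le> 1" using subsetD[OF A(2)] by fastforce
      then have "x\<^sup>2 \<le> 1" by (simp add: abs_square_le_1)
      then have "?e \<le> normal_density 0 1 x"
        unfolding normal_density_def by (simp add: divide_simps)
      then show ?thesis using True by (simp add: ennreal_leI)
    qed simp
  qed
  also have "\<dots> = emeasure gauss A" unfolding gauss_def using A by (subst emeasure_density) auto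
  also have "\<dots> = ennreal (measure gauss A)" by (rule emeasure_eq_measure)
  finally show ?thesis by (simp add: ennreal_le_iff)
qed

lemma BM_incr_law:
  assumes W: "std_BM N W" and n: "0 < n"
  shows "\<And>i. BM_incr W n i \<in> borel_measurable N"
    and "prob_space.indep_vars N (\<lambda>_. borel) (\<lambda>i. BM_incr W n (Suc i)) {..<n}"
    and "\<And>i. i < n \<Longrightarrow> distr N borel (BM_incr W n (Suc i)) = gauss"
proof -
  interpret prob_space N using W by (auto simp: std_BM_def)
  have [measurable]: "W t \<in> borel_measurable N" for t using W by (auto simp: std_BM_def)
  show m: "BM_incr W n i \<in> borel_measurable N" for i unfolding BM_incr_def by measurable
  have adm: "elem_admissible (grid n) (grid_coeff 0 n)" by (rule grid_admissible[OF n])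
  then have "sorted_wrt (<) (grid n)" "set (grid n) \<subseteq> {0..}" by (auto simp: elem_admissible_def)
  then have "indep_vars (\<lambda>_. borel) (\<lambda>k \<omega>. W (grid n ! Suc k) \<omega> - W (grid n ! k) \<omega>) {..<length (grid n) - 1}"
    using W unfolding std_BM_def by blast
  then have "indep_vars (\<lambda>_. borel) (\<lambda>k \<omega>. sqrt (real n) * (W (grid n ! Suc k) \<omega> - W (grid n ! k) \<omega>)) {..<n}"
    using indep_vars_compose2[where M'="\<lambda>_. borel" and N="\<lambda>_. borel" and Y="\<lambda>_ x. sqrt (real n) * x" and I="{..<n}"
        and X="\<lambda>k \<omega>. W (grid n ! Suc k) \<omega> - W (grid n ! k) \<omega>"] unfolding grid_length by simp
  moreover have "(\<lambda>\<omega>. sqrt (real n) * (W (grid n ! Suc i) \<omega> - W (grid n ! i) \<omega>)) = BM_incr W n (Suc i)"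
    if "i \<in> {..<n}" for i
    using that by (simp add: BM_incr_def fun_eq_iff grid_nth)
  ultimately show "indep_vars (\<lambda>_. borel) (\<lambda>i. BM_incr W n (Suc i)) {..<n}"
    using indep_vars_cong[of "{..<n}" "{..<n}" "\<lambda>i \<omega>. sqrt (real n) * (W (grid n ! Suc i) \<omega> - W (grid n ! i) \<omega>)"
        "\<lambda>i. BM_incr W n (Suc i)" "\<lambda>_. borel" "\<lambda>_. borel"] by simp
  show "distr N borel (BM_incr W n (Suc i)) = gauss" if "i < n" for i
  proof -
    have "distributed N lborel (\<lambda>\<omega>. W (real (Suc i) / real n) \<omega> - W (real i / real n) \<omega>)
       (\<lambda>x. ennreal (normal_density 0 (sqrt (real (Suc i) / real n - real i / real n)) x))"
      using W n unfolding std_BM_def by (auto simp: divide_strict_right_mono)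
    moreover have "real (Suc i) / real n - real i / real n = 1 / real n" by (simp add: diff_divide_distrib[symmetric])
    ultimately have "distributed N lborel (\<lambda>\<omega>. W (real (Suc i) / real n) \<omega> - W (real i / real n) \<omega>)
       (\<lambda>x. ennreal (normal_density 0 (sqrt (1 / real n)) x))" by simp
    then have "distributed N lborel (\<lambda>\<omega>. 0 + sqrt (real n) * (W (real (Suc i) / real n) \<omega> - W (real i / real n) \<omega>))
       (\<lambda>x. ennreal (normal_density (0 + sqrt (real n) * 0) (\<bar>sqrt (real n)\<bar> * sqrt (1 / real n)) x))"
      by (rule normal_density_affine) (use n in auto)
    moreover have "\<bar>sqrt (real n)\<bar> * sqrt (1 / real n) = 1" using n by (simp add: real_sqrt_divide)
    ultimately have "distributed N lborel (BM_incr W n (Suc i)) (\<lambda>x. ennreal (normal_density 0 1 x))"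
      by (simp add: BM_incr_def[abs_def])
    then show ?thesis by (auto simp: distributed_def gauss_def cong: distr_cong)
  qed
qed

lemma continuous_bounded_integrable:
  fixes f :: "real \<Rightarrow> real"
  assumes "prob_space M" "X \<in> borel_measurable M" "f \<in> borel_measurable borel" "\<And>x. \<bar>f x\<bar> \<le> b"
  shows "integrable M (\<lambda>\<omega>. f (X \<omega>))"
proof -
  interpret prob_space M by fact
  show ?thesis using assms by (intro integrable_const_bound[of _ b]) auto
qed

lemma S_np_measurable:
  assumes [measurable]: "\<And>i. Z i \<in> borel_measurable M"
  shows "S_np Z p n \<in> borel_measurable M"
  unfolding S_np_def by measurable

text \<open>In place of the Cauchy-Schwarz inequality, |y| \<le> t/2 + y^2/(2t) with t of the order
  of the \<open>L\<^sup>2\<close>-error.\<close>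

lemma S_np_BM_L1_error:
  assumes W: "std_BM N W" and X: "is_double_WI N W (psi p) X" and n: "0 < n" and p: "0 < p" "p < 1 / 2"
  defines "S \<equiv> S_np (BM_incr W n) p n"
  shows "integrable N (\<lambda>\<omega>. S \<omega> - X \<omega>)"
    and "(\<integral>\<omega>. \<bar>S \<omega> - X \<omega>\<bar> \<partial>N) \<le> (1 + 512 / (1 - 2 * p)) / 2 * real n powr (- (1 - 2 * p) / 4)"
proof -
  interpret prob_space N using W by (auto simp: std_BM_def)
  have [measurable]: "X \<in> borel_measurable N" using X by (auto simp: is_double_WI_def)
  have [measurable]: "S \<in> borel_measurable N" unfolding S_def by (rule S_np_measurable[OF BM_incr_law(1)[OF W n]])
  define c where "c = 512 / (1 - 2 * p)"
  define t where "t = real n powr (- (1 - 2 * p) / 4)"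
  have t: "0 < t" using n by (simp add: t_def)
  have t2: "real n powr (- (1 - 2 * p) / 2) = t\<^sup>2"
    by (simp add: t_def power2_eq_square powr_add[symmetric])
  have c0: "0 \<le> c" using p by (simp add: c_def)
  have le: "(\<integral>\<^sup>+ \<omega>. ennreal ((X \<omega> - S \<omega>)\<^sup>2) \<partial>N) \<le> ennreal (c * t\<^sup>2)"
    using S_np_BM_L2_error[OF W X n p] unfolding S_def c_def t2 by simp
  have i2: "integrable N (\<lambda>\<omega>. (S \<omega> - X \<omega>)\<^sup>2)"
    using le by (intro integrableI_bounded) (auto simp: power2_commute[of "S _"] intro: le_less_trans)
  show i1: "integrable N (\<lambda>\<omega>. S \<omega> - X \<omega>)"
    by (rule square_integrable_imp_integrable[OF _ i2]) measurable
  have E2: "(\<integral>\<omega>. (S \<omega> - X \<omega>)\<^sup>2 \<partial>N) \<le> c * t\<^sup>2"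
  proof -
    have "ennreal (\<integral>\<omega>. (S \<omega> - X \<omega>)\<^sup>2 \<partial>N) = (\<integral>\<^sup>+ \<omega>. ennreal ((S \<omega> - X \<omega>)\<^sup>2) \<partial>N)"
      by (rule nn_integral_eq_integral[symmetric, OF i2]) simp
    also have "\<dots> \<le> ennreal (c * t\<^sup>2)" using le by (simp add: power2_commute[of "S _"])
    finally show ?thesis using c0 by (simp add: ennreal_le_iff)
  qed
  have pw: "\<bar>y\<bar> \<le> t / 2 + 1 / (2 * t) * y\<^sup>2" for y :: real
  proof -
    have "0 \<le> (\<bar>y\<bar> - t)\<^sup>2" by simp
    then have "2 * t * \<bar>y\<bar> \<le> t\<^sup>2 + y\<^sup>2" by (simp add: power2_diff algebra_simps)
    then show ?thesis using t by (simp add: field_simps power2_eq_square)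
  qed
  have "(\<integral>\<omega>. \<bar>S \<omega> - X \<omega>\<bar> \<partial>N) \<le> (\<integral>\<omega>. t / 2 + 1 / (2 * t) * (S \<omega> - X \<omega>)\<^sup>2 \<partial>N)"
    using i1 i2 pw by (intro integral_mono) auto
  also have "\<dots> = t / 2 + 1 / (2 * t) * (\<integral>\<omega>. (S \<omega> - X \<omega>)\<^sup>2 \<partial>N)"
    using i2 by (simp add: prob_space)
  also have "\<dots> \<le> t / 2 + 1 / (2 * t) * (c * t\<^sup>2)"
    using E2 t by (intro add_left_mono mult_left_mono) auto
  also have "\<dots> = (1 + c) / 2 * t" using t by (simp add: field_simps power2_eq_square)
  finally show "(\<integral>\<omega>. \<bar>S \<omega> - X \<omega>\<bar> \<partial>N) \<le> (1 + 512 / (1 - 2 * p)) / 2 * real n powr (- (1 - 2 * p) / 4)"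
    unfolding c_def t_def .
qed

lemma Lipschitz_test_BM_error:
  assumes W: "std_BM N W" and X: "is_double_WI N W (psi p) X" and n: "0 < n" and p: "0 < p" "p < 1 / 2"
    and h: "\<And>x. (h has_real_derivative h1 x) (at x)" "\<And>x. \<bar>h1 x\<bar> \<le> b" "\<And>x. \<bar>h x\<bar> \<le> 1"
  shows "\<bar>(\<integral>\<omega>. h (S_np (BM_incr W n) p n \<omega>) \<partial>N) - (\<integral>\<omega>. h (X \<omega>) \<partial>N)\<bar>
    \<le> b * ((1 + 512 / (1 - 2 * p)) / 2 * real n powr (- (1 - 2 * p) / 4))"
proof -
  let ?S = "S_np (BM_incr W n) p n"
  have N: "prob_space N" using W by (auto simp: std_BM_def)
  have Xm: "X \<in> borel_measurable N" using X by (auto simp: is_double_WI_def)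
  have Sm: "?S \<in> borel_measurable N" by (rule S_np_measurable[OF BM_incr_law(1)[OF W n]])
  have hm: "h \<in> borel_measurable borel"
    by (rule borel_measurable_continuous_onI[OF DERIV_imp_continuous_on_UNIV[OF h(1)]])
  have b0: "0 \<le> b" using h(2)[of 0] by linarith
  note E = S_np_BM_L1_error[OF W X n p]
  have "\<bar>(\<integral>\<omega>. h (?S \<omega>) \<partial>N) - (\<integral>\<omega>. h (X \<omega>) \<partial>N)\<bar> = \<bar>\<integral>\<omega>. h (?S \<omega>) - h (X \<omega>) \<partial>N\<bar>"
    using continuous_bounded_integrable[OF N Sm hm h(3)] continuous_bounded_integrable[OF N Xm hm h(3)] by simp
  also have "\<dots> \<le> (\<integral>\<omega>. \<bar>h (?S \<omega>) - h (X \<omega>)\<bar> \<partial>N)" by (rule integral_abs_bound)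
  also have "\<dots> \<le> (\<integral>\<omega>. b * \<bar>?S \<omega> - X \<omega>\<bar> \<partial>N)"
  proof (rule integral_mono)
    show "integrable N (\<lambda>\<omega>. \<bar>h (?S \<omega>) - h (X \<omega>)\<bar>)"
      using continuous_bounded_integrable[OF N Sm hm h(3)] continuous_bounded_integrable[OF N Xm hm h(3)] by simp
    show "integrable N (\<lambda>\<omega>. b * \<bar>?S \<omega> - X \<omega>\<bar>)" using E(1) by simp
    show "\<bar>h (?S \<omega>) - h (X \<omega>)\<bar> \<le> b * \<bar>?S \<omega> - X \<omega>\<bar>" for \<omega>
      using field_differentiable_bound[of UNIV h h1 b "?S \<omega>" "X \<omega>"] h
      by (auto intro: has_field_derivative_at_within)
  qed
  also have "\<dots> = b * (\<integral>\<omega>. \<bar>?S \<omega> - X \<omega>\<bar> \<partial>N)" by simp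
  also have "\<dots> \<le> b * ((1 + 512 / (1 - 2 * p)) / 2 * real n powr (- (1 - 2 * p) / 4))"
    by (rule mult_left_mono[OF E(2) b0])
  finally show ?thesis .
qed

definition gauss_const :: real where
  "gauss_const = reg_const (exp (- 1 / 2) / sqrt (2 * pi)) 1"

text \<open>The bound for \<open>S_np\<close> passes to the limit along an almost surely convergent subsequence.\<close>

lemma double_WI_regularity:
  assumes W: "std_BM N W" and X: "is_double_WI N W (psi p) X" and p: "0 < p" "p < 1 / 2"
    and d: "\<And>x. (\<phi> has_real_derivative g x) (at x)" and cg: "continuous_on UNIV g"
    and b: "\<And>x. \<bar>\<phi> x\<bar> \<le> a" "\<And>x. \<bar>g x\<bar> \<le> b" and \<eta>: "0 < \<eta>"
  shows "\<bar>\<integral>\<omega>. g (X \<omega>) \<partial>N\<bar> \<le> gauss_const * (a / sqrt \<eta> + b * sqrt \<eta>)"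
proof -
  have N: "prob_space N" using W by (auto simp: std_BM_def)
  interpret prob_space N by (rule N)
  let ?e = "exp (- 1 / 2) / sqrt (2 * pi) :: real"
  have e: "0 < ?e" by simp
  have gm[measurable]: "g \<in> borel_measurable borel" by (rule borel_measurable_continuous_onI[OF cg])
  have [measurable]: "X \<in> borel_measurable N" using X by (auto simp: is_double_WI_def)
  define S where "S n = S_np (BM_incr W (Suc n)) p (Suc n)" for n
  have [measurable]: "S n \<in> borel_measurable N" for n
    unfolding S_def by (rule S_np_measurable[OF BM_incr_law(1)[OF W]]) simp
  have L1: "(\<lambda>n. \<integral>\<omega>. norm (S n \<omega> - X \<omega>) \<partial>N) \<longlonglongrightarrow> 0"
  proof (rule tendsto_sandwich[OF _ _ tendsto_const])
    let ?c = "(1 + 512 / (1 - 2 * p)) / 2"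
    have "(\<lambda>n. real (Suc n) powr (- (1 - 2 * p) / 4)) \<longlonglongrightarrow> 0"
      using p by (intro tendsto_neg_powr filterlim_compose[OF filterlim_real_sequentially filterlim_Suc]) auto
    from tendsto_mult_left[OF this, of ?c] show "(\<lambda>n. ?c * real (Suc n) powr (- (1 - 2 * p) / 4)) \<longlonglongrightarrow> 0" by simp
    show "\<forall>\<^sub>F n in sequentially. (\<integral>\<omega>. norm (S n \<omega> - X \<omega>) \<partial>N) \<le> ?c * real (Suc n) powr (- (1 - 2 * p) / 4)"
      unfolding S_def real_norm_def
      by (intro always_eventually allI S_np_BM_L1_error(2)[OF W X _ p]) simp
  qed simp
  have "\<exists>r::nat\<Rightarrow>nat. strict_mono r \<and> (AE \<omega> in N. (\<lambda>n. S (r n) \<omega> - X \<omega>) \<longlonglongrightarrow> 0)"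
    using S_np_BM_L1_error(1)[OF W X _ p] by (intro tendsto_L1_AE_subseq L1) (simp add: S_def)
  then obtain r :: "nat \<Rightarrow> nat" where r: "strict_mono r" and AE: "AE \<omega> in N. (\<lambda>n. S (r n) \<omega> - X \<omega>) \<longlonglongrightarrow> 0"
    by blast
  have conv: "(\<lambda>n. \<integral>\<omega>. g (S (r n) \<omega>) \<partial>N) \<longlonglongrightarrow> (\<integral>\<omega>. g (X \<omega>) \<partial>N)"
  proof (rule integral_dominated_convergence[where w="\<lambda>_. b"])
    show "AE \<omega> in N. (\<lambda>n. g (S (r n) \<omega>)) \<longlonglongrightarrow> g (X \<omega>)"
      using AE
    proof eventually_elim
      case (elim \<omega>)
      then have "(\<lambda>n. S (r n) \<omega>) \<longlonglongrightarrow> X \<omega>" by (rule LIM_zero_cancel)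
      moreover have "isCont g (X \<omega>)" using cg by (simp add: continuous_on_eq_continuous_at)
      ultimately show ?case by (rule isCont_tendsto_compose[rotated])
    qed
  qed (use b in auto)
  \<comment> \<open>The summand 1/n comes from too few labels and disappears in the limit, so the
    estimate for \<open>X\<close> is free of it.\<close>
  let ?B = "\<lambda>n. gauss_const * (a / sqrt \<eta> + b * (sqrt \<eta> + 1 / real (Suc (r n))))"
  have "(\<lambda>n. 1 / real (Suc (r n))) \<longlonglongrightarrow> 0"
    using LIMSEQ_subseq_LIMSEQ[OF LIMSEQ_inverse_real_of_nat r] by (simp add: o_def inverse_eq_divide)
  then have "?B \<longlonglongrightarrow> gauss_const * (a / sqrt \<eta> + b * (sqrt \<eta> + 0))"
    by (intro tendsto_intros)
  moreover have "(\<lambda>n. \<bar>\<integral>\<omega>. g (S (r n) \<omega>) \<partial>N\<bar>) \<longlonglongrightarrow> \<bar>\<integral>\<omega>. g (X \<omega>) \<partial>N\<bar>"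
    using conv by (rule tendsto_rabs)
  moreover have "\<exists>n0. \<forall>n\<ge>n0. \<bar>\<integral>\<omega>. g (S (r n) \<omega>) \<partial>N\<bar> \<le> ?B n"
  proof -
    \<comment> \<open>Enough variables for the condition \<open>4 \<le> 16 / 15 * e * r * n\<close>
      of the regularity estimate; \<open>n \<le> r n\<close> carries it over to the
      subsequence.\<close>
    obtain n0 :: nat where n0: "4 / (16 / 15 * ?e * 1) < real n0" using reals_Archimedean2 by blast
    have "\<bar>\<integral>\<omega>. g (S (r n) \<omega>) \<partial>N\<bar> \<le> ?B n" if n: "n0 \<le> n" for n
    proof -
      let ?m = "Suc (r n)"
      have "n \<le> r n" using r by (rule seq_suble)
      then have "real n0 \<le> real ?m" using n by simp
      then have "4 / (16 / 15 * ?e * 1) \<le> real ?m" using n0 by linarith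
      then have big: "4 \<le> 16 / 15 * ?e * 1 * real ?m" using e by (simp add: field_simps)
      have "(\<integral>\<omega>. g (S (r n) \<omega>) \<partial>N) = (\<integral>x. g (qform (kcoeff p ?m) {..<?m} x) \<partial>PiM {..<?m} (\<lambda>_. gauss))"
        unfolding S_def by (rule expectation_S_np) (use BM_incr_law[OF W] gm in auto)
      also have "\<bar>\<dots>\<bar> \<le> reg_const ?e 1 * (a / sqrt \<eta> + b * (sqrt \<eta> + 1 / real ?m))"
      proof (rule quadratic_form_regularity[where c="\<lambda>_. 0" and K=3, OF gauss_std_law e])
        show "?e * measure lborel A \<le> measure gauss A" if "A \<in> sets borel" "A \<subseteq> {0 - 1<..<0 + 1}" for A
          using gauss_minorant[OF that] .
        show "1 / real ?m \<le> kcoeff p ?m i j" if "i \<in> {..<?m}" "j \<in> {..<?m}" "i \<noteq> j" for i j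
          by (rule kcoeff_ge[OF p(1)]) (use that in auto)
      qed (use big d cg b \<eta> in \<open>auto simp: kcoeff_diag kcoeff_sym\<close>)
      finally show ?thesis unfolding gauss_const_def .
    qed
    then show ?thesis by blast
  qed
  ultimately have "\<bar>\<integral>\<omega>. g (X \<omega>) \<partial>N\<bar> \<le> gauss_const * (a / sqrt \<eta> + b * (sqrt \<eta> + 0))"
    by (intro LIMSEQ_le)
  then show ?thesis by simp
qed

lemma reg_const_nonneg: "0 < e \<Longrightarrow> 0 < r \<Longrightarrow> 0 \<le> reg_const e r"
  unfolding reg_const_def by (intro add_nonneg_nonneg mult_nonneg_nonneg) auto

text \<open>A finite measure above both laws yields one continuous function that approximates
  \<open>f\<close> for both at once. Clipping it to [-1,1] brings it no farther from
  \<open>f\<close>, whose values lie there.\<close>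

lemma continuous_to_measurable_test:
  fixes f :: "real \<Rightarrow> real"
  assumes M: "prob_space M" and N: "prob_space N"
    and X[measurable]: "X \<in> borel_measurable M" and Y[measurable]: "Y \<in> borel_measurable N"
    and c: "\<And>g. continuous_on UNIV g \<Longrightarrow> (\<And>x. \<bar>g x\<bar> \<le> 1) \<Longrightarrow> \<bar>(\<integral>\<omega>. g (X \<omega>) \<partial>M) - (\<integral>\<omega>. g (Y \<omega>) \<partial>N)\<bar> \<le> k"
    and f[measurable]: "f \<in> borel_measurable borel" and b: "\<And>x. \<bar>f x\<bar> \<le> 1"
  shows "\<bar>(\<integral>\<omega>. f (X \<omega>) \<partial>M) - (\<integral>\<omega>. f (Y \<omega>) \<partial>N)\<bar> \<le> k"
proof (rule field_le_epsilon)
  fix e :: real assume e: "0 < e"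
  interpret M: prob_space M by (rule M)
  interpret N: prob_space N by (rule N)
  define \<mu> \<nu> where "\<mu> = distr M borel X" and "\<nu> = distr N borel Y"
  interpret \<mu>: prob_space \<mu> unfolding \<mu>_def by (rule M.prob_space_distr) measurable
  interpret \<nu>: prob_space \<nu> unfolding \<nu>_def by (rule N.prob_space_distr) measurable
  have s: "sets \<mu> = sets borel" "sets \<nu> = sets \<mu>" by (simp_all add: \<mu>_def \<nu>_def)
  define \<kappa> where "\<kappa> = sup_measure' \<mu> \<nu>"
  have s\<kappa>: "sets \<kappa> = sets borel" and sp: "space \<kappa> = UNIV"
    unfolding \<kappa>_def using s by (simp_all add: \<mu>_def)
  have fin: "finite_measure \<kappa>"
  proof
    have "emeasure \<kappa> (space \<kappa>) = (SUP Y\<in>sets \<mu>. emeasure \<mu> (UNIV \<inter> Y) + emeasure \<nu> (UNIV \<inter> - Y))"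
      unfolding sp unfolding \<kappa>_def using s by (intro emeasure_sup_measure') auto
    also have "\<dots> \<le> 1 + 1"
      by (intro SUP_least add_mono \<mu>.measure_le_1 \<nu>.measure_le_1)
    finally show "emeasure \<kappa> (space \<kappa>) \<noteq> \<infinity>" by (auto simp: top_unique)
  qed
  interpret \<kappa>: finite_measure \<kappa> by (rule fin)
  have ifk: "integrable \<kappa> f"
    by (rule \<kappa>.integrable_const_bound[of _ 1]) (use b s\<kappa> in \<open>auto cong: measurable_cong_sets\<close>)
  obtain g where g: "continuous_on UNIV g" "(\<integral>x. \<bar>f x - g x\<bar> \<partial>\<kappa>) < e / 2"
    and gb: "bounded (range g)"
    using continuous_approx_L1[OF fin s\<kappa> ifk, of "e / 2"] e by auto
  define h where "h x = max (- 1) (min 1 (g x))" for x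
  have hc: "continuous_on UNIV h" unfolding h_def by (intro continuous_intros g)
  have h1: "\<bar>h x\<bar> \<le> 1" for x by (auto simp: h_def)
  have hf: "\<bar>f x - h x\<bar> \<le> \<bar>f x - g x\<bar>" for x using b[of x] by (auto simp: h_def abs_le_iff max_def min_def)
  have gm[measurable]: "g \<in> borel_measurable borel" and hm[measurable]: "h \<in> borel_measurable borel"
    using g(1) hc by (auto intro: borel_measurable_continuous_onI)
  obtain bg where bg: "\<And>x. \<bar>g x\<bar> \<le> bg" using gb by (auto simp: bounded_iff)
  have ig: "integrable \<kappa> (\<lambda>x. \<bar>f x - g x\<bar>)"
    by (intro integrable_abs Bochner_Integration.integrable_diff ifk \<kappa>.integrable_const_bound[of _ bg])
      (use bg s\<kappa> in \<open>auto cong: measurable_cong_sets\<close>)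
  have close: "\<bar>(\<integral>\<omega>. f (Z \<omega>) \<partial>P) - (\<integral>\<omega>. h (Z \<omega>) \<partial>P)\<bar> < e / 2"
    if P: "prob_space P" and Z[measurable]: "Z \<in> borel_measurable P"
      and le: "\<And>A. A \<in> sets borel \<Longrightarrow> emeasure (distr P borel Z) A \<le> emeasure \<kappa> A" for P :: "'c measure" and Z
  proof -
    interpret P: prob_space P by (rule P)
    have i: "integrable P (\<lambda>\<omega>. f (Z \<omega>))" "integrable P (\<lambda>\<omega>. h (Z \<omega>))"
      using continuous_bounded_integrable[OF P Z f b] continuous_bounded_integrable[OF P Z hm h1] by auto
    have iab: "integrable P (\<lambda>\<omega>. \<bar>f (Z \<omega>) - h (Z \<omega>)\<bar>)" using i by simp
    have "\<bar>(\<integral>\<omega>. f (Z \<omega>) \<partial>P) - (\<integral>\<omega>. h (Z \<omega>) \<partial>P)\<bar> = \<bar>\<integral>\<omega>. f (Z \<omega>) - h (Z \<omega>) \<partial>P\<bar>"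
      using i by simp
    also have "\<dots> \<le> (\<integral>\<omega>. \<bar>f (Z \<omega>) - h (Z \<omega>)\<bar> \<partial>P)" by (rule integral_abs_bound)
    also have "\<dots> \<le> (\<integral>x. \<bar>f x - g x\<bar> \<partial>\<kappa>)"
    proof -
      have "ennreal (\<integral>\<omega>. \<bar>f (Z \<omega>) - h (Z \<omega>)\<bar> \<partial>P) = (\<integral>\<^sup>+ \<omega>. ennreal \<bar>f (Z \<omega>) - h (Z \<omega>)\<bar> \<partial>P)"
        by (rule nn_integral_eq_integral[symmetric, OF iab]) simp
      also have "\<dots> \<le> (\<integral>\<^sup>+ \<omega>. ennreal \<bar>f (Z \<omega>) - g (Z \<omega>)\<bar> \<partial>P)"
        by (intro nn_integral_mono ennreal_leI hf)
      also have "\<dots> = (\<integral>\<^sup>+ x. ennreal \<bar>f x - g x\<bar> \<partial>distr P borel Z)"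
        by (subst nn_integral_distr) auto
      also have "\<dots> \<le> (\<integral>\<^sup>+ x. ennreal \<bar>f x - g x\<bar> \<partial>\<kappa>)"
      proof (rule nn_integral_mono_measure)
        show "distr P borel Z \<le> \<kappa>" using le s\<kappa> by (subst le_measure) auto
      qed (simp add: s\<kappa>)
      also have "\<dots> = ennreal (\<integral>x. \<bar>f x - g x\<bar> \<partial>\<kappa>)"
        by (rule nn_integral_eq_integral[OF ig]) simp
      finally show ?thesis by (simp add: ennreal_le_iff)
    qed
    finally show ?thesis using g(2) by linarith
  qed
  have "\<bar>(\<integral>\<omega>. f (X \<omega>) \<partial>M) - (\<integral>\<omega>. h (X \<omega>) \<partial>M)\<bar> < e / 2"
    using le_emeasure_sup_measure'1[OF s(2)] s(1) by (intro close[OF M X]) (auto simp: \<kappa>_def \<mu>_def)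
  moreover have "\<bar>(\<integral>\<omega>. f (Y \<omega>) \<partial>N) - (\<integral>\<omega>. h (Y \<omega>) \<partial>N)\<bar> < e / 2"
    using le_emeasure_sup_measure'2[OF s(2)] s(1) by (intro close[OF N Y]) (auto simp: \<kappa>_def \<nu>_def)
  moreover have "\<bar>(\<integral>\<omega>. h (X \<omega>) \<partial>M) - (\<integral>\<omega>. h (Y \<omega>) \<partial>N)\<bar> \<le> k" by (rule c[OF hc h1])
  ultimately show "\<bar>(\<integral>\<omega>. f (X \<omega>) \<partial>M) - (\<integral>\<omega>. f (Y \<omega>) \<partial>N)\<bar> \<le> k + e" by linarith
qed

section \<open>Assembling the rates\<close>

locale quadratic_limit =
  fixes M :: "'a measure" and Z :: "nat \<Rightarrow> 'a \<Rightarrow> real" and p K :: real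
    and N :: "'b measure" and W :: "real \<Rightarrow> 'b \<Rightarrow> real" and X :: "'b \<Rightarrow> real"
  assumes M: "prob_space M" and Z: "\<And>i. Z i \<in> borel_measurable M"
    and ind: "prob_space.indep_vars M (\<lambda>_. borel) Z UNIV"
    and law: "\<And>i. std_law K (distr M borel (Z i))" and K: "3 \<le> K"
    and p: "0 < p" "p < 1 / 2" and W: "std_BM N W" and X: "is_double_WI N W (psi p) X"
begin

text \<open>The smoothing scale is \<open>(rate n)\<^sup>2\<close> throughout, which balances the regularity error, of order its
  square root, against the errors for smooth test functions.\<close>

definition rate :: "nat \<Rightarrow> real" where "rate n = real n powr (- ((1 - 2 * p) / 15))"

text \<open>The Lindeberg part, with 8 from the bound on the third derivative, plus the Brownian
  part, which is twice the constant of the \<open>L\<^sup>1\<close>-error.\<close>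

definition smooth_const :: real where
  "smooth_const = 8 * (1 + K)\<^sup>2 / 6 * sqrt (8 / (1 - 2 * p)) ^ 3 + (1 + 512 / (1 - 2 * p))"

lemma N: "prob_space N" using W by (auto simp: std_BM_def)

lemma Xm: "X \<in> borel_measurable N" using X by (auto simp: is_double_WI_def)

lemma Sm: "S_np Z p n \<in> borel_measurable M" by (rule S_np_measurable[OF Z])

text \<open>Three derivatives cost \<open>rate n\<close> to the power -6 and one derivative costs
  the power -2, so n^(-1/2) and n^(-(1-2p)/4) have to supply 7 and 3 powers. They do, since
  7(1-2p)/15 \<le> 1/2 and 3/15 \<le> 1/4.\<close>

lemma rate_powers:
  assumes "0 < n"
  shows "0 < rate n" "1 / real n \<le> rate n" "real n powr (- 1 / 2) \<le> rate n ^ 7"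
    "real n powr (- (1 - 2 * p) / 4) \<le> rate n ^ 3"
proof -
  have n: "1 \<le> real n" using assms by simp
  have pw: "rate n ^ k = real n powr (- (real k * (1 - 2 * p) / 15))" for k
    using n by (simp add: rate_def powr_power mult.commute)
  show "0 < rate n" using assms by (simp add: rate_def)
  have "1 / real n = real n powr (- 1)" using assms by (simp add: powr_minus_divide)
  also have "\<dots> \<le> rate n" unfolding rate_def using n p by (intro powr_mono) auto
  finally show "1 / real n \<le> rate n" .
  have "- 1 / 2 \<le> - (real 7 * (1 - 2 * p) / 15)" "- (1 - 2 * p) / 4 \<le> - (real 3 * (1 - 2 * p) / 15)"
    using p by (simp_all add: field_simps)
  then show "real n powr (- 1 / 2) \<le> rate n ^ 7" "real n powr (- (1 - 2 * p) / 4) \<le> rate n ^ 3"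
    unfolding pw using n by (auto intro: powr_mono)
qed

lemma expectation_Z:
  fixes f :: "real \<Rightarrow> real"
  assumes n: "0 < n" and f: "f \<in> borel_measurable borel"
  shows "(\<integral>\<omega>. f (S_np Z p n \<omega>) \<partial>M) = (\<integral>x. f (qform (kcoeff p n) {..<n} x) \<partial>PiM {..<n} (\<lambda>i. distr M borel (Z (Suc i)))) "
proof -
  interpret prob_space M by (rule M)
  have "indep_vars (\<lambda>_. borel) (\<lambda>i. Z (Suc i)) {..<n}"
    by (rule indep_vars_reindex_inj[OF indep_vars_subset[OF ind]]) auto
  then show ?thesis by (rule expectation_S_np[OF Z _ _ n f]) simp
qed

text \<open>The sum built from Brownian increments stands between the two laws: Lindeberg
  replacement compares it with \<open>Z\<close>, the \<open>L\<^sup>1\<close>-error compares it with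
  \<open>X\<close>.\<close>

lemma smooth_test_error:
  assumes n: "0 < n"
    and d: "\<And>x. (h has_real_derivative h1 x) (at x)" "\<And>x. (h1 has_real_derivative h2 x) (at x)"
      "\<And>x. (h2 has_real_derivative h3 x) (at x)"
    and b: "\<And>x. \<bar>h x\<bar> \<le> 1" "\<And>x. \<bar>h1 x\<bar> \<le> 2 / (rate n)\<^sup>2" "\<And>x. \<bar>h3 x\<bar> \<le> 8 / ((rate n)\<^sup>2) ^ 3"
  shows "\<bar>(\<integral>\<omega>. h (S_np Z p n \<omega>) \<partial>M) - (\<integral>\<omega>. h (X \<omega>) \<partial>N)\<bar> \<le> smooth_const * rate n"
proof -
  let ?r = "rate n" and ?k = "1 - 2 * p"
  note R = rate_powers[OF n]
  have k: "0 < ?k" using p by simp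
  let ?\<tau> = "sqrt (8 / (?k * real n))"
  have hm: "h \<in> borel_measurable borel"
    by (rule borel_measurable_continuous_onI[OF DERIV_imp_continuous_on_UNIV[OF d(1)]])
  have G: "(\<integral>\<omega>. h (S_np (BM_incr W n) p n \<omega>) \<partial>N) = (\<integral>x. h (qform (kcoeff p n) {..<n} x) \<partial>PiM {..<n} (\<lambda>_. gauss))"
    by (rule prob_space.expectation_S_np[OF N]) (use BM_incr_law[OF W n] n hm in auto)
  have \<tau>: "0 < ?\<tau>" using k n by simp
  have "\<bar>(\<integral>x. h (qform (kcoeff p n) {..<n} x) \<partial>PiM {..<n} (\<lambda>i. distr M borel (Z (Suc i))))
      - (\<integral>x. h (qform (kcoeff p n) {..<n} x) \<partial>PiM {..<n} (\<lambda>_. gauss))\<bar>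
    \<le> real (card {..<n}) * (8 / (?r\<^sup>2) ^ 3 * (1 + K)\<^sup>2 / 6 * ?\<tau> ^ 3)"
    by (rule Lindeberg_quadratic_form[OF d b(3) b(1) law gauss_std_law[OF K] K finite_lessThan kcoeff_diag kcoeff_sym \<tau>])
      (use kcoeff_row_sum[OF p] in auto)
  also have "\<dots> = 8 * (1 + K)\<^sup>2 / 6 / ?r ^ 6 * (real n * ?\<tau> ^ 3)" by (simp add: power_mult[symmetric])
  \<comment> \<open>n exchanges, each of order n^(-3/2).\<close>
  also have "real n * ?\<tau> ^ 3 = sqrt (8 / ?k) ^ 3 * real n powr (- 1 / 2)"
  proof -
    have t: "?\<tau> = sqrt (8 / ?k) * (1 / sqrt (real n))"
      by (simp add: real_sqrt_divide real_sqrt_mult)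
    have "real n * ?\<tau> ^ 3 = sqrt (8 / ?k) ^ 3 * (real n * (1 / sqrt (real n)) ^ 3)"
      unfolding t power_mult_distrib by (simp only: mult.left_commute)
    also have "real n * (1 / sqrt (real n)) ^ 3 = real n powr (- 1 / 2)"
    proof -
      have "real n * (1 / sqrt (real n)) ^ 3 = 1 / sqrt (real n)"
        using n by (simp add: power3_eq_cube divide_simps)
      then show ?thesis using n by (simp add: powr_minus_divide powr_half_sqrt)
    qed
    finally show ?thesis .
  qed
  also have "8 * (1 + K)\<^sup>2 / 6 / ?r ^ 6 * (sqrt (8 / ?k) ^ 3 * real n powr (- 1 / 2))
    \<le> 8 * (1 + K)\<^sup>2 / 6 / ?r ^ 6 * (sqrt (8 / ?k) ^ 3 * ?r ^ 7)"
    using R k by (intro mult_left_mono) auto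
  also have "\<dots> = 8 * (1 + K)\<^sup>2 / 6 * sqrt (8 / ?k) ^ 3 * ?r"
  proof -
    have cancel: "c / x * (b * (x * y)) = c * b * y" if "x \<noteq> 0" for c b x y :: real using that by simp
    have r7: "?r ^ 7 = ?r ^ 6 * ?r" by (simp add: power_eq_if)
    show ?thesis unfolding r7 by (rule cancel) (use R(1) in simp)
  qed
  finally have A: "\<bar>(\<integral>\<omega>. h (S_np Z p n \<omega>) \<partial>M) - (\<integral>\<omega>. h (S_np (BM_incr W n) p n \<omega>) \<partial>N)\<bar>
    \<le> 8 * (1 + K)\<^sup>2 / 6 * sqrt (8 / ?k) ^ 3 * ?r"
    unfolding G expectation_Z[OF n hm] .
  have "\<bar>(\<integral>\<omega>. h (S_np (BM_incr W n) p n \<omega>) \<partial>N) - (\<integral>\<omega>. h (X \<omega>) \<partial>N)\<bar>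
    \<le> 2 / ?r\<^sup>2 * ((1 + 512 / ?k) / 2 * real n powr (- ?k / 4))"
    by (rule Lipschitz_test_BM_error[OF W X n p d(1) b(2) b(1)])
  also have "\<dots> \<le> 2 / ?r\<^sup>2 * ((1 + 512 / ?k) / 2 * ?r ^ 3)"
    using R k by (intro mult_left_mono) auto
  also have "\<dots> = (1 + 512 / ?k) * ?r"
    using R(1) by (simp add: power2_eq_square power3_eq_cube)
  finally show ?thesis using A unfolding smooth_const_def distrib_right by linarith
qed

text \<open>The window is dominated by a ramp minus its translate by 5\<delta>, a function with an
  antiderivative of size 5\<delta>. Regularity with \<eta> = \<delta> gives 5 + 1 multiples of sqrt
  \<delta>. The width 4\<delta> is that of the transition zone of the smoothed step used for the
  Kolmogorov distance.\<close>

lemma X_small_ball: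
  assumes n: "0 < n"
  shows "measure N {\<omega> \<in> space N. x < X \<omega> \<and> X \<omega> \<le> x + 4 * (rate n)\<^sup>2} \<le> 6 * gauss_const * rate n"
proof -
  interpret N: prob_space N by (rule N)
  note [measurable] = Xm
  define \<delta> where "\<delta> = (rate n)\<^sup>2"
  have r: "0 < rate n" by (rule rate_powers(1)[OF n])
  have \<delta>: "0 < \<delta>" using r by (simp add: \<delta>_def)
  have sq: "sqrt \<delta> = rate n" using r by (simp add: \<delta>_def)
  define f where "f y = max 0 (min 1 ((x + 5 * \<delta> - y) / \<delta>))" for y
  have fc: "continuous_on UNIV f" unfolding f_def using \<delta> by (intro continuous_intros) auto
  obtain F where F: "\<And>y. (F has_real_derivative f y) (at y)"
    using continuous_antiderivative[OF fc] by blast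
  define g where "g y = f y - f (y + 5 * \<delta>)" for y
  have f01: "0 \<le> f y" "f y \<le> 1" for y by (auto simp: f_def)
  have fmono: "f (y + 5 * \<delta>) \<le> f y" for y
    unfolding f_def using \<delta> by (intro max.mono min.mono divide_right_mono) auto
  have d: "((\<lambda>y. F y - F (y + 5 * \<delta>)) has_real_derivative g y) (at y)" for y
    unfolding g_def using F[of "y + 5 * \<delta>"] by (intro DERIV_diff F) (simp add: DERIV_shift)
  have bF: "\<bar>F y - F (y + 5 * \<delta>)\<bar> \<le> 5 * \<delta>" for y
    using field_differentiable_bound[of UNIV F f 1 y "y + 5 * \<delta>"] F f01 \<delta>
    by (auto intro: has_field_derivative_at_within)
  have bg: "\<bar>g y\<bar> \<le> 1" for y using f01[of y] f01[of "y + 5 * \<delta>"] unfolding g_def by linarith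
  have gc: "continuous_on UNIV g" unfolding g_def using \<delta>
    by (intro continuous_intros fc continuous_on_compose2[OF fc]) auto
  have gm: "g \<in> borel_measurable borel" by (rule borel_measurable_continuous_onI[OF gc])
  have g1: "g y = 1" if "x < y" "y \<le> x + 4 * \<delta>" for y
  proof -
    have "1 \<le> (x + 5 * \<delta> - y) / \<delta>" using that \<delta> by (simp add: field_simps)
    then have "f y = 1" by (simp add: f_def)
    moreover have "(x + 5 * \<delta> - (y + 5 * \<delta>)) / \<delta> \<le> 0" using that \<delta> by (simp add: divide_nonpos_pos)
    then have "f (y + 5 * \<delta>) = 0" unfolding f_def by (simp add: min_def)
    ultimately show ?thesis by (simp add: g_def)
  qed
  let ?A = "{\<omega> \<in> space N. x < X \<omega> \<and> X \<omega> \<le> x + 4 * \<delta>}"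
  have "measure N ?A = (\<integral>\<omega>. indicator ?A \<omega> \<partial>N)" by simp
  also have "\<dots> \<le> (\<integral>\<omega>. g (X \<omega>) \<partial>N)"
  proof (rule integral_mono)
    show "integrable N (\<lambda>\<omega>. g (X \<omega>))" by (rule continuous_bounded_integrable[OF N Xm gm bg])
    show "(indicator ?A \<omega> :: real) \<le> g (X \<omega>)" for \<omega>
      using g1[of "X \<omega>"] fmono[of "X \<omega>"] by (auto simp: indicator_def g_def)
  qed (auto intro!: integrable_real_indicator simp: N.emeasure_eq_measure)
  also have "\<dots> \<le> gauss_const * (5 * \<delta> / sqrt \<delta> + 1 * sqrt \<delta>)"
    using double_WI_regularity[OF W X p d gc bF bg \<delta>] by linarith
  also have "5 * \<delta> / sqrt \<delta> + 1 * sqrt \<delta> = 6 * rate n"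
    unfolding sq using r by (simp add: \<delta>_def power2_eq_square)
  finally show ?thesis by (simp add: \<delta>_def mult_ac)
qed

text \<open>A smooth function between the indicators of the half-lines ending at \<open>x\<close>
  and at x + 4\<delta> compares the distribution functions up to a shift. The shift is paid on the
  side of \<open>X\<close> alone, by its small-ball bound.\<close>

lemma Kolmogorov_bound:
  assumes n: "0 < n"
  shows "d_kol M (S_np Z p n) N X \<le> (smooth_const + 6 * gauss_const) * rate n"
  unfolding d_kol_def
proof (rule cSUP_least)
  interpret N: prob_space N by (rule N)
  interpret M: prob_space M by (rule M)
  note [measurable] = Xm Sm
  define \<delta> where "\<delta> = (rate n)\<^sup>2"
  have r: "0 < rate n" by (rule rate_powers(1)[OF n])
  have \<delta>: "0 < \<delta>" using r by (simp add: \<delta>_def)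
  let ?S = "S_np Z p n"
  have smooth: "\<exists>h. continuous_on UNIV h \<and> (\<forall>y. 0 \<le> h y \<and> h y \<le> 1) \<and> (\<forall>y\<le>x. h y = 1) \<and> (\<forall>y>x + 4 * \<delta>. h y = 0) \<and>
     \<bar>(\<integral>\<omega>. h (?S \<omega>) \<partial>M) - (\<integral>\<omega>. h (X \<omega>) \<partial>N)\<bar> \<le> smooth_const * rate n" for x
  proof -
    \<comment> \<open>The ramp falls between x + 3\<delta> and x + 4\<delta>. Smoothing looks
      3\<delta> to the right, so \<open>h\<close> is still 1 up to \<open>x\<close> and is 0 beyond
      x + 4\<delta>.\<close>
    define f where "f y = max 0 (min 1 ((x + 4 * \<delta> - y) / \<delta>))" for y
    have fc: "continuous_on UNIV f" unfolding f_def using \<delta> by (intro continuous_intros) auto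
    have f1: "\<bar>f y\<bar> \<le> 1" for y by (auto simp: f_def)
    obtain h h1 h2 h3 \<phi> where h: "\<And>x. (h has_real_derivative h1 x) (at x)" "\<And>x. (h1 has_real_derivative h2 x) (at x)"
      "\<And>x. (h2 has_real_derivative h3 x) (at x)"
      "\<And>x. \<exists>y\<in>{x..x + 3 * \<delta>}. h x = f y" "\<And>x. \<bar>h1 x\<bar> \<le> 2 / \<delta>" "\<And>x. \<bar>h3 x\<bar> \<le> 8 / \<delta> ^ 3"
      "\<And>x. (\<phi> has_real_derivative f x - h x) (at x)" "\<And>x. \<bar>\<phi> x\<bar> \<le> 3 * \<delta>"
      using third_order_smoothing[OF fc f1 \<delta>] by blast
    have h01: "0 \<le> h y \<and> h y \<le> 1" for y
    proof -
      obtain z where "h y = f z" using h(4) by blast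
      then show ?thesis by (auto simp: f_def)
    qed
    have "h y = 1" if "y \<le> x" for y
    proof -
      obtain z where z: "z \<in> {y..y + 3 * \<delta>}" "h y = f z" using h(4) by blast
      then have "1 \<le> (x + 4 * \<delta> - z) / \<delta>" using that \<delta> by (simp add: field_simps)
      then show ?thesis using z by (simp add: f_def)
    qed
    moreover have "h y = 0" if "x + 4 * \<delta> < y" for y
    proof -
      obtain z where z: "z \<in> {y..y + 3 * \<delta>}" "h y = f z" using h(4) by blast
      then have "(x + 4 * \<delta> - z) / \<delta> \<le> 0" using that \<delta> by (intro divide_nonpos_pos) auto
      then show ?thesis using z by (simp add: f_def min_def)
    qed
    moreover have "\<bar>(\<integral>\<omega>. h (?S \<omega>) \<partial>M) - (\<integral>\<omega>. h (X \<omega>) \<partial>N)\<bar> \<le> smooth_const * rate n"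
      by (rule smooth_test_error[OF n h(1-3)]) (use h01 h(5,6) in \<open>auto simp: \<delta>_def\<close>)
    ultimately show ?thesis using h01 DERIV_imp_continuous_on_UNIV[OF h(1)] by blast
  qed
  fix x :: real
  let ?F = "\<lambda>x. measure M {\<omega> \<in> space M. ?S \<omega> \<le> x}" and ?G = "\<lambda>x. measure N {\<omega> \<in> space N. X \<omega> \<le> x}"
  have sandwich: "measure P {\<omega> \<in> space P. Y \<omega> \<le> x} \<le> (\<integral>\<omega>. h (Y \<omega>) \<partial>P)
      \<and> (\<integral>\<omega>. h (Y \<omega>) \<partial>P) \<le> measure P {\<omega> \<in> space P. Y \<omega> \<le> x + 4 * \<delta>}"
    if P: "prob_space P" and Y[measurable]: "Y \<in> borel_measurable P" and hc: "continuous_on UNIV h"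
      and h01: "\<forall>y. 0 \<le> h y \<and> h y \<le> 1" and hx: "\<forall>y\<le>x. h y = 1" "\<forall>y>x + 4 * \<delta>. h y = 0"
    for P :: "'c measure" and Y and h :: "real \<Rightarrow> real" and x
  proof -
    interpret P: prob_space P by (rule P)
    have hm: "h \<in> borel_measurable borel" by (rule borel_measurable_continuous_onI[OF hc])
    have i: "integrable P (\<lambda>\<omega>. h (Y \<omega>))"
      by (rule continuous_bounded_integrable[OF P Y hm, of 1]) (use h01 in auto)
    have ind: "integrable P (indicator {\<omega> \<in> space P. Y \<omega> \<le> z} :: _ \<Rightarrow> real)" for z
      by (rule integrable_real_indicator) (auto simp: P.emeasure_eq_measure)
    have m: "measure P {\<omega> \<in> space P. Y \<omega> \<le> z} = (\<integral>\<omega>. indicator {\<omega> \<in> space P. Y \<omega> \<le> z} \<omega> \<partial>P)" for z by simp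
    have "(\<integral>\<omega>. indicator {\<omega> \<in> space P. Y \<omega> \<le> x} \<omega> \<partial>P) \<le> (\<integral>\<omega>. h (Y \<omega>) \<partial>P)"
      by (rule integral_mono[OF ind i]) (use h01 hx in \<open>auto simp: indicator_def\<close>)
    moreover have "(\<integral>\<omega>. h (Y \<omega>) \<partial>P) \<le> (\<integral>\<omega>. indicator {\<omega> \<in> space P. Y \<omega> \<le> x + 4 * \<delta>} \<omega> \<partial>P)"
      by (rule integral_mono[OF i ind]) (use h01 hx in \<open>auto simp: indicator_def not_le\<close>)
    ultimately show ?thesis unfolding m by simp
  qed
  have incr: "?G (y + 4 * \<delta>) \<le> ?G y + 6 * gauss_const * rate n" for y
  proof -
    have "?G (y + 4 * \<delta>) = measure N ({\<omega> \<in> space N. X \<omega> \<le> y} \<union> {\<omega> \<in> space N. y < X \<omega> \<and> X \<omega> \<le> y + 4 * \<delta>})"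
      using \<delta> by (intro arg_cong[where f="measure N"]) auto
    also have "\<dots> \<le> ?G y + measure N {\<omega> \<in> space N. y < X \<omega> \<and> X \<omega> \<le> y + 4 * \<delta>}"
      by (rule measure_Un_le) auto
    also have "\<dots> \<le> ?G y + 6 * gauss_const * rate n"
      using X_small_ball[OF n, of y] by (simp add: \<delta>_def)
    finally show ?thesis .
  qed
  have up: "?F x \<le> ?G x + (smooth_const + 6 * gauss_const) * rate n"
  proof -
    obtain h where h: "continuous_on UNIV h" "\<forall>y. 0 \<le> h y \<and> h y \<le> 1" "\<forall>y\<le>x. h y = 1" "\<forall>y>x + 4 * \<delta>. h y = 0"
      and e: "\<bar>(\<integral>\<omega>. h (?S \<omega>) \<partial>M) - (\<integral>\<omega>. h (X \<omega>) \<partial>N)\<bar> \<le> smooth_const * rate n"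
      using smooth[of x] by blast
    show ?thesis
      using conjunct1[OF sandwich[OF M Sm[of n] h]] conjunct2[OF sandwich[OF N Xm h]] e incr[of x]
      unfolding distrib_right by linarith
  qed
  have low: "?G x \<le> ?F x + (smooth_const + 6 * gauss_const) * rate n"
  proof -
    \<comment> \<open>For the lower bound the transition zone has to end at
      \<open>x\<close>.\<close>
    let ?y = "x - 4 * \<delta>"
    obtain h where h: "continuous_on UNIV h" "\<forall>y. 0 \<le> h y \<and> h y \<le> 1" "\<forall>y\<le>?y. h y = 1" "\<forall>y>?y + 4 * \<delta>. h y = 0"
      and e: "\<bar>(\<integral>\<omega>. h (?S \<omega>) \<partial>M) - (\<integral>\<omega>. h (X \<omega>) \<partial>N)\<bar> \<le> smooth_const * rate n"
      using smooth[of ?y] by blast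
    have y: "?y + 4 * \<delta> = x" by simp
    show ?thesis
      using conjunct2[OF sandwich[OF M Sm[of n] h]] conjunct1[OF sandwich[OF N Xm h]] e incr[of ?y]
      unfolding distrib_right y by linarith
  qed
  show "\<bar>?F x - ?G x\<bar> \<le> (smooth_const + 6 * gauss_const) * rate n" using up low by linarith
qed simp

text \<open>General test functions admit no sandwich. Instead \<open>f - h\<close> is the derivative
  of \<open>\<phi>\<close>, of size 3\<delta>, and its mean is small under both laws by their
  regularity. Continuous \<open>f\<close> come before measurable ones, as antiderivatives are
  needed.\<close>

lemma total_variation_bound:
  assumes e: "0 < e" "0 < r"
    and minor: "\<And>i A. A \<in> sets borel \<Longrightarrow> A \<subseteq> {c i - r<..<c i + r} \<Longrightarrow> e * measure lborel A \<le> measure M {\<omega> \<in> space M. Z i \<omega> \<in> A}"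
    and n: "0 < n" "4 \<le> 16 / 15 * e * r * real n"
  shows "d_tv M (S_np Z p n) N X \<le> (7 * reg_const e r + smooth_const + 5 * gauss_const) * rate n"
  unfolding d_tv_def
proof (rule cSUP_least)
  define \<delta> where "\<delta> = (rate n)\<^sup>2"
  have rt: "0 < rate n" "1 / real n \<le> rate n" using rate_powers[OF n(1)] by auto
  have \<delta>: "0 < \<delta>" using rt by (simp add: \<delta>_def)
  have sq: "sqrt \<delta> = rate n" using rt by (simp add: \<delta>_def)
  have q: "3 * \<delta> / rate n = 3 * rate n" using rt by (simp add: \<delta>_def power2_eq_square)
  let ?S = "S_np Z p n"
  have cont: "\<bar>(\<integral>\<omega>. f (?S \<omega>) \<partial>M) - (\<integral>\<omega>. f (X \<omega>) \<partial>N)\<bar> \<le> (7 * reg_const e r + smooth_const + 5 * gauss_const) * rate n"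
    if fc: "continuous_on UNIV f" and f1: "\<And>x. \<bar>f x\<bar> \<le> 1" for f :: "real \<Rightarrow> real"
  proof -
    obtain h h1 h2 h3 \<phi> where h: "\<And>x. (h has_real_derivative h1 x) (at x)" "\<And>x. (h1 has_real_derivative h2 x) (at x)"
      "\<And>x. (h2 has_real_derivative h3 x) (at x)"
      "\<And>x. \<exists>y\<in>{x..x + 3 * \<delta>}. h x = f y" "\<And>x. \<bar>h1 x\<bar> \<le> 2 / \<delta>" "\<And>x. \<bar>h3 x\<bar> \<le> 8 / \<delta> ^ 3"
      and \<phi>: "\<And>x. (\<phi> has_real_derivative f x - h x) (at x)" "\<And>x. \<bar>\<phi> x\<bar> \<le> 3 * \<delta>"
      using third_order_smoothing[OF fc f1 \<delta>] by blast
    have hb: "\<bar>h x\<bar> \<le> 1" for x using h(4)[of x] f1 by metis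
    have hc: "continuous_on UNIV h" by (rule DERIV_imp_continuous_on_UNIV[OF h(1)])
    have gc: "continuous_on UNIV (\<lambda>x. f x - h x)" by (intro continuous_intros fc hc)
    have gb: "\<bar>f x - h x\<bar> \<le> 2" for x using f1[of x] hb[of x] by linarith
    have ms: "f \<in> borel_measurable borel" "h \<in> borel_measurable borel" "(\<lambda>x. f x - h x) \<in> borel_measurable borel"
      by (auto intro!: borel_measurable_continuous_onI fc hc gc)
    have sm: "\<bar>(\<integral>\<omega>. h (?S \<omega>) \<partial>M) - (\<integral>\<omega>. h (X \<omega>) \<partial>N)\<bar> \<le> smooth_const * rate n"
      by (rule smooth_test_error[OF n(1) h(1-3) hb]) (use h(5,6) in \<open>auto simp: \<delta>_def\<close>)
    have rX: "\<bar>\<integral>\<omega>. f (X \<omega>) - h (X \<omega>) \<partial>N\<bar> \<le> gauss_const * (3 * \<delta> / sqrt \<delta> + 2 * sqrt \<delta>)"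
      by (rule double_WI_regularity[OF W X p \<phi>(1) gc \<phi>(2) gb \<delta>])
    have rZ: "\<bar>\<integral>\<omega>. f (?S \<omega>) - h (?S \<omega>) \<partial>M\<bar> \<le> reg_const e r * (3 * \<delta> / sqrt \<delta> + 2 * (sqrt \<delta> + 1 / real n))"
      unfolding expectation_Z[OF n(1) ms(3)]
    proof (rule quadratic_form_regularity[where c="\<lambda>i. c (Suc i)" and n="real n", OF law e])
      show "e * measure lborel A \<le> measure (distr M borel (Z (Suc j))) A"
        if "A \<in> sets borel" "A \<subseteq> {c (Suc j) - r<..<c (Suc j) + r}" for j A
        using minor[OF that] measure_distr[OF Z that(1), of "Suc j"]
        by (simp add: vimage_def Int_def conj_commute)
      show "1 / real n \<le> kcoeff p n i j" if "i \<in> {..<n}" "j \<in> {..<n}" "i \<noteq> j" for i j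
        by (rule kcoeff_ge[OF p(1)]) (use that in auto)
    qed (use n \<phi> gc gb \<delta> in \<open>auto simp: kcoeff_diag kcoeff_sym\<close>)
    \<comment> \<open>3 from the size of \<open>\<phi>\<close>, and 2 each from sqrt \<delta> and
      from 1/n, which is at most \<open>rate n\<close>. For \<open>X\<close>, without the term 1/n,
      the count is 5.\<close>
    have "reg_const e r * (3 * \<delta> / sqrt \<delta> + 2 * (sqrt \<delta> + 1 / real n)) \<le> reg_const e r * (7 * rate n)"
    proof (intro mult_left_mono reg_const_nonneg e)
      have "3 * x + 2 * (x + k) \<le> 7 * x" if "k \<le> x" for k x :: real using that by (simp add: algebra_simps)
      then show "3 * \<delta> / sqrt \<delta> + 2 * (sqrt \<delta> + 1 / real n) \<le> 7 * rate n" unfolding sq q using rt(2) by blast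
    qed
    then have rZ': "\<bar>\<integral>\<omega>. f (?S \<omega>) - h (?S \<omega>) \<partial>M\<bar> \<le> 7 * reg_const e r * rate n" using rZ by linarith
    have rX': "\<bar>\<integral>\<omega>. f (X \<omega>) - h (X \<omega>) \<partial>N\<bar> \<le> 5 * gauss_const * rate n"
      using rX unfolding sq q by (simp add: algebra_simps)
    have iZ: "(\<integral>\<omega>. f (?S \<omega>) - h (?S \<omega>) \<partial>M) = (\<integral>\<omega>. f (?S \<omega>) \<partial>M) - (\<integral>\<omega>. h (?S \<omega>) \<partial>M)"
      by (intro Bochner_Integration.integral_diff continuous_bounded_integrable[OF M Sm ms(1) f1]
          continuous_bounded_integrable[OF M Sm ms(2) hb])
    have iX: "(\<integral>\<omega>. f (X \<omega>) - h (X \<omega>) \<partial>N) = (\<integral>\<omega>. f (X \<omega>) \<partial>N) - (\<integral>\<omega>. h (X \<omega>) \<partial>N)"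
      by (intro Bochner_Integration.integral_diff continuous_bounded_integrable[OF N Xm ms(1) f1]
          continuous_bounded_integrable[OF N Xm ms(2) hb])
    show ?thesis using sm rZ' rX' unfolding iZ iX distrib_right by linarith
  qed
  show "\<bar>(\<integral>\<omega>. f (?S \<omega>) \<partial>M) - (\<integral>\<omega>. f (X \<omega>) \<partial>N)\<bar> \<le> (7 * reg_const e r + smooth_const + 5 * gauss_const) * rate n"
    if "f \<in> {f. f \<in> borel_measurable borel \<and> (\<forall>x. \<bar>f x\<bar> \<le> 1)}" for f
    by (rule continuous_to_measurable_test[OF M N Sm Xm cont]) (use that in auto)
  show "{f :: real \<Rightarrow> real. f \<in> borel_measurable borel \<and> (\<forall>x. \<bar>f x\<bar> \<le> 1)} \<noteq> {}"
    by (auto intro!: exI[of _ "\<lambda>_. 0"])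
qed

text \<open>Passing to |C| makes the constant nonnegative, so that lowering the exponent can only
  increase the bound.\<close>

lemma rate_le:
  assumes "0 < n" "a \<le> (1 - 2 * p) / 15"
  shows "C * rate n \<le> \<bar>C\<bar> * real n powr (- a)"
proof -
  have "rate n \<le> real n powr (- a)" unfolding rate_def using assms by (intro powr_mono) auto
  then have "\<bar>C\<bar> * rate n \<le> \<bar>C\<bar> * real n powr (- a)" by (intro mult_left_mono) auto
  moreover have "C * rate n \<le> \<bar>C\<bar> * rate n" using rate_powers(1)[OF assms(1)] by (intro mult_right_mono) auto
  ultimately show ?thesis by linarith
qed

end

theorem theorem4p2:
  fixes M :: "'a measure" and Z :: "nat \<Rightarrow> 'a \<Rightarrow> real" and p :: real
    and N :: "'b measure" and W :: "real \<Rightarrow> 'b \<Rightarrow> real" and X :: "'b \<Rightarrow> real"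
  assumes "prob_space M"
    and "\<And>i. Z i \<in> borel_measurable M"
    and "prob_space.indep_vars M (\<lambda>_. borel) Z UNIV"
    and "\<And>i. (\<integral>\<omega>. Z i \<omega> \<partial>M) = 0"
    and "\<And>i. (\<integral>\<omega>. (Z i \<omega>)\<^sup>2 \<partial>M) = 1"
    and "\<And>q. q \<ge> 1 \<Longrightarrow> \<exists>B. \<forall>i. integrable M (\<lambda>\<omega>. \<bar>Z i \<omega>\<bar> powr q) \<and>
                                    (\<integral>\<omega>. \<bar>Z i \<omega>\<bar> powr q \<partial>M) \<le> B"
    and "0 < p" and "p < 1/2"
    and "std_BM N W"
    and "is_double_WI N W (psi p) X"
  shows "(\<forall>\<theta>. 1/4 < \<theta> \<and> \<theta> < 1 \<longrightarrow>
           (\<exists>n0 C. \<forall>n\<ge>n0. d_kol M (S_np Z p n) N X \<le> C * real n powr (- (\<theta> * (1 - 2 * p) / 15))))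
       \<and> ((\<exists>\<epsilon> r R x. \<epsilon> > 0 \<and> r > 0 \<and> R > 0 \<and> (\<forall>i. \<bar>x i\<bar> \<le> R) \<and>
             (\<forall>i A. A \<in> sets borel \<and> A \<subseteq> {x i - r <..< x i + r} \<longrightarrow>
                 measure M {\<omega> \<in> space M. Z i \<omega> \<in> A} \<ge> \<epsilon> * measure lborel A))
          \<longrightarrow> (\<forall>\<theta>. 1/4 < \<theta> \<and> \<theta> < 1 \<longrightarrow>
           (\<exists>n0 C. \<forall>n\<ge>n0. d_tv M (S_np Z p n) N X \<le>
                  C * real n powr (- min (\<theta> / 26) (\<theta> * (1 - 2 * p) / 15)))))"
proof -
  interpret prob_space M by fact
  obtain B where B: "\<And>i. integrable M (\<lambda>\<omega>. \<bar>Z i \<omega>\<bar> powr 4) \<and> (\<integral>\<omega>. \<bar>Z i \<omega>\<bar> powr 4 \<partial>M) \<le> B"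
    using assms(6)[of 4] by auto
  \<comment> \<open>The moment hypothesis is stated with \<open>powr\<close>; at 0 both sides are
    0.\<close>
  have p4: "\<bar>z\<bar> powr 4 = z ^ 4" for z :: real
    using powr_realpow'[of "\<bar>z\<bar>" 4] by (simp add: power_even_abs)
  \<comment> \<open>At least 3, the fourth moment of the standard normal law, so that the Gaussian
    variables meet the same bound.\<close>
  define K where "K = max 3 B"
  have law: "std_law K (distr M borel (Z i))" for i
  proof -
    have [measurable]: "Z i \<in> borel_measurable M" by (rule assms(2))
    have B4: "integrable M (\<lambda>\<omega>. Z i \<omega> ^ 4)" "(\<integral>\<omega>. Z i \<omega> ^ 4 \<partial>M) \<le> B"
      using B[of i] unfolding p4 by auto
    show ?thesis
      unfolding std_law_def
    proof (intro conjI)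
      show "prob_space (distr M borel (Z i))" by (rule prob_space_distr) measurable
      show "integrable (distr M borel (Z i)) (\<lambda>x. x ^ 4)" using B4 by (subst integrable_distr_eq) auto
      show "(\<integral>x. x \<partial>distr M borel (Z i)) = 0" using assms(4) by (subst integral_distr) auto
      show "(\<integral>x. x\<^sup>2 \<partial>distr M borel (Z i)) = 1" using assms(5) by (subst integral_distr) auto
      show "(\<integral>x. x ^ 4 \<partial>distr M borel (Z i)) \<le> K" using B4 by (subst integral_distr) (auto simp: K_def)
    qed simp
  qed
  interpret quadratic_limit M Z p K N W X
    by (rule quadratic_limit.intro[OF assms(1-3) law _ assms(7-10)]) (simp add: K_def)
  show ?thesis
  proof (intro conjI allI impI)
    fix \<theta> :: real assume \<theta>: "1 / 4 < \<theta> \<and> \<theta> < 1"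
    \<comment> \<open>The exponent of \<open>rate\<close> is at least the claimed one, so the
      constant can be chosen independently of \<theta>.\<close>
    have a: "\<theta> * (1 - 2 * p) / 15 \<le> (1 - 2 * p) / 15" using \<theta> p by (simp add: divide_right_mono)
    have "d_kol M (S_np Z p n) N X \<le> \<bar>smooth_const + 6 * gauss_const\<bar> * real n powr (- (\<theta> * (1 - 2 * p) / 15))"
      if "1 \<le> n" for n
      by (rule order_trans[OF Kolmogorov_bound rate_le[OF _ a]]) (use that in auto)
    then show "\<exists>n0 C. \<forall>n\<ge>n0. d_kol M (S_np Z p n) N X \<le> C * real n powr (- (\<theta> * (1 - 2 * p) / 15))"
      by (intro exI[of _ 1] exI[of _ "\<bar>smooth_const + 6 * gauss_const\<bar>"] allI impI)
  next
    fix \<theta> :: real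
    assume "\<exists>\<epsilon> r R x. \<epsilon> > 0 \<and> r > 0 \<and> R > 0 \<and> (\<forall>i. \<bar>x i\<bar> \<le> R) \<and>
             (\<forall>i A. A \<in> sets borel \<and> A \<subseteq> {x i - r <..< x i + r} \<longrightarrow>
                 measure M {\<omega> \<in> space M. Z i \<omega> \<in> A} \<ge> \<epsilon> * measure lborel A)"
    then obtain e r R c where H: "e > 0 \<and> r > 0 \<and> R > 0 \<and> (\<forall>i. \<bar>c i\<bar> \<le> R) \<and>
             (\<forall>i A. A \<in> sets borel \<and> A \<subseteq> {c i - r <..< c i + r} \<longrightarrow>
                 measure M {\<omega> \<in> space M. Z i \<omega> \<in> A} \<ge> e * measure lborel A)"
      by (elim exE)
    then have e: "0 < e" "0 < r" by simp_all
    have minor: "e * measure lborel A \<le> measure M {\<omega> \<in> space M. Z i \<omega> \<in> A}"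
      if "A \<in> sets borel" "A \<subseteq> {c i - r<..<c i + r}" for i A
      using H that by (elim conjE) (simp only: simp_thms)
    assume \<theta>: "1 / 4 < \<theta> \<and> \<theta> < 1"
    let ?a = "min (\<theta> / 26) (\<theta> * (1 - 2 * p) / 15)" and ?C = "7 * reg_const e r + smooth_const + 5 * gauss_const"
    have "\<theta> * (1 - 2 * p) / 15 \<le> (1 - 2 * p) / 15" using \<theta> p by (simp add: divide_right_mono)
    then have a: "?a \<le> (1 - 2 * p) / 15" by linarith
    \<comment> \<open>From \<open>n0\<close> on, the expected number of labels \<open>True\<close>
      is at least 4, as the regularity estimate requires.\<close>
    obtain n0 :: nat where n0: "4 / (16 / 15 * e * r) < real n0" using reals_Archimedean2 by blast
    have "d_tv M (S_np Z p n) N X \<le> \<bar>?C\<bar> * real n powr (- ?a)" if n: "max 1 n0 \<le> n" for n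
    proof -
      have "0 < n" using n by simp
      moreover have "4 / (16 / 15 * e * r) \<le> real n" using n n0 by linarith
      then have "4 \<le> 16 / 15 * e * r * real n" using e by (simp add: field_simps)
      ultimately show ?thesis
        by (intro order_trans[OF total_variation_bound[where e=e and r=r and c=c, OF e minor] rate_le[OF _ a]])
    qed
    then show "\<exists>n0 C. \<forall>n\<ge>n0. d_tv M (S_np Z p n) N X \<le> C * real n powr (- ?a)"
      by (intro exI[of _ "max 1 n0"] exI[of _ "\<bar>?C\<bar>"] allI impI)
  qed
qed

end
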